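(* Let $G$ be a finite solvable group, let $p$ be a prime, and let $P$ be a Sylow $p$-subgroup of $G$. Then $p$ is a prime divisor of $|K(G)|$ if and only if one of the following situations occurs: (1) $P$ is cyclic and $Z(G)\cap P\neq 1$. (2) The prime $p=2$ and one of the following situations occurs: (a) $P$ is generalized quaternion, $G$ has a normal $2$-complement $Q$, and $Z(P)\le C_P(Q)$. (b) $Z(P)\le C_P(O_{2'}(G))$ and $G/O_{2'}(G)$ is isomorphic to either $\mathrm{SL}_2(3)$ or $\widetilde{\mathrm{GL}}_2(3)$. If in addition $3$ divides $|K(G)|$, then $G/O_{2'}(G)\cong \mathrm{SL}_2(3)$. Moreover, if conclusion (2) occurs, then $|K(G)|_2=2$.
   Context: For a finite group $G$, $K(G)=\{x\in G \mid \langle x,g\rangle \text{ is cyclic for all } g\in G\}$; this set is a subgroup of $G$ contained in the center $Z(G)$. $O_{2'}(G)$ is the largest normal subgroup of $G$ of odd order. A normal $2$-complement of $G$ is a normal subgroup of odd order whose index in $G$ is a power of $2$. $C_P(X)$ denotes the centralizer of $X$ in $P$. $|K(G)|_2$ denotes the largest power of $2$ dividing $|K(G)|$. Generalized quaternion groups are those of order $2^n$ with $n\ge 3$ (including the quaternion group of order $8$). $\mathrm{SL}_2(3)$ is the special linear group of degree $2$ over the field with $3$ elements. $\widetilde{\mathrm{GL}}_2(3)$ denotes the group of order $48$ that is isoclinic to $\mathrm{GL}_2(3)$ and has a generalized quaternion group of order $16$ as a Sylow $2$-subgroup. *)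

theory Defs
  imports
    "HOL-Algebra.Algebra"
    "HOL-Analysis.Determinants"
    "HOL-Computational_Algebra.Primes"
begin

definition cyclicizer :: "('a, 'b) monoid_scheme \<Rightarrow> 'a set" where
  "cyclicizer G = {x \<in> carrier G. \<forall>g\<in>carrier G. cyclic_group (subgroup_generated G {x, g})}"

definition group_center :: "('a, 'b) monoid_scheme \<Rightarrow> 'a set" where
  "group_center G = {z \<in> carrier G. \<forall>x\<in>carrier G. z \<otimes>\<^bsub>G\<^esub> x = x \<otimes>\<^bsub>G\<^esub> z}"

definition centralizer_in :: "('a, 'b) monoid_scheme \<Rightarrow> 'a set \<Rightarrow> 'a set \<Rightarrow> 'a set" where
  "centralizer_in G P S = {x \<in> P. \<forall>y\<in>S. x \<otimes>\<^bsub>G\<^esub> y = y \<otimes>\<^bsub>G\<^esub> x}"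

definition sylow_subgroup :: "nat \<Rightarrow> 'a set \<Rightarrow> ('a, 'b) monoid_scheme \<Rightarrow> bool" where
  "sylow_subgroup p P G \<longleftrightarrow> subgroup P G \<and> card P = p ^ multiplicity p (order G)"

definition normal_two_complement :: "'a set \<Rightarrow> ('a, 'b) monoid_scheme \<Rightarrow> bool" where
  "normal_two_complement Q G \<longleftrightarrow>
     Q \<lhd> G \<and> odd (card Q) \<and> (\<exists>n::nat. card (rcosets\<^bsub>G\<^esub> Q) = 2 ^ n)"

text \<open>\<open>odd_core G\<close> is $O_{2'}(G)$, the largest normal subgroup of odd order. The description
  is proper for every finite group, by \<open>ex1_largest_odd_normal\<close> below.\<close>

definition odd_core :: "('a, 'b) monoid_scheme \<Rightarrow> 'a set" where
  "odd_core G = (THE N. N \<lhd> G \<and> odd (card N) \<and> (\<forall>M. M \<lhd> G \<and> odd (card M) \<longrightarrow> M \<subseteq> N))"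

text \<open>The presentation
  $\langle a, b \mid a^{2^{n-1}} = 1,\ b^2 = a^{2^{n-2}},\ b^{-1} a b = a^{-1} \rangle$
  defines a group of order exactly $2^n$, so a group of order $2^n$ generated by two elements
  satisfying the relations is the group presented.\<close>

definition generalized_quaternion :: "('a, 'b) monoid_scheme \<Rightarrow> bool" where
  "generalized_quaternion H \<longleftrightarrow> group H \<and>
     (\<exists>n::nat. n \<ge> 3 \<and> order H = 2 ^ n \<and>
       (\<exists>a\<in>carrier H. \<exists>b\<in>carrier H.
          generate H {a, b} = carrier H \<and>
          a [^]\<^bsub>H\<^esub> (2 ^ (n - 1) :: nat) = \<one>\<^bsub>H\<^esub> \<and>
          b [^]\<^bsub>H\<^esub> (2 :: nat) = a [^]\<^bsub>H\<^esub> (2 ^ (n - 2) :: nat) \<and>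
          inv\<^bsub>H\<^esub> b \<otimes>\<^bsub>H\<^esub> a \<otimes>\<^bsub>H\<^esub> b = inv\<^bsub>H\<^esub> a))"

definition GL :: "('a::comm_ring_1 ^ 'n ^ 'n) monoid" where
  "GL = \<lparr>carrier = {A. invertible A}, monoid.mult = (**), one = mat 1\<rparr>"

definition SL :: "('a::comm_ring_1 ^ 'n ^ 'n) monoid" where
  "SL = \<lparr>carrier = {A. det A = 1}, monoid.mult = (**), one = mat 1\<rparr>"

text \<open>The numeral type \<open>3\<close> is the ring of integers modulo 3, that is, the field with 3 elements.\<close>

abbreviation GL\<^sub>2_3 :: "(3 ^ 2 ^ 2) monoid" where "GL\<^sub>2_3 \<equiv> GL"

abbreviation SL\<^sub>2_3 :: "(3 ^ 2 ^ 2) monoid" where "SL\<^sub>2_3 \<equiv> SL"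

definition commutator :: "('a, 'b) monoid_scheme \<Rightarrow> 'a \<Rightarrow> 'a \<Rightarrow> 'a" where
  "commutator G x y = x \<otimes>\<^bsub>G\<^esub> y \<otimes>\<^bsub>G\<^esub> inv\<^bsub>G\<^esub> x \<otimes>\<^bsub>G\<^esub> inv\<^bsub>G\<^esub> y"

text \<open>Isoclinism in the sense of P. Hall: isomorphisms $\varphi : G/Z(G) \to H/Z(H)$ and
  $\psi : [G,G] \to [H,H]$ that are compatible with the commutator maps.\<close>

definition isoclinic :: "('a, 'c) monoid_scheme \<Rightarrow> ('b, 'd) monoid_scheme \<Rightarrow> bool" where
  "isoclinic G H \<longleftrightarrow>
     (\<exists>\<phi> \<psi>. \<phi> \<in> iso (G Mod group_center G) (H Mod group_center H) \<and>
        \<psi> \<in> iso (G\<lparr>carrier := derived G (carrier G)\<rparr>) (H\<lparr>carrier := derived H (carrier H)\<rparr>) \<and>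
        (\<forall>g\<^sub>1\<in>carrier G. \<forall>g\<^sub>2\<in>carrier G. \<forall>h\<^sub>1\<in>carrier H. \<forall>h\<^sub>2\<in>carrier H.
           \<phi> (group_center G #>\<^bsub>G\<^esub> g\<^sub>1) = group_center H #>\<^bsub>H\<^esub> h\<^sub>1 \<longrightarrow>
           \<phi> (group_center G #>\<^bsub>G\<^esub> g\<^sub>2) = group_center H #>\<^bsub>H\<^esub> h\<^sub>2 \<longrightarrow>
           \<psi> (commutator G g\<^sub>1 g\<^sub>2) = commutator H h\<^sub>1 h\<^sub>2))"

text \<open>The group $\widetilde{\mathrm{GL}}_2(3)$ is determined up to isomorphism by the following
  properties, all of which are isomorphism invariant. Hence being isomorphic to it is the same as
  having them.\<close>

definition is_GL\<^sub>2_3_tilde :: "('a, 'b) monoid_scheme \<Rightarrow> bool" where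
  "is_GL\<^sub>2_3_tilde H \<longleftrightarrow> group H \<and> order H = 48 \<and> isoclinic H GL\<^sub>2_3 \<and>
     (\<exists>S. sylow_subgroup 2 S H \<and> card S = 16 \<and> generalized_quaternion (H\<lparr>carrier := S\<rparr>))"

lemma group_GL: "group (GL :: ('a::comm_ring_1 ^ 'n ^ 'n) monoid)"
proof (rule groupI)
  fix x :: "'a ^ 'n ^ 'n" assume "x \<in> carrier GL"
  then obtain y where "x ** y = mat 1" "y ** x = mat 1"
    by (auto simp: GL_def invertible_def)
  then show "\<exists>y\<in>carrier GL. y \<otimes>\<^bsub>GL\<^esub> x = \<one>\<^bsub>GL\<^esub>"
    by (auto simp: GL_def invertible_def)
next
  show "\<one>\<^bsub>GL\<^esub> \<in> carrier (GL :: ('a ^ 'n ^ 'n) monoid)"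
    by (auto simp: GL_def invertible_def intro!: exI[of _ "mat 1"])
qed (auto simp: GL_def matrix_mul_assoc invertible_mult)

lemma (in group) odd_card_normal_mult:
  assumes fin: "finite (carrier G)" and N: "N \<lhd> G" "odd (card N)" and M: "M \<lhd> G" "odd (card M)"
  shows "odd (card (N <#> M))"
proof -
  have sN: "subgroup N G" and sM: "subgroup M G"
    using N M by (auto simp: normal_def)
  have so: "second_isomorphism_grp N G M"
    using N(1) sM by (simp add: second_isomorphism_grp_def second_isomorphism_grp_axioms_def)
  define H where "H = G\<lparr>carrier := N <#> M\<rparr>"
  define L where "L = G\<lparr>carrier := M\<rparr>"
  have sNM: "subgroup (N <#> M) G"
    using second_isomorphism_grp.normal_set_mult_subgroup[OF so] .
  then have gH: "group H" unfolding H_def by (rule subgroup_imp_group)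
  have gL: "group L" unfolding L_def by (rule subgroup_imp_group[OF sM])
  have fH: "finite (carrier H)" and fL: "finite (carrier L)"
    using fin subgroup.subset[OF sNM] subgroup.subset[OF sM]
    by (auto simp: H_def L_def intro: finite_subset)
  have NH: "subgroup N H"
    using second_isomorphism_grp.H_contained_in_set_mult[OF so] sN sNM by (simp add: H_def subgroup_incl)
  have NL: "subgroup (N \<inter> M) L"
    using second_isomorphism_grp.normal_subgrp_intersection_normal[OF so] by (simp add: L_def normal_def Int_commute)
  have "H Mod N \<cong> L Mod (N \<inter> M) \<or> L Mod (N \<inter> M) \<cong> H Mod N"
    using second_isomorphism_grp.normal_intersection_quotient_isom[OF so]
    by (auto simp: H_def L_def is_iso_def Int_commute)
  then have "card (rcosets\<^bsub>H\<^esub> N) = card (rcosets\<^bsub>L\<^esub> (N \<inter> M))"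
    using iso_same_card by (fastforce simp: FactGroup_def)
  moreover have "card (rcosets\<^bsub>L\<^esub> (N \<inter> M)) * card (N \<inter> M) = card M"
    using group.lagrange[OF gL NL] by (simp add: order_def L_def)
  moreover have "card (rcosets\<^bsub>H\<^esub> N) * card N = card (N <#> M)"
    using group.lagrange[OF gH NH] by (simp add: order_def H_def)
  ultimately show ?thesis using N(2) M(2) by (metis even_mult_iff)
qed

lemma (in group) ex1_largest_odd_normal:
  assumes fin: "finite (carrier G)"
  shows "\<exists>!N. N \<lhd> G \<and> odd (card N) \<and> (\<forall>M. M \<lhd> G \<and> odd (card M) \<longrightarrow> M \<subseteq> N)"
proof -
  define \<N> where "\<N> = {N. N \<lhd> G \<and> odd (card N)}"
  have sub: "N \<subseteq> carrier G" if "N \<in> \<N>" for N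
    using that by (auto simp: \<N>_def normal_def dest: subgroup.subset)
  then have "\<N> \<subseteq> Pow (carrier G)" by auto
  then have "finite \<N>" using fin by (simp add: finite_subset)
  moreover have "{\<one>} \<in> \<N>" by (simp add: \<N>_def one_is_normal)
  ultimately obtain N where N: "N \<in> \<N>" and max: "\<And>M. M \<in> \<N> \<Longrightarrow> N \<subseteq> M \<Longrightarrow> N = M"
    by (metis finite_has_maximal empty_iff)
  have "M \<subseteq> N" if M: "M \<in> \<N>" for M
  proof -
    have sM: "subgroup M G" and sN: "subgroup N G"
      using M N by (auto simp: \<N>_def normal_def)
    have so: "second_isomorphism_grp N G M"
      using N sM by (simp add: \<N>_def second_isomorphism_grp_def second_isomorphism_grp_axioms_def)
    have "N <#> M \<lhd> G"
      using M N by (auto simp: \<N>_def intro: normal_subgroup_set_mult_closed)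
    then have "N <#> M \<in> \<N>"
      using odd_card_normal_mult[OF fin] M N by (auto simp: \<N>_def)
    moreover have "N \<subseteq> N <#> M" "M \<subseteq> N <#> M"
      using second_isomorphism_grp.H_contained_in_set_mult[OF so] second_isomorphism_grp.S_contained_in_set_mult[OF so] N by (auto simp: \<N>_def)
    ultimately show ?thesis using max by blast
  qed
  then show ?thesis using N by (intro ex1I[of _ N]) (auto simp: \<N>_def)
qed

lemma (in group) odd_core:
  assumes "finite (carrier G)"
  shows odd_core_normal: "odd_core G \<lhd> G"
    and odd_core_odd: "odd (card (odd_core G))"
    and odd_core_largest: "M \<lhd> G \<Longrightarrow> odd (card M) \<Longrightarrow> M \<subseteq> odd_core G"
  using theI'[OF ex1_largest_odd_normal[OF assms]] unfolding odd_core_def by blast+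

end

theory Submission
  imports Defs "HOL-Number_Theory.Number_Theory"
begin

text \<open>A prime \<open>p\<close> divides \<open>|K(G)|\<close> iff \<open>G\<close> has a unique subgroup \<open>\<langle>z\<rangle>\<close> of order \<open>p\<close> and it is central. In that
  case a Sylow \<open>p\<close>-subgroup has a unique subgroup of order \<open>p\<close>, so it is cyclic or generalized quaternion.

  In the quaternion case \<open>H = G/O\<^sub>2\<^sub>'(G)\<close> is solvable with a unique involution \<open>t\<close> and no nontrivial normal
  subgroup of odd order, so its 2-core \<open>F\<close> contains its own centralizer. If \<open>F\<close> is not the quaternion
  group of order 8, elements of odd order centralize \<open>F\<close> and \<open>H\<close> is a 2-group. Otherwise \<open>H\<close> acts on the
  24 pairs of noncommuting elements of \<open>F\<close>, and the point stabilizers are \<open>\<langle>t\<rangle>\<close>. So \<open>|H|\<close> is 24 or 48,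
  and the action provides elements satisfying the relations of \<open>SL\<^sub>2(3)\<close> or of \<open>GL\<^sub>2(3)\<close> up to the
  value of one square; that ambiguity disappears under isoclinism.

  Conversely, an involution of \<open>Z(P)\<close> that centralizes a normal subgroup \<open>N\<close> of odd order and is the
  only involution modulo \<open>N\<close> is the only involution of \<open>G\<close>. If moreover 3 divides \<open>|K(G)|\<close> and \<open>|H| = 48\<close>, then
  an element of order 3 of \<open>H\<close> that lifts to a generator of a cyclic Sylow 3-subgroup \<open>R\<close> of \<open>G\<close> is inverted in \<open>H\<close>.
  By the Frattini argument it is inverted by an element normalizing \<open>R\<close>, which must centralize the subgroup of order 3 of \<open>R\<close>,
  a contradiction.\<close>

section \<open>Group actions and Sylow subgroups\<close>

text \<open>The 24 pairs stand in for Aut(Q_8): an automorphism is determined by the images of two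
  generators, with 6 choices for the first and then 4 for the second, so no automorphism group has
  to be formed. The comparison with the matrix groups uses no formula for a map. Corresponding
  generators are paired inside the direct product; the pairs satisfy the same relations, which bound
  the subgroup they generate, and equality of sizes makes it the graph of an isomorphism. In order
  48 the square of \<open>d\<close> is not fixed by the relations, so the full subgroup need not be
  a graph. Its derived subgroup still is one, which is what isoclinism asks for; the quaternion
  Sylow subgroup then singles out one group of the isoclinism class. For the p-groups the question
  is whether some \<open>a^t x\<close> outside a self-centralizing normal cyclic subgroup
  \<open>\<langle>a\<rangle>\<close> has trivial p-th power. If \<open>x\<close> acts by
  \<open>a -> a^s\<close> and \<open>x^p = a^e\<close>, this asks for
  \<open>t (1 + s + ... + s^(p-1)) + e = 0\<close> modulo \<open>ord a\<close>. The equation is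
  solvable unless \<open>p = 2\<close> and \<open>s = 3\<close> modulo 4, and this exception is the
  source of the quaternion groups.\<close>

locale fin_group = group +
  assumes fin [simp]: "finite (carrier G)"

section \<open>Conjugation as a left action, and elementary facts on powers\<close>

context group
begin

lemma inv_cancel_left [simp]:
  "x \<in> carrier G \<Longrightarrow> y \<in> carrier G \<Longrightarrow> x \<otimes> (inv x \<otimes> y) = y"
  "x \<in> carrier G \<Longrightarrow> y \<in> carrier G \<Longrightarrow> inv x \<otimes> (x \<otimes> y) = y"
  by (simp_all flip: m_assoc)

lemmas grp_simps = m_assoc inv_mult_group

definition conjugate :: "'a \<Rightarrow> 'a \<Rightarrow> 'a" where
  "conjugate g x = g \<otimes> x \<otimes> inv g"

lemma conjugate_closed [simp]:
  "g \<in> carrier G \<Longrightarrow> x \<in> carrier G \<Longrightarrow> conjugate g x \<in> carrier G"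
  by (simp add: conjugate_def)

lemma conjugate_mult:
  assumes "g \<in> carrier G" "x \<in> carrier G" "y \<in> carrier G"
  shows "conjugate g (x \<otimes> y) = conjugate g x \<otimes> conjugate g y"
  using assms by (simp add: conjugate_def grp_simps)

lemma conjugate_conjugate:
  assumes "g \<in> carrier G" "h \<in> carrier G" "x \<in> carrier G"
  shows "conjugate (g \<otimes> h) x = conjugate g (conjugate h x)"
  using assms by (simp add: conjugate_def grp_simps)

lemma conjugate_one [simp]: "g \<in> carrier G \<Longrightarrow> conjugate g \<one> = \<one>" "x \<in> carrier G \<Longrightarrow> conjugate \<one> x = x"
  by (simp_all add: conjugate_def)

lemma conjugate_inv:
  assumes "g \<in> carrier G" "x \<in> carrier G"
  shows "conjugate g (inv x) = inv (conjugate g x)"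
  using assms by (simp add: conjugate_def grp_simps)

lemma conjugate_pow:
  fixes n :: nat
  assumes "g \<in> carrier G" "x \<in> carrier G"
  shows "conjugate g (x [^] n) = conjugate g x [^] n"
  using assms by (induction n) (simp_all add: conjugate_mult)

lemma conjugate_cancel [simp]:
  assumes "g \<in> carrier G" "x \<in> carrier G"
  shows "conjugate g (conjugate (inv g) x) = x" "conjugate (inv g) (conjugate g x) = x"
  using assms by (simp_all add: conjugate_def grp_simps)

lemma conjugate_eq_iff:
  assumes "g \<in> carrier G" "x \<in> carrier G" "y \<in> carrier G"
  shows "conjugate g x = conjugate g y \<longleftrightarrow> x = y"
  using assms by (metis conjugate_cancel(2))

lemma conjugate_eq_self_iff:
  assumes "g \<in> carrier G" "x \<in> carrier G"
  shows "conjugate g x = x \<longleftrightarrow> g \<otimes> x = x \<otimes> g"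
  using assms by (metis conjugate_def inv_closed inv_solve_right m_closed)

lemma conjugate_normal: "N \<lhd> G \<Longrightarrow> g \<in> carrier G \<Longrightarrow> x \<in> N \<Longrightarrow> conjugate g x \<in> N"
  by (simp add: conjugate_def normal.inv_op_closed2)

lemma normalI_conjugate:
  assumes "subgroup N G" "\<And>g x. g \<in> carrier G \<Longrightarrow> x \<in> N \<Longrightarrow> conjugate g x \<in> N"
  shows "N \<lhd> G"
  using assms by (auto simp: normal_inv_iff conjugate_def)

lemma subgroup_pow_closed:
  fixes n :: nat
  assumes "subgroup H G" "x \<in> H" shows "x [^] n \<in> H"
  using assms by (induction n) (auto simp: subgroup.one_closed subgroup.m_closed)

lemma subgroup_pow_card:
  assumes "subgroup H G" "x \<in> H" shows "x [^] card H = \<one>"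
proof -
  interpret H: group "G\<lparr>carrier := H\<rparr>" using assms(1) by (rule subgroup_imp_group)
  show ?thesis using H.pow_order_eq_1[of x] assms(2) by (simp add: order_def flip: nat_pow_consistent)
qed

lemma pow_eq_one_coprime:
  fixes m n :: nat
  assumes "x \<in> carrier G" "x [^] m = \<one>" "x [^] n = \<one>" "coprime m n"
  shows "x = \<one>"
proof -
  have "ord x dvd 1" using assms by (metis coprime_common_divisor_nat nat_dvd_1_iff_1 pow_eq_id)
  then have "ord x = 1" by simp
  then show ?thesis using assms(1) ord_eq_1 by blast
qed

lemma pow_commute:
  fixes m n :: nat
  assumes "x \<in> carrier G" "y \<in> carrier G" "x \<otimes> y = y \<otimes> x"
  shows "x [^] n \<otimes> y = y \<otimes> x [^] n"
  using assms
proof (induction n)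
  case (Suc n)
  have "x [^] Suc n \<otimes> y = x [^] n \<otimes> (y \<otimes> x)" using Suc.prems by (simp add: m_assoc)
  also have "\<dots> = x [^] n \<otimes> y \<otimes> x" using Suc.prems(1,2) by (simp add: m_assoc)
  also have "\<dots> = y \<otimes> x [^] n \<otimes> x" using Suc by (simp only:)
  finally show ?case using Suc.prems(1,2) by (simp add: m_assoc)
qed simp

end

text \<open>The action laws make \<open>f (inv g)\<close> inverse to \<open>f g\<close>, so
  bijectivity comes for free. The \<open>restrict\<close> makes the maps extensional, as membership
  in \<open>BijGroup E\<close> demands.\<close>

lemma group_actionI:
  assumes "group G"
    and cl: "\<And>g x. g \<in> carrier G \<Longrightarrow> x \<in> E \<Longrightarrow> f g x \<in> E"
    and one: "\<And>x. x \<in> E \<Longrightarrow> f \<one>\<^bsub>G\<^esub> x = x"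
    and mult: "\<And>g h x. g \<in> carrier G \<Longrightarrow> h \<in> carrier G \<Longrightarrow> x \<in> E \<Longrightarrow> f (g \<otimes>\<^bsub>G\<^esub> h) x = f g (f h x)"
  shows "group_action G E (\<lambda>g. restrict (f g) E)"
proof -
  interpret group G by fact
  have inv: "f g (f (inv\<^bsub>G\<^esub> g) x) = x" "f (inv\<^bsub>G\<^esub> g) (f g x) = x" if "g \<in> carrier G" "x \<in> E" for g x
    using that mult[of g "inv\<^bsub>G\<^esub> g" x] mult[of "inv\<^bsub>G\<^esub> g" g x] one by auto
  have bij: "bij_betw (f g) E E" if "g \<in> carrier G" for g
    by (rule bij_betwI[of _ _ _ "f (inv\<^bsub>G\<^esub> g)"]) (use that cl inv in auto)
  have "(\<lambda>g. restrict (f g) E) \<in> hom G (BijGroup E)"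
  proof (rule homI)
    fix g h assume g: "g \<in> carrier G" "h \<in> carrier G"
    have B: "restrict (f k) E \<in> Bij E" if "k \<in> carrier G" for k
      using bij[OF that] by (auto simp: Bij_def)
    show "restrict (f g) E \<in> carrier (BijGroup E)" using B[OF g(1)] by (simp add: BijGroup_def)
    show "restrict (f (g \<otimes>\<^bsub>G\<^esub> h)) E = restrict (f g) E \<otimes>\<^bsub>BijGroup E\<^esub> restrict (f h) E"
      using B g cl by (auto simp: BijGroup_def compose_def mult fun_eq_iff)
  qed
  then show ?thesis
    by (simp add: group_action_def group_hom_def group_hom_axioms_def group_BijGroup assms(1))
qed

text \<open>Orbits of a \<open>p\<close>-group have size a power of \<open>p\<close>, so those that are not fixed points
  contribute multiples of \<open>p\<close>.\<close>

lemma p_group_fixed_points: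
  fixes p k :: nat
  assumes G: "group G" and p: "Factorial_Ring.prime p" and ord: "order G = p ^ k" and E: "finite E"
    and cl: "\<And>g x. g \<in> carrier G \<Longrightarrow> x \<in> E \<Longrightarrow> f g x \<in> E"
    and one: "\<And>x. x \<in> E \<Longrightarrow> f \<one>\<^bsub>G\<^esub> x = x"
    and mult: "\<And>g h x. g \<in> carrier G \<Longrightarrow> h \<in> carrier G \<Longrightarrow> x \<in> E \<Longrightarrow> f (g \<otimes>\<^bsub>G\<^esub> h) x = f g (f h x)"
  shows "p dvd card {x \<in> E. \<exists>g\<in>carrier G. f g x \<noteq> x}"
proof -
  define \<phi> where "\<phi> = (\<lambda>g. restrict (f g) E)"
  interpret group_action G E \<phi>
    unfolding \<phi>_def by (rule group_actionI[OF G cl one mult])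
  define M where "M = {x \<in> E. \<exists>g\<in>carrier G. f g x \<noteq> x}"
  \<comment> \<open>The points of \<open>M\<close> are counted orbit by orbit: an orbit contributes
    0 if it is a fixed point and its full size otherwise.\<close>
  have "p dvd (\<Sum>orb\<in>orbits G E \<phi>. \<Sum>x\<in>orb. if x \<in> M then 1 else 0)"
  proof (rule dvd_sum)
    fix orb assume "orb \<in> orbits G E \<phi>"
    then obtain x where x: "x \<in> E" and orb: "orb = Group_Action.orbit G \<phi> x" by (auto simp: orbits_def)
    have orb': "orb = {f g x |g. g \<in> carrier G}" using x by (simp add: orb Group_Action.orbit_def \<phi>_def)
    have oE: "orb \<subseteq> E" using x cl by (auto simp: orb')
    show "p dvd (\<Sum>x\<in>orb. if x \<in> M then 1 else 0)"
    proof (cases "x \<in> M")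
      case False
      then have "orb \<subseteq> {x}" using x by (auto simp: orb' M_def)
      then have "(\<Sum>x\<in>orb. if x \<in> M then 1 else 0) = (0::nat)" using False by (intro sum.neutral) auto
      then show ?thesis by simp
    next
      case True
      \<comment> \<open>If one point of the orbit were fixed by the whole group, it would be fixed
        by the element leading back to \<open>x\<close>, so \<open>x\<close> would be that fixed
        point.\<close>
      have "orb \<subseteq> M"
      proof
        fix y assume y: "y \<in> orb"
        then obtain g where g: "g \<in> carrier G" "y = f g x" by (auto simp: orb')
        obtain h where h: "h \<in> carrier G" "f h x \<noteq> x" using True by (auto simp: M_def)
        show "y \<in> M"
        proof (rule ccontr)
          assume "y \<notin> M"
          then have fx: "\<And>k. k \<in> carrier G \<Longrightarrow> f k y = y" using y oE by (auto simp: M_def)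
          have "x = f (inv\<^bsub>G\<^esub> g) y"
            using g x mult[of "inv\<^bsub>G\<^esub> g" g x] one G by (simp add: group.l_inv group.inv_closed)
          then have "x = y" using fx g G by (simp add: group.inv_closed)
          then show False using fx h by simp
        qed
      qed
      then have "(\<Sum>x\<in>orb. if x \<in> M then 1 else 0) = card orb"
        by (subst sum.cong[of orb orb _ "\<lambda>_. 1"]) auto
      moreover have "card orb dvd p ^ k" using orbit_stabilizer_theorem[OF x] orb ord by (metis dvd_triv_left)
      then obtain j where "card orb = p ^ j" using p by (meson divides_primepow_nat)
      moreover have "card orb \<noteq> 1"
      proof
        assume "card orb = 1"
        then obtain z where "orb = {z}" by (auto simp: card_1_singleton_iff)
        moreover have "x \<in> orb" using one[OF x] group.is_monoid[OF G] by (auto simp: orb' intro!: exI[of _ "\<one>\<^bsub>G\<^esub>"] monoid.one_closed)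
        ultimately have "orb = {x}" by auto
        then show False using True by (auto simp: M_def orb')
      qed
      ultimately show ?thesis by (cases j) auto
    qed
  qed
  also have "(\<Sum>orb\<in>orbits G E \<phi>. \<Sum>x\<in>orb. if x \<in> M then 1 else 0) = (\<Sum>x\<in>E. if x \<in> M then 1 else 0)"
    by (rule disjoint_sum[OF E])
  also have "\<dots> = card M" using E by (simp add: sum.If_cases M_def Int_def)
  finally show ?thesis by (simp add: M_def)
qed

section \<open>Theorems of Cauchy and Sylow\<close>

context fin_group
begin

lemma finite_subgroup [simp]: "subgroup H G \<Longrightarrow> finite H"
  using fin subgroup.subset finite_subset by blast

lemma fin_group_subgroup: "subgroup H G \<Longrightarrow> fin_group (G\<lparr>carrier := H\<rparr>)"
  by (simp add: fin_group_def fin_group_axioms_def subgroup_imp_group)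

lemma inv_eq_pow: "x \<in> carrier G \<Longrightarrow> inv x = x [^] (order G - 1)"
proof -
  assume x: "x \<in> carrier G"
  have "x [^] (order G - 1) \<otimes> x = x [^] order G"
    using fin order_gt_0_iff_finite by (metis Suc_diff_1 nat_pow_Suc)
  then show ?thesis using x pow_order_eq_1 by (intro inv_equality) auto
qed

lemma card_subgroup_dvd: "subgroup H G \<Longrightarrow> card H dvd order G"
  using lagrange[of H] by (metis dvd_triv_right)

lemma order_pos [simp]: "order G > 0"
  using fin order_gt_0_iff_finite by blast

lemma card_subgroup_pos: "subgroup H G \<Longrightarrow> card H > 0"
  using finite_subgroup subgroup.one_closed card_gt_0_iff by blast

lemma card_subgroup_dvd_subgroup: "subgroup H G \<Longrightarrow> subgroup K G \<Longrightarrow> H \<subseteq> K \<Longrightarrow> card H dvd card K"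
  using fin_group.card_subgroup_dvd[OF fin_group_subgroup, of K H] subgroup_incl[of H K] by (simp add: order_def)

text \<open>Sylow's existence theorem covers every power of \<open>p\<close> dividing the order.
  Exponent 1 gives a subgroup of order \<open>p\<close>, whose nontrivial elements have order
  \<open>p\<close>.\<close>

lemma cauchy:
  assumes "Factorial_Ring.prime p" "p dvd order G"
  obtains x where "x \<in> carrier G" "ord x = p"
proof -
  obtain m where "order G = p ^ 1 * m" using assms(2) by auto
  then obtain H where H: "subgroup H G" "card H = p"
    using sylow_thm[OF assms(1) is_group _ fin, of 1 m] by auto
  have "H \<noteq> {\<one>}" using H assms(1) by auto
  then obtain x where x: "x \<in> H" "x \<noteq> \<one>" using subgroup.one_closed[OF H(1)] by blast
  then have xc: "x \<in> carrier G" using H subgroup.subset by blast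
  have "ord x dvd p" using subgroup_pow_card[OF H(1) x(1)] H(2) xc by (simp add: pow_eq_id)
  moreover have "ord x \<noteq> 1" using x xc ord_eq_1 by blast
  ultimately have "ord x = p" using assms(1) by (auto simp: prime_nat_iff)
  then show ?thesis using that xc by blast
qed

lemma cauchy_subgroup:
  assumes "Factorial_Ring.prime p" "subgroup H G" "p dvd card H"
  obtains x where "x \<in> H" "x [^] p = \<one>" "x \<noteq> \<one>"
proof -
  interpret H: fin_group "G\<lparr>carrier := H\<rparr>" by (rule fin_group_subgroup) fact
  obtain x where x: "x \<in> H" "H.ord x = p" using H.cauchy[OF assms(1)] assms(3) by (auto simp: order_def)
  have "x [^] p = \<one>" using H.pow_ord_eq_1[of x] x by (simp flip: nat_pow_consistent)
  moreover have "x \<noteq> \<one>" using x H.ord_id assms(1) by (auto simp: prime_nat_iff)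
  ultimately show ?thesis using that x(1) by blast
qed

end

lemma nat_prime_power_if_unique_prime_factor:
  fixes n p :: nat
  assumes "n \<noteq> 0" "Factorial_Ring.prime p" "\<And>q. Factorial_Ring.prime q \<Longrightarrow> q dvd n \<Longrightarrow> q = p"
  shows "\<exists>k. n = p ^ k"
proof -
  obtain m where m: "n = p ^ multiplicity p n * m" "\<not> p dvd m"
    using assms multiplicity_decompose'[of n p] by (metis not_prime_unit)
  have "m = 1"
  proof (rule ccontr)
    assume "m \<noteq> 1"
    then obtain q where q: "Factorial_Ring.prime q" "q dvd m" using prime_factor_nat by blast
    then have "q dvd n" using m(1) by (metis dvd_mult)
    then show False using assms(3) q m(2) by blast
  qed
  then show ?thesis using m(1) by (metis mult.right_neutral)
qed

context fin_group
begin

text \<open>By Cauchy's theorem a prime \<open>q\<close> dividing the order is the order of an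
  element; some power of \<open>p\<close> kills that element, so \<open>q = p\<close>.\<close>

lemma card_prime_powerI:
  assumes p: "Factorial_Ring.prime p" and H: "subgroup H G"
    and pow: "\<And>x. x \<in> H \<Longrightarrow> \<exists>k::nat. x [^] (p ^ k) = \<one>"
  shows "\<exists>k. card H = p ^ k"
proof (rule nat_prime_power_if_unique_prime_factor[OF _ p])
  show "card H \<noteq> 0" using card_subgroup_pos[OF H] by simp
  fix q :: nat assume q: "Factorial_Ring.prime q" "q dvd card H"
  obtain x where x: "x \<in> H" "x [^] q = \<one>" "x \<noteq> \<one>" using cauchy_subgroup[OF q(1) H q(2)] .
  obtain k where k: "x [^] (p ^ k) = \<one>" using pow x by blast
  show "q = p"
  proof (rule ccontr)
    assume "q \<noteq> p"
    then have "coprime q (p ^ k)" using p q by (simp add: primes_coprime)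
    then show False using pow_eq_one_coprime[of x q "p ^ k"] x k H subgroup.subset by blast
  qed
qed

lemma p_subgroup_fixed_points:
  fixes p k :: nat
  assumes p: "Factorial_Ring.prime p" and P: "subgroup P G" "card P = p ^ k" and E: "finite E"
    and cl: "\<And>g x. g \<in> P \<Longrightarrow> x \<in> E \<Longrightarrow> f g x \<in> E"
    and one: "\<And>x. x \<in> E \<Longrightarrow> f \<one> x = x"
    and mult: "\<And>g h x. g \<in> P \<Longrightarrow> h \<in> P \<Longrightarrow> x \<in> E \<Longrightarrow> f (g \<otimes> h) x = f g (f h x)"
  shows "p dvd card {x \<in> E. \<exists>g\<in>P. f g x \<noteq> x}"
  using p_group_fixed_points[of "G\<lparr>carrier := P\<rparr>" p k E f] assms subgroup_imp_group[OF P(1)]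
  by (simp add: order_def)

text \<open>The class equation restricted to \<open>N\<close>: the number of elements moved by
  conjugation is a multiple of \<open>p\<close>, so the subgroup \<open>Z\<close> of the unmoved
  ones has order divisible by \<open>p\<close> and Cauchy's theorem applies to it.\<close>

lemma p_group_normal_meets_center:
  assumes p: "Factorial_Ring.prime p" and ord: "order G = p ^ k" and N: "N \<lhd> G" "N \<noteq> {\<one>}"
  obtains z where "z \<in> N" "z \<noteq> \<one>" "z [^] p = \<one>" "z \<in> group_center G"
proof -
  have sN: "subgroup N G" using N(1) by (rule normal_imp_subgroup)
  have NG: "N \<subseteq> carrier G" using sN by (rule subgroup.subset)
  have cN: "card N \<noteq> 1" using N(2) subgroup.one_closed[OF sN] by (auto simp: card_1_singleton_iff)
  have "card N dvd p ^ k" using card_subgroup_dvd[OF sN] ord by simp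
  then obtain j where "card N = p ^ j" using p by (meson divides_primepow_nat)
  with cN have pN: "p dvd card N" by (cases j) auto
  define Z where "Z = {x \<in> N. \<forall>g\<in>carrier G. conjugate g x = x}"
  have "p dvd card {x \<in> N. \<exists>g\<in>carrier G. conjugate g x \<noteq> x}"
    by (rule p_group_fixed_points[OF is_group p ord])
       (use sN NG N(1) in \<open>auto simp: conjugate_normal conjugate_conjugate subset_eq\<close>)
  moreover have "{x \<in> N. \<exists>g\<in>carrier G. conjugate g x \<noteq> x} = N - Z" by (auto simp: Z_def)
  moreover have "card N = card (N - Z) + card Z"
    using card_Diff_subset[of Z N] card_mono[of N Z] sN by (simp add: Z_def finite_subset)
  ultimately have pZ: "p dvd card Z" using pN by (simp add: dvd_add_right_iff)
  have ZZ: "Z = {x \<in> N. x \<in> group_center G}"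
    using NG by (auto simp: Z_def group_center_def conjugate_eq_self_iff)
  have "subgroup Z G"
  proof (rule subgroupI)
    show "Z \<subseteq> carrier G" using NG by (auto simp: Z_def)
    show "Z \<noteq> {}" using subgroup.one_closed[OF sN] by (auto simp: Z_def)
    show "inv a \<in> Z" if "a \<in> Z" for a
      using that sN NG by (auto simp: Z_def conjugate_inv subgroup.m_inv_closed subset_eq)
    show "a \<otimes> b \<in> Z" if "a \<in> Z" "b \<in> Z" for a b
      using that sN NG by (auto simp: Z_def conjugate_mult subgroup.m_closed subset_eq)
  qed
  then obtain z where "z \<in> Z" "z [^] p = \<one>" "z \<noteq> \<one>" using cauchy_subgroup[OF p _ pZ] by metis
  then show ?thesis using that[of z] ZZ by auto
qed

lemma sylow_exists:
  assumes "Factorial_Ring.prime p"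
  obtains P where "sylow_subgroup p P G"
proof -
  obtain m where m: "order G = p ^ multiplicity p (order G) * m"
    using multiplicity_dvd[of p "order G"] by (rule dvdE)
  obtain P where "subgroup P G" "card P = p ^ multiplicity p (order G)"
    using sylow_thm[OF assms is_group m fin] by blast
  then show ?thesis using that by (simp add: sylow_subgroup_def)
qed

text \<open>\<open>Q\<close> acts on the cosets of \<open>P\<close> by right multiplication. Their
  number is prime to \<open>p\<close>, so some coset \<open>P x\<close> is fixed, which says that
  \<open>x Q x^-1\<close> lies in \<open>P\<close>.\<close>

lemma sylow_conjugate:
  assumes p: "Factorial_Ring.prime p" and P: "sylow_subgroup p P G"
    and Q: "subgroup Q G" "card Q = p ^ k"
  obtains g where "g \<in> carrier G" "\<forall>x\<in>Q. conjugate g x \<in> P"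
proof -
  have sP: "subgroup P G" and cP: "card P = p ^ multiplicity p (order G)"
    using P by (auto simp: sylow_subgroup_def)
  have QG: "Q \<subseteq> carrier G" using Q by (simp add: subgroup.subset)
  \<comment> \<open>The inverse turns right multiplication into a left action.\<close>
  define f where "f = (\<lambda>g Y. r_coset G Y (inv g))"
  define E where "E = rcosets P"
  have Esub: "Y \<subseteq> carrier G" if "Y \<in> E" for Y using that sP by (simp add: E_def rcosets_part_G subgroup.rcosets_carrier)
  have fE: "finite E" by (simp add: E_def RCOSETS_def)
  have "\<not> p dvd card E"
  proof
    assume "p dvd card E"
    then have "p * card P dvd card E * card P" by (rule mult_dvd_mono) simp
    then have "p * p ^ multiplicity p (order G) dvd order G"
      using lagrange[OF sP] cP by (simp only: E_def)
    then have "p ^ Suc (multiplicity p (order G)) dvd order G" by simp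
    then have "Suc (multiplicity p (order G)) \<le> multiplicity p (order G)"
      by - (rule multiplicity_geI, use p order_pos in \<open>auto simp: prime_nat_iff\<close>)
    then show False by simp
  qed
  moreover have "p dvd card {Y \<in> E. \<exists>g\<in>Q. f g Y \<noteq> Y}"
  proof (rule p_subgroup_fixed_points[OF p Q fE])
    show "f g Y \<in> E" if "g \<in> Q" "Y \<in> E" for g Y
      using that QG subgroup.subset[OF sP] by (force simp: E_def f_def RCOSETS_def coset_mult_assoc)
    show "f \<one> Y = Y" if "Y \<in> E" for Y using Esub[OF that] by (simp add: f_def)
    show "f (g \<otimes> h) Y = f g (f h Y)" if "g \<in> Q" "h \<in> Q" "Y \<in> E" for g h Y
      using that QG Esub[OF that(3)] by (auto simp: f_def coset_mult_assoc inv_mult_group subset_eq)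
  qed
  ultimately have "{Y \<in> E. \<exists>g\<in>Q. f g Y \<noteq> Y} \<noteq> E" by auto
  then obtain Y where Y: "Y \<in> E" "\<forall>g\<in>Q. f g Y = Y" by blast
  then obtain x where x: "x \<in> carrier G" "Y = P #> x" by (auto simp: E_def RCOSETS_def)
  have "conjugate x g \<in> P" if g: "g \<in> Q" for g
  proof -
    have gc: "g \<in> carrier G" using g QG by auto
    have "inv g \<in> Q" using g Q by (simp add: subgroup.m_inv_closed)
    then have "P #> (x \<otimes> g) = P #> x"
      using bspec[OF Y(2), of "inv g"] x gc subgroup.subset[OF sP] by (simp add: f_def coset_mult_assoc)
    then have "x \<otimes> g \<in> P #> x" using rcos_self[of "x \<otimes> g" P] x gc sP by auto
    then obtain q where "q \<in> P" "x \<otimes> g = q \<otimes> x" by (auto simp: r_coset_def)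
    moreover have "q \<in> carrier G" using \<open>q \<in> P\<close> sP by (rule subgroup.mem_carrier[rotated])
    ultimately show ?thesis using x gc by (simp add: conjugate_def m_assoc)
  qed
  then show ?thesis using that x(1) by blast
qed

lemma normal_p_subgroup_subset_sylow:
  assumes p: "Factorial_Ring.prime p" and P: "sylow_subgroup p P G"
    and Q: "Q \<lhd> G" "card Q = p ^ k"
  shows "Q \<subseteq> P"
proof -
  have sQ: "subgroup Q G" using Q(1) by (rule normal_imp_subgroup)
  obtain g where g: "g \<in> carrier G" "\<forall>x\<in>Q. conjugate g x \<in> P"
    using sylow_conjugate[OF p P sQ Q(2)] .
  show ?thesis
  proof
    fix x assume x: "x \<in> Q"
    then have "conjugate (inv g) x \<in> Q" using conjugate_normal[OF Q(1)] g(1) by simp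
    then have "conjugate g (conjugate (inv g) x) \<in> P" using g by blast
    then show "x \<in> P" using g(1) x subgroup.mem_carrier[OF sQ] by simp
  qed
qed

end


section \<open>\<open>p\<close>-groups with a unique subgroup of order \<open>p\<close>\<close>

text \<open>The sum is the factor that multiplies \<open>t\<close> when \<open>a^t x\<close> is
  raised to the \<open>p\<close>-th power. With \<open>s = 1 + p v\<close> one has
  \<open>s^i = 1 + i p v\<close> modulo \<open>p^2\<close>, and for odd \<open>p\<close> the sum of
  all \<open>i < p\<close> is a multiple of \<open>p\<close>; so exactly one factor \<open>p\<close>
  occurs. For \<open>p = 2\<close> the sum is \<open>1 + s\<close>.\<close>

lemma geometric_sum_mod_prime_square:
  fixes p s :: nat
  assumes p: "Factorial_Ring.prime p" and s: "s mod p = 1" and sp: "odd p \<or> s mod 4 = 1"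
  shows "\<exists>w. (\<Sum>i<p. s ^ i) = p * (1 + p * w)"
proof (cases "p = 2")
  case True
  have "s mod 4 = 1" using sp True by simp
  then have "s = 1 + 4 * (s div 4)" by presburger
  then have "(\<Sum>i<p. s ^ i) = p * (1 + p * (s div 4))" using True by (simp add: numeral_2_eq_2)
  then show ?thesis ..
next
  case False
  then have "odd p" using p prime_odd_nat by (metis prime_ge_2_nat le_neq_implies_less)
  define v where "v = s div p"
  have sv: "s = 1 + p * v" using s by (metis v_def add.commute mult_div_mod_eq)
  have pw: "\<exists>u. s ^ i = 1 + i * p * v + p * p * u" for i
  proof (induction i)
    case (Suc i)
    then obtain u where "s ^ i = 1 + i * p * v + p * p * u" by blast
    then have "s ^ Suc i = 1 + Suc i * p * v + p * p * (i * v * v + u * (1 + p * v))"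
      by (simp add: sv algebra_simps)
    then show ?case by blast
  qed simp
  then obtain u where u: "\<And>i. s ^ i = 1 + i * p * v + p * p * u i" by metis
  have "(\<Sum>i<p. s ^ i) = (\<Sum>i<p. 1) + (\<Sum>i<p. i) * p * v + p * p * (\<Sum>i<p. u i)"
    unfolding u sum.distrib by (simp add: sum_distrib_left sum_distrib_right mult.assoc)
  moreover have "(\<Sum>i<p. i) = p * ((p - 1) div 2)"
  proof -
    have "(\<Sum>i<p. i) = p * (p - 1) div 2"
      using Sum_Ico_nat[of 0 p] by (simp add: atLeast0LessThan)
    then show ?thesis using \<open>odd p\<close> by (simp add: div_mult_swap)
  qed
  ultimately have "(\<Sum>i<p. s ^ i) = p * (1 + p * (((p - 1) div 2) * v + (\<Sum>i<p. u i)))"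
    by (simp add: algebra_simps)
  then show ?thesis by blast
qed

text \<open>\<open>S\<close> contains \<open>p\<close> exactly once and \<open>p\<close> divides
  \<open>e\<close>, so after division by \<open>p\<close> the congruence has an invertible
  coefficient.\<close>

lemma solve_shifted_power:
  fixes p S e m w :: nat
  assumes p: "Factorial_Ring.prime p" and S: "S = p * (1 + p * w)" and e: "p dvd e"
  shows "\<exists>t. p ^ m dvd t * S + e"
proof (cases m)
  case (Suc k)
  obtain f where f: "e = p * f" using e by blast
  have "coprime (1 + p * w) p" 
  proof -
    have "\<not> p dvd 1 + p * w" using p dvd_add_left_iff[of p "p * w" 1] by (auto simp: prime_nat_iff)
    then show ?thesis using prime_imp_coprime[OF p] coprime_commute by blast
  qed
  then have "coprime (1 + p * w) (p ^ k)" by simp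
  then obtain x where x: "[(1 + p * w) * x = 1] (mod p ^ k)" using cong_solve_coprime_nat[of "1 + p * w" "p ^ k"] by auto
  \<comment> \<open>\<open>(p^k - 1) * f\<close> plays the role of \<open>-f\<close> modulo
    \<open>p^k\<close>, and \<open>x\<close> inverts the coefficient
    \<open>1 + p * w\<close>.\<close>
  define t where "t = x * ((p ^ k - 1) * f)"
  have "[(1 + p * w) * x * ((p ^ k - 1) * f) + f = 1 * ((p ^ k - 1) * f) + f] (mod p ^ k)"
    using cong_scalar_right[OF x] by (rule cong_add) simp
  moreover have "1 * ((p ^ k - 1) * f) + f = p ^ k * f"
  proof -
    have "p ^ k > 0" using p by (simp add: prime_gt_0_nat)
    then show ?thesis by (cases "p ^ k") auto
  qed
  ultimately have "p ^ k dvd (1 + p * w) * x * ((p ^ k - 1) * f) + f"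
    by (metis cong_dvd_iff dvd_triv_left)
  then have "p * p ^ k dvd p * ((1 + p * w) * x * ((p ^ k - 1) * f) + f)" by simp
  also have "p * ((1 + p * w) * x * ((p ^ k - 1) * f) + f) = t * S + e"
    by (simp add: t_def S f algebra_simps)
  finally show ?thesis using Suc by auto
qed auto

section \<open>Cyclic subgroups, powers of twisted products, and quotients\<close>

context group
begin

text \<open>In a finite group this is the cyclic subgroup generated by \<open>a\<close>; natural
  exponents keep the later congruences within the natural numbers.\<close>

definition powers :: "'a \<Rightarrow> 'a set" where
  "powers a = range (\<lambda>k::nat. a [^] k)"

lemma powers_self [simp]: "a \<in> carrier G \<Longrightarrow> a \<in> powers a"
  using rangeI[of "\<lambda>k::nat. a [^] k" 1] by (simp add: powers_def)

lemma pow_in_powers [simp]: "a [^] (k::nat) \<in> powers a"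
  by (simp add: powers_def)

lemma one_in_powers [simp]: "\<one> \<in> powers a"
  using pow_in_powers[of a 0] by simp

lemma powers_subset: "subgroup H G \<Longrightarrow> a \<in> H \<Longrightarrow> powers a \<subseteq> H"
  by (auto simp: powers_def subgroup_pow_closed)

lemma powers_commute:
  assumes "a \<in> carrier G" "x \<in> carrier G" "a \<otimes> x = x \<otimes> a" "y \<in> powers a"
  shows "y \<otimes> x = x \<otimes> y"
  using assms by (auto simp: powers_def pow_commute)

lemma powers_abelian:
  assumes "a \<in> carrier G" "x \<in> powers a" "y \<in> powers a"
  shows "x \<otimes> y = y \<otimes> x"
  using assms by (auto simp: powers_def nat_pow_mult add.commute)

lemma powers_trans: "a \<in> carrier G \<Longrightarrow> x \<in> powers a \<Longrightarrow> powers x \<subseteq> powers a"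
  by (auto simp: powers_def nat_pow_pow)

lemma powers_in_carrier: "a \<in> carrier G \<Longrightarrow> x \<in> powers a \<Longrightarrow> x \<in> carrier G"
  by (auto simp: powers_def)

lemma conjugate_pow_exponent:
  fixes s k :: nat
  assumes a: "a \<in> carrier G" and x: "x \<in> carrier G" and s: "conjugate x a = a [^] s"
  shows "conjugate (x [^] k) a = a [^] (s ^ k)"
proof (induction k)
  case (Suc k)
  have "conjugate (x [^] Suc k) a = conjugate (x [^] k) (conjugate x a)" using a x by (simp add: conjugate_conjugate)
  also have "\<dots> = conjugate (x [^] k) a [^] s" using a x by (simp add: s conjugate_pow)
  also have "\<dots> = a [^] (s ^ Suc k)" using a by (simp only: Suc) (simp add: nat_pow_pow mult.commute)
  finally show ?case .
qed (use a in simp)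

text \<open>Moving \<open>x\<close> past a power of \<open>a\<close> multiplies the exponent by
  \<open>s\<close>, so the exponents of the \<open>n\<close> factors \<open>a^t\<close> form a
  geometric series.\<close>

lemma twisted_pow:
  fixes s t n :: nat
  assumes a: "a \<in> carrier G" and x: "x \<in> carrier G" and s: "conjugate x a = a [^] s"
  shows "(a [^] t \<otimes> x) [^] n = a [^] (t * (\<Sum>i<n. s ^ i)) \<otimes> x [^] n"
proof (induction n)
  case (Suc n)
  have xa: "x \<otimes> a [^] k = a [^] (s * k) \<otimes> x" for k :: nat
  proof -
    have "conjugate x (a [^] k) = a [^] (s * k)" using a x s by (simp add: conjugate_pow nat_pow_pow)
    then have "conjugate x (a [^] k) \<otimes> x = a [^] (s * k) \<otimes> x" by simp
    then show ?thesis using a x by (simp add: conjugate_def m_assoc)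
  qed
  have "(a [^] t \<otimes> x) [^] Suc n = (a [^] t \<otimes> x) \<otimes> (a [^] t \<otimes> x) [^] n"
    using a x by (simp only: nat_pow_Suc2 nat_pow_closed m_closed)
  also have "\<dots> = (a [^] t \<otimes> x) \<otimes> (a [^] (t * (\<Sum>i<n. s ^ i)) \<otimes> x [^] n)" by (simp only: Suc)
  also have "\<dots> = a [^] t \<otimes> (x \<otimes> a [^] (t * (\<Sum>i<n. s ^ i))) \<otimes> x [^] n" using a x by (simp add: m_assoc)
  also have "\<dots> = (a [^] t \<otimes> a [^] (s * (t * (\<Sum>i<n. s ^ i)))) \<otimes> (x \<otimes> x [^] n)"
    using a x by (simp only: xa) (simp add: m_assoc)
  also have "\<dots> = a [^] (t * (1 + s * (\<Sum>i<n. s ^ i))) \<otimes> x [^] Suc n"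
    using a x by (simp add: nat_pow_mult algebra_simps flip: nat_pow_Suc2 del: nat_pow_Suc)
  also have "1 + s * (\<Sum>i<n. s ^ i) = (\<Sum>i<Suc n. s ^ i)"
    by (subst sum.lessThan_Suc_shift) (simp add: sum_distrib_left)
  finally show ?case .
qed (use a x in simp)

end

context fin_group
begin

lemma powers_eq_generate: "a \<in> carrier G \<Longrightarrow> powers a = generate G {a}"
  using generate_pow_on_finite_carrier[OF fin] by (auto simp: powers_def)

lemma powers_subgroup [simp]: "a \<in> carrier G \<Longrightarrow> subgroup (powers a) G"
  by (simp add: powers_eq_generate generate_is_subgroup)

lemma card_powers: "a \<in> carrier G \<Longrightarrow> card (powers a) = ord a"
  using generate_pow_card by (simp add: powers_eq_generate)

lemma powers_pow_coprime:
  assumes "a \<in> carrier G" "coprime k (ord a)"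
  shows "a \<in> powers (a [^] (k::nat))"
proof -
  obtain x where "[k * x = 1] (mod ord a)" using cong_solve_coprime_nat[OF assms(2)] by auto
  then have "int (ord a) dvd int 1 - int (k * x)" by (metis cong_iff_dvd_diff cong_int_iff cong_sym)
  then have "a [^] (int (k * x)) = a [^] (int 1)" using assms(1) by (simp only: int_pow_eq)
  then have "a [^] (k * x) = a" using assms(1) by (simp only: int_pow_int nat_pow_eone)
  then show ?thesis using assms(1) by (metis nat_pow_pow pow_in_powers)
qed

lemma pow_eq_pow_iff:
  assumes "a \<in> carrier G" shows "a [^] (k::nat) = a [^] (l::nat) \<longleftrightarrow> [k = l] (mod ord a)"
proof -
  have "a [^] k = a [^] l \<longleftrightarrow> a [^] (int k) = a [^] (int l)" by (simp add: int_pow_int)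
  also have "\<dots> \<longleftrightarrow> int (ord a) dvd int l - int k" using assms by (rule int_pow_eq)
  also have "\<dots> \<longleftrightarrow> [k = l] (mod ord a)" by (metis cong_iff_dvd_diff cong_int_iff cong_sym)
  finally show ?thesis .
qed

lemma quot_fin_group: "N \<lhd> G \<Longrightarrow> fin_group (G Mod N)"
  by (simp add: fin_group_def fin_group_axioms_def normal.factorgroup_is_group carrier_FactGroup)

lemma quot_hom: "N \<lhd> G \<Longrightarrow> group_hom G (G Mod N) (\<lambda>x. N #> x)"
  by (simp add: group_hom_def group_hom_axioms_def normal.factorgroup_is_group normal.r_coset_hom_Mod is_group)

lemma quot_eq_one: "N \<lhd> G \<Longrightarrow> x \<in> carrier G \<Longrightarrow> N #> x = N \<longleftrightarrow> x \<in> N"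
  using coset_join1[of N x] coset_join2[of x N] normal_imp_subgroup[of N G] subgroup.subset by blast

lemma order_quot: "N \<lhd> G \<Longrightarrow> order (G Mod N) * card N = order G"
  using lagrange[OF normal_imp_subgroup] by (simp add: order_def FactGroup_def)

lemma quot_eq:
  assumes N: "N \<lhd> G" and xy: "x \<in> carrier G" "y \<in> carrier G"
  shows "N #> x = N #> y \<longleftrightarrow> x \<otimes> inv y \<in> N"
proof -
  interpret h: group_hom G "G Mod N" "\<lambda>x. N #> x" by (rule quot_hom[OF N])
  have 1: "N #> x = N #> y \<longleftrightarrow> (N #> x) \<otimes>\<^bsub>G Mod N\<^esub> inv\<^bsub>G Mod N\<^esub> (N #> y) = \<one>\<^bsub>G Mod N\<^esub>"
    using h.hom_closed[OF xy(1)] h.hom_closed[OF xy(2)] by (metis h.H.inv_closed h.H.inv_equality h.H.r_inv h.H.inv_inv)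
  have 2: "(N #> x) \<otimes>\<^bsub>G Mod N\<^esub> inv\<^bsub>G Mod N\<^esub> (N #> y) = N #> (x \<otimes> inv y)"
    using h.hom_mult[of x "inv y"] h.hom_inv[of y] xy by simp
  show ?thesis using quot_eq_one[OF N, of "x \<otimes> inv y"] xy by (simp only: 1 2 one_FactGroup) simp
qed

text \<open>\<open>M/N\<close> is a nontrivial normal subgroup of the \<open>p\<close>-group
  \<open>G/N\<close> and thus contains a central element of order \<open>p\<close>. Here
  \<open>x\<close> is a lift of it; centrality turns into a statement on commutators modulo
  \<open>N\<close>.\<close>

lemma p_group_normal_central_step:
  assumes p: "Factorial_Ring.prime p" and ord: "order G = p ^ k" and N: "N \<lhd> G" and M: "M \<lhd> G"
    and NM: "N \<subseteq> M" "N \<noteq> M"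
  obtains x where "x \<in> M" "x \<notin> N" "x [^] p \<in> N" "\<forall>g\<in>carrier G. conjugate g x \<otimes> inv x \<in> N"
proof -
  interpret Q: fin_group "G Mod N" by (rule quot_fin_group[OF N])
  interpret h: group_hom G "G Mod N" "\<lambda>x. N #> x" by (rule quot_hom[OF N])
  have MG: "M \<subseteq> carrier G" using M normal_imp_subgroup subgroup.subset by blast
  have "order (G Mod N) dvd p ^ k" using order_quot[OF N] ord by (metis dvd_triv_left)
  then obtain j where j: "order (G Mod N) = p ^ j" using p by (meson divides_primepow_nat)
  have "(\<lambda>x. N #> x) ` M \<lhd> G Mod N"
    using normal.surj_hom_normal_subgroup[OF M h.group_hom_axioms] by (simp add: carrier_FactGroup)
  moreover obtain y where y: "y \<in> M" "y \<notin> N" using NM by blast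
  then have "N #> y \<noteq> N" using quot_eq_one[OF N] MG by blast
  then have "(\<lambda>x. N #> x) ` M \<noteq> {\<one>\<^bsub>G Mod N\<^esub>}" using y by auto
  ultimately obtain Z where Z: "Z \<in> (\<lambda>x. N #> x) ` M" "Z \<noteq> \<one>\<^bsub>G Mod N\<^esub>" "Z [^]\<^bsub>G Mod N\<^esub> p = \<one>\<^bsub>G Mod N\<^esub>"
    "Z \<in> group_center (G Mod N)"
    using Q.p_group_normal_meets_center[OF p j] by metis
  then obtain x where x: "x \<in> M" "Z = N #> x" by blast
  then have xc: "x \<in> carrier G" using MG by blast
  have "x \<notin> N" using Z(2) x quot_eq_one[OF N xc] by auto
  moreover have "x [^] p \<in> N" using Z(3) x(2) xc quot_eq_one[OF N] by (simp flip: h.hom_nat_pow)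
  moreover have "conjugate g x \<otimes> inv x \<in> N" if g: "g \<in> carrier G" for g
  proof -
    have "(N #> g) \<otimes>\<^bsub>G Mod N\<^esub> (N #> x) = (N #> x) \<otimes>\<^bsub>G Mod N\<^esub> (N #> g)"
      using Z(4) g x(2) h.hom_closed[OF g] by (auto simp: group_center_def)
    then have "N #> (g \<otimes> x) = N #> (x \<otimes> g)" using g xc by (simp only: h.hom_mult)
    then have "(g \<otimes> x) \<otimes> inv (x \<otimes> g) \<in> N" using quot_eq[OF N, of "g \<otimes> x" "x \<otimes> g"] g xc by simp
    then show ?thesis using g xc by (simp add: conjugate_def grp_simps)
  qed
  ultimately show ?thesis using that x(1) by blast
qed

end


context group
begin

text \<open>\<open>quaternion_pair a b m\<close>: the group is generalized quaternion of order \<open>2 ^ (m + 1)\<close>, with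
  \<open>a\<close> generating the cyclic subgroup of index 2 and \<open>b\<close> outside it.\<close>

definition quaternion_pair :: "'a \<Rightarrow> 'a \<Rightarrow> nat \<Rightarrow> bool" where
  "quaternion_pair a b m \<longleftrightarrow> a \<in> carrier G \<and> b \<in> carrier G \<and> m \<ge> 2 \<and> ord a = 2 ^ m \<and>
     b \<notin> powers a \<and> b [^] (2::nat) = a [^] (2 ^ (m - 1) :: nat) \<and> conjugate b a = inv a \<and>
     carrier G = powers a \<union> (\<lambda>x. x \<otimes> b) ` powers a"

end

context fin_group
begin

definition unique_prime_subgroup :: "nat \<Rightarrow> 'a \<Rightarrow> bool" where
  "unique_prime_subgroup p z \<longleftrightarrow> z \<in> carrier G \<and> ord z = p \<and> (\<forall>y\<in>carrier G. y [^] p = \<one> \<longrightarrow> y \<in> powers z)"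

lemma pow_sq: "x \<in> carrier G \<Longrightarrow> x [^] (2::nat) = x \<otimes> x"
  by (simp add: numeral_2_eq_2)

text \<open>\<open>a\<close> generates a maximal normal cyclic subgroup.\<close>

lemma self_centralizing_cyclic:
  assumes p: "Factorial_Ring.prime p" and ordG: "order G = p ^ n" and z: "unique_prime_subgroup p z"
  obtains a where "a \<in> carrier G" "powers a \<lhd> G" "z \<in> powers a"
    "\<forall>x\<in>carrier G. x \<otimes> a = a \<otimes> x \<longrightarrow> x \<in> powers a"
proof -
  have zc: "z \<in> carrier G" and zo: "ord z = p" and zu: "\<And>y. y \<in> carrier G \<Longrightarrow> y [^] p = \<one> \<Longrightarrow> y \<in> powers z"
    using z by (auto simp: unique_prime_subgroup_def)
  \<comment> \<open>Keeping \<open>z\<close> inside the cyclic subgroup ensures that all elements of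
    order \<open>p\<close> lie in it.\<close>
  define good where "good a \<longleftrightarrow> a \<in> carrier G \<and> powers a \<lhd> G \<and> z \<in> powers a" for a
  have "powers z \<lhd> G"
  proof (rule normalI_conjugate)
    fix g x assume g: "g \<in> carrier G" and "x \<in> powers z"
    then obtain k :: nat where k: "x = z [^] k" by (auto simp: powers_def)
    have "x [^] p = \<one>" using zc zo k by (metis nat_pow_pow mult.commute pow_ord_eq_1 nat_pow_one)
    then have "conjugate g x [^] p = \<one>" using conjugate_pow[OF g, of x p] g k zc by simp
    then show "conjugate g x \<in> powers z" using zu g k zc by simp
  qed (use zc in simp)
  then have "good z" using zc by (simp add: good_def)
  moreover have "finite {a. good a}" by (rule finite_subset[OF _ fin]) (auto simp: good_def)
  ultimately obtain a where a: "good a" and amax: "\<And>b. good b \<Longrightarrow> ord b \<le> ord a"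
    using ex_has_greatest_nat[of good z ord "Suc (order G)"] ord_le_group_order[OF fin]
    by (auto simp: good_def less_Suc_eq_le)
  have ac: "a \<in> carrier G" and an: "powers a \<lhd> G" and za: "z \<in> powers a" using a by (auto simp: good_def)
  have ua: "y \<in> powers a" if "y \<in> carrier G" "y [^] p = \<one>" for y
    using zu[OF that] powers_trans[OF ac za] by blast
  define C where "C = {x \<in> carrier G. x \<otimes> a = a \<otimes> x}"
  have aC: "powers a \<subseteq> C" using ac by (auto simp: C_def powers_def pow_commute)
  have C_comm: "x \<otimes> y = y \<otimes> x" if "x \<in> C" "y \<in> powers a" for x y
    using powers_commute[OF ac, of x y] that by (simp add: C_def)
  have "C = powers a"
  proof (rule ccontr)
    assume ne: "C \<noteq> powers a"
    have C_alt: "C = {x \<in> carrier G. \<forall>y\<in>powers a. x \<otimes> y = y \<otimes> x}"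
      using ac C_comm by (auto simp: C_def)
    have "subgroup C G"
    proof (rule subgroupI)
      show "C \<noteq> {}" using aC one_in_powers by blast
      show "inv x \<in> C" if "x \<in> C" for x
      proof -
        have "x \<in> carrier G" "conjugate x a = a" using that ac by (auto simp: C_def conjugate_eq_self_iff)
        then have "conjugate (inv x) a = a" using conjugate_cancel(2)[of x a] ac by simp
        then show ?thesis using ac that by (simp add: C_def conjugate_eq_self_iff)
      qed
      show "x \<otimes> y \<in> C" if "x \<in> C" "y \<in> C" for x y
        using that ac conjugate_conjugate[of x y a] by (auto simp: C_def simp flip: conjugate_eq_self_iff)
    qed (auto simp: C_def)
    then have "C \<lhd> G"
    proof (rule normalI_conjugate)
      fix g x assume g: "g \<in> carrier G" and x: "x \<in> C"
      have xc: "x \<in> carrier G" using x by (simp add: C_def)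
      have "conjugate (inv g) a \<in> powers a" using conjugate_normal[OF an, of "inv g" a] g ac by simp
      then have "conjugate x (conjugate (inv g) a) = conjugate (inv g) a"
        using x C_comm powers_in_carrier[OF ac] xc conjugate_eq_self_iff by metis
      then have "conjugate (conjugate g x) a = a"
        using conjugate_conjugate[of "g \<otimes> x" "inv g" a] conjugate_conjugate[of g x "conjugate (inv g) a"] g xc ac
        by (simp add: conjugate_def[of g x])
      then show "conjugate g x \<in> C" using g xc ac by (simp add: C_def conjugate_eq_self_iff)
    qed
    then obtain x where x: "x \<in> C" "x \<notin> powers a" "x [^] p \<in> powers a"
      "\<forall>g\<in>carrier G. conjugate g x \<otimes> inv x \<in> powers a"
      using p_group_normal_central_step[OF p ordG an] aC ne by metis
    then have xc: "x \<in> carrier G" and xa: "x \<otimes> a = a \<otimes> x" by (auto simp: C_def)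
    obtain e :: nat where e: "x [^] p = a [^] e" using x(3) by (auto simp: powers_def)
    \<comment> \<open>Either a power of \<open>a\<close> corrects \<open>x\<close> to an element
      with trivial \<open>p\<close>-th power outside \<open>powers a\<close>, or \<open>a\<close> is
      itself a power of \<open>x\<close>. In the second case \<open>powers x\<close> is a larger
      normal cyclic subgroup, because conjugation changes \<open>x\<close> only by factors from
      \<open>powers a\<close>.\<close>
    show False
    proof (cases "p dvd e")
      case True
      then obtain f where f: "e = p * f" by blast
      define y where "y = inv (a [^] f) \<otimes> x"
      have "inv (a [^] f) \<in> powers a" using powers_subgroup[OF ac] pow_in_powers subgroup.m_inv_closed by metis
      then have "inv (a [^] f) \<otimes> x = x \<otimes> inv (a [^] f)" using C_comm x(1) by metis
      then have "y [^] p = inv (a [^] f) [^] p \<otimes> x [^] p"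
        unfolding y_def using xc ac by (intro pow_mult_distrib) auto
      also have "\<dots> = \<one>" using e f ac xc by (simp add: nat_pow_inv nat_pow_pow mult.commute)
      finally have "y \<in> powers a" using ua xc ac by (simp add: y_def)
      then have "a [^] f \<otimes> y \<in> powers a" using powers_subgroup[OF ac] pow_in_powers subgroup.m_closed by metis
      then show False using x(2) xc ac by (simp add: y_def)
    next
      case False
      have "ord a dvd p ^ n" using ord_dvd_group_order[OF ac] ordG by simp
      then obtain m where m: "ord a = p ^ m" using p by (meson divides_primepow_nat)
      have "coprime e (ord a)" using False p m by (metis coprime_commute coprime_power_left_iff prime_imp_coprime)
      then have "a \<in> powers (a [^] e)" using powers_pow_coprime[OF ac] by blast
      then have ax: "a \<in> powers x" using e powers_trans[of x "x [^] p"] xc pow_in_powers[of x p] by auto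
      have sx: "subgroup (powers x) G" using xc by simp
      have "powers a \<subset> powers x" using powers_trans[OF xc ax] x(2) xc powers_self by blast
      then have lt: "ord a < ord x" using psubset_card_mono[of "powers x" "powers a"] sx ac xc by (simp add: card_powers)
      have "powers x \<lhd> G"
      proof (rule normalI_conjugate[OF sx])
        fix g y assume g: "g \<in> carrier G" and "y \<in> powers x"
        then obtain k :: nat where k: "y = x [^] k" by (auto simp: powers_def)
        have "conjugate g x \<otimes> inv x \<in> powers x" using x(4) g powers_trans[OF xc ax] by blast
        then have "conjugate g x \<otimes> inv x \<otimes> x \<in> powers x" using sx xc by (meson powers_self subgroup.m_closed)
        then have "conjugate g x \<in> powers x" using g xc by (simp add: m_assoc)
        then show "conjugate g y \<in> powers x" using sx g xc k by (simp add: conjugate_pow subgroup_pow_closed)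
      qed
      then have "good x" using xc za powers_trans[OF xc ax] by (auto simp: good_def)
      then show False using amax lt by fastforce
    qed
  qed
  then show ?thesis using that ac an za by (auto simp: C_def)
qed

text \<open>No product \<open>a^t x\<close> has trivial \<open>p\<close>-th power, so
  \<open>t (1 + s + ... + s^(p-1)) + e\<close> is never 0 modulo \<open>p^m\<close>, where
  \<open>x\<close> acts by \<open>a -> a^s\<close> and \<open>x^p = a^e\<close>. Solvability of this
  congruence rules out everything but \<open>p = 2\<close> and \<open>s = 3\<close> modulo 4, and
  then congruences modulo \<open>2^m\<close> determine first \<open>e\<close> and then
  \<open>s\<close>.\<close>

lemma unique_prime_subgroup_action:
  assumes p: "Factorial_Ring.prime p" and ordG: "order G = p ^ n"
    and a: "a \<in> carrier G" "powers a \<lhd> G" and self: "\<forall>x\<in>carrier G. x \<otimes> a = a \<otimes> x \<longrightarrow> x \<in> powers a"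
    and ua: "\<And>y. y \<in> carrier G \<Longrightarrow> y [^] p = \<one> \<Longrightarrow> y \<in> powers a"
    and m: "ord a = p ^ m" "m \<ge> 1"
    and x: "x \<in> carrier G" "x \<notin> powers a" "x [^] p \<in> powers a"
  shows "p = 2 \<and> m \<ge> 2 \<and> x [^] (2::nat) = a [^] (2 ^ (m - 1) :: nat) \<and> conjugate x a = inv a"
proof -
  have "conjugate x a \<in> powers a" using conjugate_normal[OF a(2) x(1), of a] a(1) by simp
  then obtain s :: nat where s: "conjugate x a = a [^] s" by (auto simp: powers_def)
  obtain e :: nat where e: "x [^] p = a [^] e" using x(3) by (auto simp: powers_def)
  have not_comm: "x \<otimes> a \<noteq> a \<otimes> x" using self x by blast
  note conj_pow = conjugate_pow_exponent[OF a(1) x(1) s]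
  have "conjugate (x [^] p) a = a" using a x e by (simp add: conjugate_eq_self_iff nat_pow_mult pow_commute)
  then have "a [^] (s ^ p) = a [^] (1::nat)" using conj_pow[of p] a by simp
  then have sp: "[s ^ p = 1] (mod p ^ m)" using pow_eq_pow_iff[OF a(1), of "s ^ p" 1] m(1) by (simp only:)
  then have sp1: "[s ^ p = 1] (mod p)" using m(2) by (intro cong_dvd_modulus_nat[OF sp]) (cases m, auto)
  have "\<not> p dvd s"
  proof
    assume "p dvd s"
    then have "p dvd s ^ p" using p by (meson dvd_power dvd_trans prime_gt_0_nat)
    then show False using sp1 p by (metis cong_dvd_iff not_prime_unit)
  qed
  then have "[s ^ (p - 1) = 1] (mod p)" using fermat_theorem[OF p] by blast
  then have "[s ^ (p - 1) * s = 1 * s] (mod p)" by (rule cong_scalar_right)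
  moreover have "s ^ (p - 1) * s = s ^ p" using p by (metis power_minus_mult prime_gt_0_nat)
  ultimately have "[s = 1] (mod p)" using sp1 by (metis cong_sym cong_trans mult_1)
  then have s1: "s mod p = 1" using p by (metis cong_def mod_less prime_gt_1_nat)
  \<comment> \<open>Otherwise \<open>a\<close> would be a power of \<open>x\<close> and commute with
    it.\<close>
  have pe: "p dvd e"
  proof (rule ccontr)
    assume "\<not> p dvd e"
    then have "coprime e (ord a)" using p m by (metis coprime_commute coprime_power_left_iff prime_imp_coprime)
    then have "a \<in> powers (a [^] e)" using powers_pow_coprime[OF a(1)] by blast
    then have "a \<in> powers x" using e powers_trans[of x "x [^] p"] x(1) pow_in_powers[of x p] by auto
    then show False using not_comm powers_commute[OF x(1) x(1) refl] by metis
  qed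
  have no_t: "\<not> p ^ m dvd t * (\<Sum>i<p. s ^ i) + e" for t
  proof
    assume d: "p ^ m dvd t * (\<Sum>i<p. s ^ i) + e"
    have "(a [^] t \<otimes> x) [^] p = a [^] (t * (\<Sum>i<p. s ^ i) + e)"
      using twisted_pow[OF a(1) x(1) s] a e by (simp add: nat_pow_mult)
    also have "\<dots> = \<one>" using d m a by (simp add: pow_eq_id)
    finally have "a [^] t \<otimes> x \<in> powers a" using ua a x by simp
    then have "inv (a [^] t) \<otimes> (a [^] t \<otimes> x) \<in> powers a"
      using powers_subgroup[OF a(1)] by (meson pow_in_powers subgroup.m_closed subgroup.m_inv_closed)
    then show False using a x by simp
  qed
  have "\<not> (odd p \<or> s mod 4 = 1)"
  proof
    assume "odd p \<or> s mod 4 = 1"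
    then obtain w where "(\<Sum>i<p. s ^ i) = p * (1 + p * w)" using geometric_sum_mod_prime_square[OF p s1] by blast
    then show False using solve_shifted_power[OF p _ pe] no_t by blast
  qed
  then have p2: "p = 2" and s4: "s mod 4 \<noteq> 1" using p by (auto simp: prime_odd_nat dest: primes_dvd_imp_eq[OF two_is_prime_nat])
  have s3: "s mod 4 = 3" using s1 s4 p2 by presburger
  define w where "w = s div 4"
  have sw: "s = 4 * w + 3" using s3 by (simp add: w_def) presburger
  \<comment> \<open>For \<open>m = 1\<close> the action on \<open>powers a\<close> is trivial
    because \<open>s\<close> is odd.\<close>
  have m2: "m \<ge> 2"
  proof (rule ccontr)
    assume "\<not> m \<ge> 2"
    then have "m = 1" using m(2) by simp
    then have "ord a = 2" using m p2 by simp
    then have "a [^] s = a [^] (1::nat)" using s3 pow_eq_pow_iff[OF a(1), of s 1] by (simp add: cong_def) presburger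
    then have "conjugate x a = a" using s a by simp
    then show False using not_comm a x by (simp add: conjugate_eq_self_iff)
  qed
  then obtain k where k: "m = Suc k" "k \<ge> 1" by (cases m) auto
  have cop: "coprime (2 ^ k) (2 * w + 1)" by simp
  \<comment> \<open>\<open>s - 1 = 2 (2 w + 1)\<close> contains a single factor 2, so
    \<open>s + 1\<close> has to absorb the other \<open>k = m - 1\<close> of them.\<close>
  have "2 ^ m dvd s ^ 2 - 1" using sp p2 by (metis cong_altdef_nat' cong_diff_nat dvd_imp_mod_0 cong_sym_eq cong_to_1_nat)
  also have "s ^ 2 - 1 = 2 * ((2 * w + 1) * (s + 1))" by (simp add: sw power2_eq_square algebra_simps)
  finally have "2 ^ k dvd (2 * w + 1) * (s + 1)" unfolding k(1) power_Suc by (simp only: nat_mult_dvd_cancel_disj) simp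
  then have ks: "2 ^ k dvd s + 1" using cop by (simp only: coprime_dvd_mult_right_iff)
  \<comment> \<open>\<open>x\<close> commutes with \<open>x^2 = a^e\<close>, which gives
    \<open>(s - 1) e = 0\<close> modulo \<open>2^m\<close>.\<close>
  have "conjugate x (a [^] e) = a [^] e" using e x p2 by (metis conjugate_eq_self_iff nat_pow_closed pow_commute)
  then have "a [^] (s * e) = a [^] e" using a x by (simp add: conjugate_pow s nat_pow_pow)
  then have "[s * e = e] (mod 2 ^ m)" using pow_eq_pow_iff[OF a(1)] m p2 by simp
  moreover have "e \<le> s * e" using sw by simp
  ultimately have "2 ^ m dvd s * e - e" using mod_eq_dvd_iff_nat by (simp only: cong_def)
  also have "s * e - e = 2 * ((2 * w + 1) * e)" by (simp add: sw algebra_simps)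
  finally have "2 ^ k dvd (2 * w + 1) * e" unfolding k(1) power_Suc by (simp only: nat_mult_dvd_cancel_disj) simp
  then have ke: "2 ^ k dvd e" using cop by (simp only: coprime_dvd_mult_right_iff)
  then obtain f where f: "e = 2 ^ k * f" by blast
  \<comment> \<open>The choice \<open>t = 0\<close>: the square of \<open>x\<close> itself is
    nontrivial.\<close>
  have "odd f" using no_t[of 0] f k p2 by auto
  then obtain f' where f': "f = 2 * f' + 1" by (rule oddE)
  have "a [^] e = a [^] (2 ^ k :: nat)"
    using pow_eq_pow_iff[OF a(1), of e "2 ^ k"] m p2 k f f' by (simp add: cong_def algebra_simps)
  moreover have "conjugate x a = inv a"
  proof -
    obtain g where g: "s + 1 = 2 ^ k * g" using ks by blast
    \<comment> \<open>The choice \<open>t = 1\<close>: for odd \<open>g\<close> the square of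
      \<open>a x\<close> would have exponent \<open>s + 1 + e = 2^k (g + f)\<close>, a multiple of
      \<open>2^m\<close>.\<close>
    have "even g"
    proof (rule ccontr)
      assume "odd g"
      then obtain g' where g': "g = 2 * g' + 1" by (rule oddE)
      have "1 * (\<Sum>i<p. s ^ i) + e = 2 ^ k * (g + f)" using p2 g f by (simp add: numeral_2_eq_2 algebra_simps)
      also have "\<dots> = 2 ^ m * (g' + f' + 1)" using k f' g' by simp
      finally show False using no_t[of 1] p2 by (metis dvd_triv_left)
    qed
    then have "2 ^ m dvd s + 1" using g k by auto
    then have "a [^] (s + 1) = \<one>" using pow_eq_id[OF a(1), of "s + 1"] m(1) p2 by (simp only:)
    then have "a [^] s \<otimes> a = \<one>" using a by simp
    then show ?thesis using s a by (simp add: inv_equality)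
  qed
  ultimately show ?thesis using p2 m2 e k by simp
qed

text \<open>Every element outside the self-centralizing subgroup \<open>powers a\<close> inverts
  \<open>a\<close>, so a product of two of them centralizes \<open>a\<close> and falls into
  \<open>powers a\<close>. Hence the index is at most 2.\<close>

theorem unique_prime_subgroup_classification:
  assumes p: "Factorial_Ring.prime p" and ordG: "order G = p ^ n" and z: "unique_prime_subgroup p z"
  shows "(\<exists>a\<in>carrier G. carrier G = powers a) \<or> (p = 2 \<and> (\<exists>a b m. quaternion_pair a b m))"
proof -
  obtain a where a: "a \<in> carrier G" "powers a \<lhd> G" and za: "z \<in> powers a"
    and self: "\<forall>x\<in>carrier G. x \<otimes> a = a \<otimes> x \<longrightarrow> x \<in> powers a"
    using self_centralizing_cyclic[OF p ordG z] by metis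
  have ua: "y \<in> powers a" if "y \<in> carrier G" "y [^] p = \<one>" for y
    using that z powers_trans[OF a(1) za] by (auto simp: unique_prime_subgroup_def)
  have "ord a dvd p ^ n" using ord_dvd_group_order[OF a(1)] ordG by simp
  then obtain m where m: "ord a = p ^ m" using p by (meson divides_primepow_nat)
  have "m \<noteq> 0"
  proof
    assume "m = 0"
    then have "ord a = 1" using m by simp
    then have "a = \<one>" using ord_eq_1 a(1) by blast
    then have "z = \<one>" using za by (auto simp: powers_def)
    then show False using z p by (auto simp: unique_prime_subgroup_def prime_nat_iff)
  qed
  then have m1: "m \<ge> 1" by simp
  note act = unique_prime_subgroup_action[OF p ordG a self ua m m1]
  have sa: "subgroup (powers a) G" using a by simp
  have inverts: "p = 2 \<and> m \<ge> 2 \<and> g [^] (2::nat) = a [^] (2 ^ (m - 1) :: nat) \<and> conjugate g a = inv a"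
    if g: "g \<in> carrier G" "g \<notin> powers a" for g
  proof -
    define k where "k = (LEAST k. g [^] (p ^ k) \<in> powers a)"
    have "g [^] (p ^ n) \<in> powers a" using pow_order_eq_1[OF g(1)] ordG by simp
    then have k: "g [^] (p ^ k) \<in> powers a" unfolding k_def by (rule LeastI)
    have kmin: "g [^] (p ^ l) \<notin> powers a" if "l < k" for l using not_less_Least that unfolding k_def by blast
    have "k \<noteq> 0" using k g by (intro notI) simp
    then obtain l where l: "k = Suc l" by (cases k) auto
    have sl: "(g [^] (p ^ l)) [^] p = g [^] (p ^ k)" using g l by (simp add: nat_pow_pow mult.commute)
    have x: "p = 2 \<and> m \<ge> 2 \<and> (g [^] (p ^ l)) [^] (2::nat) = a [^] (2 ^ (m - 1) :: nat) \<and> conjugate (g [^] (p ^ l)) a = inv a"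
      by (rule act) (use g k kmin[of l] sl l in auto)
    \<comment> \<open>For positive \<open>l\<close> the inverting element would be the square of
      some \<open>h\<close>; then -1 would be a square modulo \<open>2^m\<close>, which is
      impossible modulo 4.\<close>
    have "l = 0"
    proof (rule ccontr)
      assume "l \<noteq> 0"
      then obtain j where j: "l = Suc j" by (cases l) auto
      define h where "h = g [^] (p ^ j)"
      have hc: "h \<in> carrier G" using g by (simp add: h_def)
      have "h [^] p = g [^] (p ^ l)" using g j by (simp add: h_def nat_pow_pow mult.commute)
      then have hh: "g [^] (p ^ l) = h \<otimes> h" using x hc pow_sq by metis
      have "conjugate h a \<in> powers a" using conjugate_normal[OF a(2) hc, of a] a(1) by simp
      then obtain s :: nat where s: "conjugate h a = a [^] s" by (auto simp: powers_def)
      have "inv a = conjugate h (conjugate h a)" using x hh hc a by (simp add: conjugate_conjugate)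
      also have "\<dots> = a [^] (s * s)" using s hc a by (simp add: conjugate_pow nat_pow_pow)
      finally have "a [^] (s * s) \<otimes> a = \<one>" using a by (metis l_inv)
      then have "a [^] Suc (s * s) = \<one>" using a by simp
      then have "2 ^ m dvd Suc (s * s)" using a m x by (simp only: pow_eq_id)
      moreover have "(2::nat) ^ 2 dvd 2 ^ m" using x le_imp_power_dvd by blast
      ultimately have "4 dvd Suc (s * s)" by (metis dvd_trans power2_eq_square mult_2 numeral_Bit0)
      then show False
      proof (cases "even s")
        case True
        then have "even (s * s)" by simp
        then show False using \<open>4 dvd Suc (s * s)\<close> by presburger
      next
        case False
        then obtain c where "s = 2 * c + 1" by (rule oddE)
        then have "Suc (s * s) = 4 * (c * c + c) + 2" by (simp add: algebra_simps)
        then show False using \<open>4 dvd Suc (s * s)\<close> by presburger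
      qed
    qed
    then show ?thesis using x g by simp
  qed
  show ?thesis
  proof (cases "carrier G = powers a")
    case False
    then obtain b where b: "b \<in> carrier G" "b \<notin> powers a" using powers_in_carrier[OF a(1)] by blast
    note bp = inverts[OF b]
    have "carrier G = powers a \<union> (\<lambda>x. x \<otimes> b) ` powers a"
    proof
      show "powers a \<union> (\<lambda>x. x \<otimes> b) ` powers a \<subseteq> carrier G" using powers_in_carrier[OF a(1)] b by blast
      show "carrier G \<subseteq> powers a \<union> (\<lambda>x. x \<otimes> b) ` powers a"
      proof
        fix g assume g: "g \<in> carrier G"
        show "g \<in> powers a \<union> (\<lambda>x. x \<otimes> b) ` powers a"
        proof (cases "g \<in> powers a")
          case False
          have "conjugate (g \<otimes> b) a = conjugate g (inv a)" using conjugate_conjugate g b a bp by simp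
          also have "\<dots> = a" using conjugate_inv g a inverts[OF g False] by simp
          finally have "(g \<otimes> b) \<otimes> a = a \<otimes> (g \<otimes> b)" using conjugate_eq_self_iff g b a by simp
          then have gb: "g \<otimes> b \<in> powers a" using self g b by simp
          have "inv (b [^] (2::nat)) \<in> powers a" using bp sa by (simp add: subgroup.m_inv_closed)
          with gb have "(g \<otimes> b) \<otimes> inv (b [^] (2::nat)) \<in> powers a" using sa by (simp add: subgroup.m_closed)
          moreover have "g = (g \<otimes> b) \<otimes> inv (b [^] (2::nat)) \<otimes> b" using g b by (simp add: pow_sq grp_simps)
          ultimately show ?thesis by blast
        qed simp
      qed
    qed
    then have "quaternion_pair a b m" using a b bp m by (simp add: quaternion_pair_def)
    then show ?thesis using bp by blast
  qed (use a in blast)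
qed

end


section \<open>Generalized quaternion groups\<close>

context group
begin

lemma powers_consistent: "group.powers (G\<lparr>carrier := H\<rparr>) a = powers a" if "subgroup H G"
  using that by (simp add: powers_def group.powers_def[OF subgroup_imp_group] flip: nat_pow_consistent)

lemma ord_consistent:
  assumes "subgroup H G" "a \<in> H" shows "group.ord (G\<lparr>carrier := H\<rparr>) a = ord a"
proof -
  interpret H: group "G\<lparr>carrier := H\<rparr>" by (rule subgroup_imp_group[OF assms(1)])
  show ?thesis
    using assms subgroup.mem_carrier[OF assms] H.ord_unique[of a "ord a"]
    by (simp add: pow_eq_id flip: nat_pow_consistent)
qed

lemma conjugate_consistent:
  assumes "subgroup H G" "a \<in> H" "b \<in> H" shows "group.conjugate (G\<lparr>carrier := H\<rparr>) a b = conjugate a b"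
  using assms by (simp add: conjugate_def group.conjugate_def[OF subgroup_imp_group] m_inv_consistent)

end

context fin_group
begin

lemma finite_subgroupI:
  assumes "S \<subseteq> carrier G" "\<one> \<in> S" and mult: "\<And>x y. x \<in> S \<Longrightarrow> y \<in> S \<Longrightarrow> x \<otimes> y \<in> S"
  shows "subgroup S G"
proof (rule subgroupI)
  fix x assume x: "x \<in> S"
  have pow: "x [^] n \<in> S" for n :: nat by (induction n) (use assms x in auto)
  show "inv x \<in> S" using pow inv_eq_pow[of x] assms(1) x by auto
qed (use assms in auto)

section \<open>Squares, involution, center and order of a generalized quaternion group\<close>

context
  fixes a b :: 'a and m :: nat and t :: 'a
  assumes q: "quaternion_pair a b m"
  defines "t \<equiv> a [^] (2 ^ (m - 1) :: nat)"
begin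

lemma quaternion_pair_facts:
  shows "a \<in> carrier G" "b \<in> carrier G" "m \<ge> 2" "ord a = 2 ^ m" "b \<notin> powers a" "b \<otimes> b = t"
    "conjugate b a = inv a" "carrier G = powers a \<union> (\<lambda>x. x \<otimes> b) ` powers a"
  using q pow_sq[of b] by (auto simp: quaternion_pair_def t_def)

lemma quaternion_conj_powers: "x \<in> powers a \<Longrightarrow> conjugate b x = inv x"
  using quaternion_pair_facts(1,2,7) by (auto simp: powers_def conjugate_pow nat_pow_inv)

text \<open>An outside element is \<open>y b\<close> with \<open>y\<close> in
  \<open>powers a\<close>, and \<open>(y b)^2 = y (b y b^-1) b^2 = b^2\<close>; since
  \<open>y\<close> commutes with \<open>powers a\<close>, it acts there like
  \<open>b\<close>.\<close>

lemma quaternion_outside: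
  assumes x: "x \<in> carrier G" "x \<notin> powers a"
  shows "x \<otimes> x = t" "\<And>y. y \<in> powers a \<Longrightarrow> conjugate x y = inv y"
proof -
  note f = quaternion_pair_facts
  obtain y where y: "y \<in> powers a" "x = y \<otimes> b" using x f(8) by blast
  have yc: "y \<in> carrier G" using y powers_in_carrier f by blast
  have "x \<otimes> x = y \<otimes> conjugate b y \<otimes> (b \<otimes> b)" using y yc f(1,2) by (simp add: conjugate_def m_assoc)
  then show "x \<otimes> x = t" using quaternion_conj_powers[OF y(1)] yc f(1,2,6) by (simp add: t_def)
  fix w assume w: "w \<in> powers a"
  have wc: "w \<in> carrier G" using w powers_in_carrier f by blast
  have iw: "inv w \<in> powers a" using w powers_subgroup[OF f(1)] by (simp add: subgroup.m_inv_closed)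
  have "conjugate x w = conjugate y (inv w)" using y yc wc f by (simp add: conjugate_conjugate quaternion_conj_powers[OF w])
  also have "\<dots> = inv w" using powers_abelian[OF f(1) y(1) iw] yc wc by (simp add: conjugate_eq_self_iff)
  finally show "conjugate x w = inv w" .
qed

lemma quaternion_t: "t \<in> powers a" "t \<in> carrier G" "t \<otimes> t = \<one>" "t \<noteq> \<one>"
proof -
  note f = quaternion_pair_facts
  show "t \<in> powers a" "t \<in> carrier G" using f(1) by (auto simp: t_def)
  have "2 ^ (m - 1) + 2 ^ (m - 1) = (2 ^ m :: nat)" using f(3) by (cases m) auto
  then show "t \<otimes> t = \<one>" using f(1,4) by (simp add: t_def nat_pow_mult pow_eq_id)
  have "\<not> 2 ^ m dvd (2 ^ (m - 1) :: nat)" using f(3) by (auto dest: power_dvd_imp_le)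
  then show "t \<noteq> \<one>" using f(1,4) by (simp add: t_def pow_eq_id)
qed

lemma quaternion_involution:
  assumes x: "x \<in> carrier G" "x \<otimes> x = \<one>" shows "x = \<one> \<or> x = t"
proof -
  note f = quaternion_pair_facts
  have "x \<in> powers a" using quaternion_outside(1)[OF x(1)] quaternion_t(4) x(2) by metis
  then obtain k :: nat where k: "x = a [^] k" by (auto simp: powers_def)
  have "2 ^ m dvd k + k" using x(2) k f(1,4) by (simp add: nat_pow_mult pow_eq_id)
  then have "2 * 2 ^ (m - 1) dvd 2 * k" using f(3) by (cases m) (auto simp: mult_2)
  then have "2 ^ (m - 1) dvd k" by simp
  then obtain j where "k = 2 ^ (m - 1) * j" by blast
  then have xt: "x = t [^] j" using k f(1) by (simp add: t_def nat_pow_pow)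
  have "t [^] (2 * i) = \<one>" for i :: nat
    using quaternion_t(2,3) by (simp add: pow_sq flip: nat_pow_pow)
  then show ?thesis using xt quaternion_t(2) by (cases "even j") (auto elim!: evenE oddE)
qed

lemma quaternion_center: "group_center G = {\<one>, t}"
proof
  note f = quaternion_pair_facts
  show "group_center G \<subseteq> {\<one>, t}"
  proof
    fix x assume "x \<in> group_center G"
    then have x: "x \<in> carrier G" "\<And>y. y \<in> carrier G \<Longrightarrow> conjugate y x = x" "\<And>y. y \<in> carrier G \<Longrightarrow> conjugate x y = y"
      by (auto simp: group_center_def conjugate_eq_self_iff)
    \<comment> \<open>A central element outside \<open>powers a\<close> would both invert and fix
      \<open>a\<close>, so \<open>ord a\<close> would divide 2.\<close>
    have "x \<in> powers a"
    proof (rule ccontr)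
      assume "x \<notin> powers a"
      then have "inv a = a" using quaternion_outside(2)[OF x(1), of a] x(3)[of a] f(1) by simp
      then have "a \<otimes> a = \<one>" using f(1) by (metis r_inv)
      then have "2 ^ m dvd (2::nat)" using f(1,4) pow_sq pow_eq_id by metis
      then have "2 ^ m \<le> (2 ^ 1 :: nat)" by (simp add: dvd_imp_le)
      then have "m \<le> 1" by (rule power_le_imp_le_exp[rotated]) simp
      then show False using f(3) by simp
    qed
    then have "inv x = x" using quaternion_conj_powers x(2) f(2) by metis
    then have "x \<otimes> x = \<one>" using x(1) by (metis r_inv)
    then show "x \<in> {\<one>, t}" using quaternion_involution x(1) by blast
  qed
  have "t \<otimes> y = y \<otimes> t" if y: "y \<in> carrier G" for y
  proof (cases "y \<in> powers a")
    case True then show ?thesis using powers_abelian f(1) quaternion_t(1) by blast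
  next
    case False
    have "conjugate y t = inv t" using quaternion_outside(2)[OF y False] quaternion_t(1) by blast
    then have "conjugate y t = t" using quaternion_t by (metis inv_equality)
    then show ?thesis using y quaternion_t(2) by (simp add: conjugate_eq_self_iff)
  qed
  then show "{\<one>, t} \<subseteq> group_center G" using quaternion_t(2) by (auto simp: group_center_def)
qed

lemma quaternion_order: "order G = 2 ^ Suc m"
proof -
  note f = quaternion_pair_facts
  have "card ((\<lambda>x. x \<otimes> b) ` powers a) = card (powers a)"
    using f(2) powers_in_carrier[OF f(1)] by (intro card_image inj_onI) auto
  moreover have "powers a \<inter> (\<lambda>x. x \<otimes> b) ` powers a = {}"
  proof (rule ccontr)
    assume "powers a \<inter> (\<lambda>x. x \<otimes> b) ` powers a \<noteq> {}"
    then obtain x where x: "x \<in> powers a" "x \<otimes> b \<in> powers a" by blast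
    then have "inv x \<otimes> (x \<otimes> b) \<in> powers a"
      using powers_subgroup[OF f(1)] by (simp add: subgroup.m_closed subgroup.m_inv_closed)
    then show False using f(2,5) powers_in_carrier[OF f(1) x(1)] by simp
  qed
  ultimately have "card (carrier G) = card (powers a) + card (powers a)"
    using f(1) by (subst f(8)) (simp add: card_Un_disjoint)
  then show ?thesis using f(1,4) by (simp add: order_def card_powers)
qed

lemma quaternion_pair_imp_generalized_quaternion: "generalized_quaternion G"
proof -
  note f = quaternion_pair_facts
  have s: "subgroup (generate G {a, b}) G" using f(1,2) by (intro generate_is_subgroup) auto
  have ab: "a \<in> generate G {a, b}" "b \<in> generate G {a, b}" by (auto intro: generate.incl)
  have "carrier G \<subseteq> generate G {a, b}"
    using powers_subset[OF s ab(1)] ab s by (subst f(8)) (auto intro: subgroup.m_closed)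
  then have gen: "generate G {a, b} = carrier G" using s subgroup.subset by blast
  have "inv b \<otimes> a \<otimes> b = inv a"
  proof -
    have "conjugate (inv b) (conjugate b (inv a)) = inv a" using f(1,2) by simp
    then have "conjugate (inv b) a = inv a" using f(1,2,7) by (simp add: conjugate_inv)
    then show ?thesis using f(1,2) by (simp add: conjugate_def)
  qed
  moreover have "a [^] (2 ^ m :: nat) = \<one>" using f(1,4) by (simp add: pow_eq_id)
  moreover have "b [^] (2::nat) = a [^] (2 ^ (m - 1) :: nat)" using f(2,6) by (simp add: pow_sq t_def)
  ultimately have "\<exists>a\<in>carrier G. \<exists>b\<in>carrier G. generate G {a, b} = carrier G \<and>
      a [^] (2 ^ (Suc m - 1) :: nat) = \<one> \<and> b [^] (2 :: nat) = a [^] (2 ^ (Suc m - 2) :: nat) \<and> inv b \<otimes> a \<otimes> b = inv a"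
    using gen f(1,2) by (intro bexI[of _ a] bexI[of _ b]) (simp_all add: numeral_2_eq_2)
  then show ?thesis
    unfolding generalized_quaternion_def
    using is_group quaternion_order f(3)
    by (intro conjI exI[of _ "Suc m"]) simp_all
qed

end

text \<open>By the relations, \<open>powers a\<close> together with its coset of \<open>b\<close> is
  closed under products, so it is the whole group. The prescribed order then leaves no room for
  collapse: \<open>a\<close> has order \<open>2^m\<close> and \<open>b\<close> is not a power of
  it.\<close>

lemma generalized_quaternion_imp_quaternion_pair:
  assumes "generalized_quaternion G"
  obtains a b m where "quaternion_pair a b m"
proof -
  obtain n :: nat and a b where n: "n \<ge> 3" and ordG: "order G = 2 ^ n" and a: "a \<in> carrier G" and b: "b \<in> carrier G"
    and gen: "generate G {a, b} = carrier G" and a1: "a [^] (2 ^ (n - 1) :: nat) = \<one>"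
    and b2: "b [^] (2 :: nat) = a [^] (2 ^ (n - 2) :: nat)" and ba: "inv b \<otimes> a \<otimes> b = inv a"
    using assms unfolding generalized_quaternion_def by blast
  obtain m where m: "n = Suc m" "m \<ge> 2" using n by (cases n) auto
  let ?A = "powers a"
  have sA: "subgroup ?A G" using a by simp
  have Ac: "x \<in> carrier G" if "x \<in> ?A" for x using that powers_in_carrier a by blast
  have bb: "b \<otimes> b \<in> ?A" using b2 b by (simp add: pow_sq)
  have cba: "conjugate b a = inv a"
  proof -
    have "conjugate (inv b) a = inv a" using ba a b by (simp add: conjugate_def)
    then have "a = conjugate b (inv a)" using a b by (metis conjugate_cancel(1))
    then show ?thesis using a b by (metis conjugate_inv conjugate_closed inv_inv)
  qed
  have cb: "conjugate b x = inv x" if "x \<in> ?A" for x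
    using that a b cba by (auto simp: powers_def conjugate_pow nat_pow_inv)
  have bx: "b \<otimes> x = inv x \<otimes> b" if "x \<in> ?A" for x
  proof -
    have "conjugate b x \<otimes> b = inv x \<otimes> b" using cb that by simp
    then show ?thesis using b Ac[OF that] by (simp add: conjugate_def m_assoc)
  qed
  define S where "S = ?A \<union> (\<lambda>x. x \<otimes> b) ` ?A"
  have inA: "x \<in> ?A \<Longrightarrow> x \<in> S" and inAb: "x \<in> ?A \<Longrightarrow> x \<otimes> b \<in> S" for x by (auto simp: S_def)
  note mA = subgroup.m_closed[OF sA] subgroup.m_inv_closed[OF sA]
  have "subgroup S G"
  proof (rule finite_subgroupI)
    show "S \<subseteq> carrier G" using Ac b by (auto simp: S_def)
    show "\<one> \<in> S" using inA[OF one_in_powers] .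
    fix x y assume x: "x \<in> S" and y: "y \<in> S"
    consider "x \<in> ?A" "y \<in> ?A" | w where "x \<in> ?A" "w \<in> ?A" "y = w \<otimes> b" | v where "v \<in> ?A" "x = v \<otimes> b" "y \<in> ?A"
      | v w where "v \<in> ?A" "x = v \<otimes> b" "w \<in> ?A" "y = w \<otimes> b" using x y by (auto simp: S_def)
    then show "x \<otimes> y \<in> S"
    proof cases
      case 1 then show ?thesis using inA mA by blast
    next
      case 2
      then have "x \<otimes> y = (x \<otimes> w) \<otimes> b" using Ac b by (simp add: m_assoc)
      then show ?thesis using inAb mA 2 by metis
    next
      case 3
      then have "x \<otimes> y = v \<otimes> (b \<otimes> y)" using Ac b by (simp add: m_assoc)
      also have "\<dots> = (v \<otimes> inv y) \<otimes> b" using bx[OF 3(3)] 3 Ac b by (simp add: m_assoc)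
      finally show ?thesis using inAb mA 3 by metis
    next
      case 4
      then have "x \<otimes> y = v \<otimes> (b \<otimes> w) \<otimes> b" using Ac b by (simp add: m_assoc)
      also have "\<dots> = v \<otimes> inv w \<otimes> (b \<otimes> b)" using bx[OF 4(3)] 4 Ac b by (simp add: m_assoc)
      finally show ?thesis using inA mA bb 4 by metis
    qed
  qed
  moreover have "a \<in> S" "b \<in> S" using inA[OF powers_self[OF a]] inAb[OF one_in_powers] b by auto
  ultimately have "carrier G \<subseteq> S" using gen generate_subgroup_incl[of "{a, b}" S] by auto
  then have GS: "carrier G = S" using Ac b by (auto simp: S_def)
  have "card (carrier G) \<le> card ?A + card ((\<lambda>x. x \<otimes> b) ` ?A)" unfolding GS S_def by (rule card_Un_le)
  also have "\<dots> \<le> ord a + ord a" using card_image_le[of ?A "\<lambda>x. x \<otimes> b"] sA a by (simp add: card_powers)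
  finally have le: "2 ^ Suc m \<le> 2 * ord a" using ordG m by (simp add: order_def)
  have "ord a dvd 2 ^ m" using a1 a m by (simp add: pow_eq_id)
  then have "ord a \<le> 2 ^ m" by (simp add: dvd_imp_le)
  then have oa: "ord a = 2 ^ m" using le by simp
  have "b \<notin> ?A"
  proof
    assume "b \<in> ?A"
    then have "S \<subseteq> ?A" using mA by (auto simp: S_def)
    then have "card (carrier G) \<le> card ?A" using GS sA by (simp add: card_mono)
    then show False using ordG oa a m by (simp add: card_powers order_def)
  qed
  then have "quaternion_pair a b m"
    using a b m oa b2 cba GS by (auto simp: quaternion_pair_def S_def)
  then show ?thesis using that by blast
qed

end


section \<open>The subgroup \<open>K(G)\<close>\<close>

context fin_group
begin

lemma range_int_pow_eq_powers: "a \<in> carrier G \<Longrightarrow> range (\<lambda>n::int. a [^] n) = powers a"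
  using generate_pow[of a] powers_eq_generate[of a] by auto

lemma cyclic_group_subgroup_iff:
  assumes H: "subgroup H G"
  shows "cyclic_group (G\<lparr>carrier := H\<rparr>) \<longleftrightarrow> (\<exists>c\<in>H. H = powers c)"
proof -
  interpret H: fin_group "G\<lparr>carrier := H\<rparr>" by (rule fin_group_subgroup[OF H])
  show ?thesis unfolding H.cyclic_group using H.range_int_pow_eq_powers powers_consistent[OF H] by auto
qed

lemma subgroup_of_powers_cyclic:
  assumes h: "h \<in> carrier G" and H: "subgroup H G" "H \<subseteq> powers h"
  shows "\<exists>c\<in>H. H = powers c"
proof -
  define k :: nat where "k = (LEAST k. k > 0 \<and> h [^] k \<in> H)"
  have "order G > 0 \<and> h [^] order G \<in> H"
    using pow_order_eq_1[OF h] subgroup.one_closed[OF H(1)] order_pos by simp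
  then have "k > 0 \<and> h [^] k \<in> H" 
    unfolding k_def by (rule LeastI[where P = "\<lambda>k::nat. k > 0 \<and> h [^] k \<in> H"])
  then have k: "k > 0" "h [^] k \<in> H" by auto
  have kmin: "l = 0" if "h [^] l \<in> H" "l < k" for l
    using not_less_Least[of l "\<lambda>k::nat. k > 0 \<and> h [^] k \<in> H"] that unfolding k_def by auto
  have "H \<subseteq> powers (h [^] k)"
  proof
    fix x assume x: "x \<in> H"
    then obtain j :: nat where j: "x = h [^] j" using H(2) by (auto simp: powers_def)
    have "h [^] j = (h [^] k) [^] (j div k) \<otimes> h [^] (j mod k)"
      using h by (simp add: nat_pow_pow nat_pow_mult)
    then have "h [^] (j mod k) = inv ((h [^] k) [^] (j div k)) \<otimes> x"
      using h j by simp
    also have "\<dots> \<in> H" using H(1) k(2) x by (simp add: subgroup.m_closed subgroup.m_inv_closed subgroup_pow_closed)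
    finally have "j mod k = 0" using kmin k(1) by simp
    then have "x = (h [^] k) [^] (j div k)" using j h by (simp add: nat_pow_pow mod_0_imp_dvd)
    then show "x \<in> powers (h [^] k)" by simp
  qed
  then show ?thesis using k(2) powers_subset[OF H(1) k(2)] by blast
qed

text \<open>Subgroups of cyclic groups are cyclic, so two elements generate a cyclic group as soon
  as they lie in a common one. This form allows cyclic subgroups to be chained.\<close>

lemma cyclicizer_iff:
  "x \<in> cyclicizer G \<longleftrightarrow> x \<in> carrier G \<and> (\<forall>g\<in>carrier G. \<exists>h\<in>carrier G. x \<in> powers h \<and> g \<in> powers h)"
proof -
  have "cyclic_group (subgroup_generated G {x, g}) \<longleftrightarrow> (\<exists>h\<in>carrier G. x \<in> powers h \<and> g \<in> powers h)"
    if xg: "x \<in> carrier G" "g \<in> carrier G" for x g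
  proof -
    let ?S = "generate G {x, g}"
    have S: "subgroup ?S G" using xg by (intro generate_is_subgroup) auto
    have "subgroup_generated G {x, g} = G\<lparr>carrier := ?S\<rparr>" using xg by (simp add: subgroup_generated_def)
    then have "cyclic_group (subgroup_generated G {x, g}) \<longleftrightarrow> (\<exists>c\<in>?S. ?S = powers c)"
      using cyclic_group_subgroup_iff[OF S] by simp
    also have "\<dots> \<longleftrightarrow> (\<exists>h\<in>carrier G. x \<in> powers h \<and> g \<in> powers h)"
    proof
      assume "\<exists>c\<in>?S. ?S = powers c"
      then obtain c where c: "c \<in> ?S" "?S = powers c" by blast
      have "x \<in> ?S" "g \<in> ?S" by (auto intro: generate.incl)
      then show "\<exists>h\<in>carrier G. x \<in> powers h \<and> g \<in> powers h" using c subgroup.mem_carrier[OF S] by auto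
    next
      assume "\<exists>h\<in>carrier G. x \<in> powers h \<and> g \<in> powers h"
      then obtain h where h: "h \<in> carrier G" "x \<in> powers h" "g \<in> powers h" by blast
      then have "?S \<subseteq> powers h" by (intro generate_subgroup_incl) auto
      then show "\<exists>c\<in>?S. ?S = powers c" using subgroup_of_powers_cyclic[OF h(1) S] by blast
    qed
    finally show ?thesis .
  qed
  then show ?thesis by (auto simp: cyclicizer_def)
qed

lemma cyclicizer_subset_center: "cyclicizer G \<subseteq> group_center G"
  using powers_abelian by (auto simp: cyclicizer_iff group_center_def) blast

text \<open>Chaining: \<open>powers h\<close> contains \<open>y\<close> and \<open>g\<close>, and
  \<open>powers k\<close> contains \<open>x\<close> and \<open>h\<close>, hence also
  \<open>x y\<close> and \<open>g\<close>.\<close>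

lemma cyclicizer_subgroup: "subgroup (cyclicizer G) G"
proof (rule finite_subgroupI)
  show "cyclicizer G \<subseteq> carrier G" by (auto simp: cyclicizer_iff)
  show "\<one> \<in> cyclicizer G" unfolding cyclicizer_iff using powers_self one_in_powers one_closed by blast
  fix x y assume x: "x \<in> cyclicizer G" and y: "y \<in> cyclicizer G"
  have xy: "x \<in> carrier G" "y \<in> carrier G" using x y by (auto simp: cyclicizer_iff)
  have "\<exists>h\<in>carrier G. x \<otimes> y \<in> powers h \<and> g \<in> powers h" if g: "g \<in> carrier G" for g
  proof -
    obtain h where h: "h \<in> carrier G" "y \<in> powers h" "g \<in> powers h" using y g by (auto simp: cyclicizer_iff)
    obtain k where k: "k \<in> carrier G" "x \<in> powers k" "h \<in> powers k" using x h(1) by (auto simp: cyclicizer_iff)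
    have "y \<in> powers k" "g \<in> powers k" using h k powers_trans by blast+
    moreover have "x \<otimes> y \<in> powers k" using k calculation powers_subgroup subgroup.m_closed by metis
    ultimately show ?thesis using k(1) by blast
  qed
  then show "x \<otimes> y \<in> cyclicizer G" using xy by (simp add: cyclicizer_iff)
qed

lemma prime_ord_iff:
  assumes "Factorial_Ring.prime p" "x \<in> carrier G"
  shows "ord x = p \<longleftrightarrow> x [^] p = \<one> \<and> x \<noteq> \<one>"
proof
  assume "ord x = p"
  then show "x [^] p = \<one> \<and> x \<noteq> \<one>" using assms ord_id by (auto simp: prime_nat_iff)
next
  assume "x [^] p = \<one> \<and> x \<noteq> \<one>"
  then have "ord x dvd p" "ord x \<noteq> 1" using assms(2) ord_eq_1 by (auto simp: pow_eq_id)
  then show "ord x = p" using assms(1) by (auto simp: prime_nat_iff)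
qed

lemma powers_eq_prime:
  assumes p: "Factorial_Ring.prime p" and z: "z \<in> carrier G" "ord z = p" and y: "y \<in> powers z" "y \<noteq> \<one>"
  shows "z \<in> powers y"
proof -
  obtain k :: nat where k: "y = z [^] k" using y by (auto simp: powers_def)
  have "\<not> p dvd k" using y(2) k z by (simp add: pow_eq_id)
  then have "coprime k (ord z)" using p z by (metis coprime_commute prime_imp_coprime)
  then show ?thesis using powers_pow_coprime z k by blast
qed

text \<open>An element of order \<open>p\<close> in \<open>K(G)\<close> shares a cyclic group with
  every other element of order \<open>p\<close>, and a cyclic group has only one subgroup of that
  order. Conversely, \<open>z\<close> is a power of \<open>g\<close> when \<open>p\<close> divides
  \<open>ord g\<close>; otherwise both are powers of \<open>z g\<close>, the orders being coprime
  and \<open>z\<close> central.\<close>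

theorem prime_dvd_card_cyclicizer_iff:
  assumes p: "Factorial_Ring.prime p"
  shows "p dvd card (cyclicizer G) \<longleftrightarrow> (\<exists>z\<in>group_center G. unique_prime_subgroup p z)"
proof
  assume "p dvd card (cyclicizer G)"
  then obtain x where x: "x \<in> cyclicizer G" "x [^] p = \<one>" "x \<noteq> \<one>"
    using cauchy_subgroup[OF p cyclicizer_subgroup] by metis
  have xc: "x \<in> carrier G" using x(1) by (simp add: cyclicizer_iff)
  then have xo: "ord x = p" using x prime_ord_iff[OF p] by blast
  have "y \<in> powers x" if y: "y \<in> carrier G" "y [^] p = \<one>" for y
  proof -
    obtain h where h: "h \<in> carrier G" "x \<in> powers h" "y \<in> powers h" using x(1) y(1) by (auto simp: cyclicizer_iff)
    obtain i j :: nat where i: "x = h [^] i" and j: "y = h [^] j" using h by (auto simp: powers_def)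
    have N: "ord h dvd i * p" "ord h dvd j * p" "\<not> ord h dvd i"
      using x(2,3) y(2) i j h(1) by (simp_all add: nat_pow_pow pow_eq_id)
    have "p dvd ord h"
    proof (rule ccontr)
      assume "\<not> p dvd ord h"
      then have "coprime (ord h) p" using p by (metis coprime_commute prime_imp_coprime)
      then show False using N by (simp add: coprime_dvd_mult_left_iff)
    qed
    \<comment> \<open>\<open>h^M\<close> generates the subgroup of order \<open>p\<close> of
      \<open>powers h\<close>, in which both \<open>x\<close> and \<open>y\<close> lie.\<close>
    then obtain M where M: "ord h = p * M" by blast
    have p0: "p > 0" using p by (simp add: prime_gt_0_nat)
    have "M dvd i" "M dvd j" using N M p0 by (simp_all add: mult.commute)
    then obtain i' j' where ij: "i = M * i'" "j = M * j'" by blast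
    have c: "h [^] M \<in> carrier G" using h by simp
    have "ord h > 0" using ord_ge_1[OF fin h(1)] by simp
    then have "ord (h [^] M) = p" using h(1) M by (simp add: ord_pow)
    moreover have "x \<in> powers (h [^] M)" "y \<in> powers (h [^] M)"
      using i j ij h(1) by (simp_all flip: nat_pow_pow)
    ultimately have "h [^] M \<in> powers x" using powers_eq_prime[OF p c] x(3) by blast
    then show ?thesis using \<open>y \<in> powers (h [^] M)\<close> powers_trans xc by blast
  qed
  then have "unique_prime_subgroup p x" using xc xo by (simp add: unique_prime_subgroup_def)
  then show "\<exists>z\<in>group_center G. unique_prime_subgroup p z" using x(1) cyclicizer_subset_center by blast
next
  assume "\<exists>z\<in>group_center G. unique_prime_subgroup p z"
  then obtain z where zZ: "z \<in> group_center G" and z: "unique_prime_subgroup p z" by blast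
  have zc: "z \<in> carrier G" and zo: "ord z = p" and zu: "\<And>y. y \<in> carrier G \<Longrightarrow> y [^] p = \<one> \<Longrightarrow> y \<in> powers z"
    using z by (auto simp: unique_prime_subgroup_def)
  have "\<exists>h\<in>carrier G. z \<in> powers h \<and> g \<in> powers h" if g: "g \<in> carrier G" for g
  proof (cases "z \<in> powers g")
    case False
    have np: "\<not> p dvd ord g"
    proof
      assume "p dvd ord g"
      then obtain M where M: "ord g = p * M" by blast
      have "ord g > 0" using ord_ge_1[OF fin g] by simp
      then have "ord (g [^] M) = p" using g M by (simp add: ord_pow)
      then have "g [^] M \<in> powers z" "g [^] M \<noteq> \<one>"
        using zu[of "g [^] M"] prime_ord_iff[OF p, of "g [^] M"] g by auto
      then have "z \<in> powers (g [^] M)" using powers_eq_prime[OF p zc zo] by blast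
      then show False using False powers_trans[OF g, of "g [^] M"] by auto
    qed
    define h where "h = z \<otimes> g"
    have hc: "h \<in> carrier G" using zc g by (simp add: h_def)
    have zg: "z \<otimes> g = g \<otimes> z" using zZ g by (auto simp: group_center_def)
    \<comment> \<open>Raising to the power \<open>ord g\<close> kills \<open>g\<close> and leaves a
      generator of \<open>powers z\<close>.\<close>
    have "h [^] ord g = z [^] ord g \<otimes> g [^] ord g" unfolding h_def using zc g zg by (intro pow_mult_distrib) auto
    then have hz: "h [^] ord g = z [^] ord g" using zc g by simp
    have "coprime (ord g) (ord z)" using np p zo by (metis coprime_commute prime_imp_coprime)
    then have "z \<in> powers (h [^] ord g)" using powers_pow_coprime[OF zc] hz by metis
    then have zh: "z \<in> powers h" using powers_trans[OF hc, of "h [^] ord g"] by auto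
    have sh: "subgroup (powers h) G" using hc by simp
    have "inv z \<otimes> h \<in> powers h"
      by (rule subgroup.m_closed[OF sh subgroup.m_inv_closed[OF sh zh] powers_self[OF hc]])
    then have "g \<in> powers h" using zc g by (simp add: h_def)
    then show ?thesis using zh hc by blast
  qed (use g in auto)
  then have "z \<in> cyclicizer G" using zc by (simp add: cyclicizer_iff)
  then have "z [^] card (cyclicizer G) = \<one>" using subgroup_pow_card cyclicizer_subgroup by blast
  then show "p dvd card (cyclicizer G)" using zc zo by (simp add: pow_eq_id)
qed

text \<open>It serves to exclude 4 as a divisor of \<open>|K(G)|\<close>. A Sylow 2-subgroup of
  \<open>H\<close> has an element besides 1 and \<open>z\<close>; its square is nontrivial because
  \<open>z\<close> is the only involution, and a suitable power of it has order 4.\<close>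

lemma unique_involution_order_4:
  assumes z: "unique_prime_subgroup 2 z" and H: "subgroup H G" "4 dvd card H"
  obtains v where "v \<in> H" "v [^] (4::nat) = \<one>" "v [^] (2::nat) \<noteq> \<one>"
proof -
  have two: "Factorial_Ring.prime (2::nat)" by simp
  interpret H: fin_group "G\<lparr>carrier := H\<rparr>" by (rule fin_group_subgroup[OF H(1)])
  obtain V where "sylow_subgroup 2 V (G\<lparr>carrier := H\<rparr>)" using H.sylow_exists[OF two] .
  then have sV: "subgroup V (G\<lparr>carrier := H\<rparr>)" and cV: "card V = 2 ^ multiplicity 2 (card H)"
    by (auto simp: sylow_subgroup_def order_def)
  have VH: "V \<subseteq> H" using subgroup.subset[OF sV] by simp
  have sV': "subgroup V G" using incl_subgroup[OF H(1) sV] .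
  have "card H \<noteq> 0" using card_subgroup_pos[OF H(1)] by simp
  then have "multiplicity 2 (card H) \<ge> 2" using H(2) by (intro multiplicity_geI) auto
  then have "card V \<ge> 2 ^ 2" unfolding cV by (rule power_increasing) simp
  then have "card V > card {\<one>, z}" using card_insert_le_m1[of 2 "{z}" \<one>] by simp
  then have "\<not> V \<subseteq> {\<one>, z}" using card_mono[of "{\<one>, z}" V] by auto
  then obtain v where v: "v \<in> V" "v \<noteq> \<one>" "v \<noteq> z" by blast
  have vc: "v \<in> carrier G" using v sV' subgroup.mem_carrier by metis
  have zc: "z \<in> carrier G" and zo: "ord z = 2" using z by (auto simp: unique_prime_subgroup_def)
  have pz: "powers z \<subseteq> {\<one>, z}"
  proof
    fix y assume "y \<in> powers z"
    then obtain k :: nat where k: "y = z [^] k" by (auto simp: powers_def)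
    have "[k = k mod 2] (mod ord z)" using zo by (simp add: cong_def)
    then have "y = z [^] (k mod 2)" using k pow_eq_pow_iff[OF zc] by blast
    then show "y \<in> {\<one>, z}" using zc by (cases "even k") (auto simp: odd_iff_mod_2_eq_one even_iff_mod_2_eq_zero)
  qed
  have v2: "v [^] (2::nat) \<noteq> \<one>" using z v vc pz by (auto simp: unique_prime_subgroup_def)
  have "v [^] card V = \<one>" using subgroup_pow_card[OF sV' v(1)] .
  then have "ord v dvd 2 ^ multiplicity 2 (card H)" using vc cV by (simp add: pow_eq_id)
  then obtain j where j: "ord v = 2 ^ j" using two by (meson divides_primepow_nat)
  have "\<not> ord v dvd 2" using v2 vc by (simp add: pow_eq_id)
  then have "j \<ge> 2" using j by (metis One_nat_def dvd_refl less_2_cases not_less one_dvd power_0 power_one_right)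
  then obtain i where i: "j = i + 2" by (metis add.commute le_Suc_ex)
  define w where "w = v [^] (2 ^ i :: nat)"
  have "ord w = 4" unfolding w_def using vc j i by (subst ord_pow) (auto simp: power_add)
  moreover have wc: "w \<in> carrier G" using vc by (simp add: w_def)
  ultimately have "w [^] (4::nat) = \<one>" "w [^] (2::nat) \<noteq> \<one>" by (auto simp: pow_eq_id)
  moreover have "w \<in> H" using v VH H(1) subgroup_pow_closed by (auto simp: w_def)
  ultimately show ?thesis using that by blast
qed

end


section \<open>The 2-core of a group with a unique involution\<close>

lemma odd_geometric_sum:
  assumes "odd (s::int)" shows "odd (\<Sum>i<n. s ^ i) \<longleftrightarrow> odd n"
  using assms by (induction n) auto

context group
begin

definition unique_involution :: "'a \<Rightarrow> bool" where
  "unique_involution t \<longleftrightarrow> t \<in> carrier G \<and> t \<noteq> \<one> \<and> t \<otimes> t = \<one> \<and>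
     (\<forall>x\<in>carrier G. x \<otimes> x = \<one> \<longrightarrow> x = \<one> \<or> x = t)"

text \<open>A witnessing odd exponent, rather than the order itself, passes directly to powers,
  conjugates and images.\<close>

definition odd_element :: "'a \<Rightarrow> bool" where
  "odd_element x \<longleftrightarrow> x \<in> carrier G \<and> (\<exists>n::nat. odd n \<and> x [^] n = \<one>)"

text \<open>This is \<open>quaternion_pair\<close> for the subgroup \<open>F\<close>, written with
  the operations of the whole group because elements outside \<open>F\<close> are to act on it by
  conjugation.\<close>

definition quaternion_on :: "'a set \<Rightarrow> 'a \<Rightarrow> 'a \<Rightarrow> nat \<Rightarrow> bool" where
  "quaternion_on F a b m \<longleftrightarrow> subgroup F G \<and> a \<in> F \<and> b \<in> F \<and> m \<ge> 2 \<and> ord a = 2 ^ m \<and>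
     b \<notin> powers a \<and> b \<otimes> b = a [^] (2 ^ (m - 1) :: nat) \<and> conjugate b a = inv a \<and>
     F = powers a \<union> (\<lambda>x. x \<otimes> b) ` powers a"

definition centralizes :: "'a \<Rightarrow> 'a set \<Rightarrow> bool" where
  "centralizes x F \<longleftrightarrow> x \<in> carrier G \<and> (\<forall>y\<in>F. conjugate x y = y)"

end

context fin_group
begin

lemma unique_prime_subgroup_2_iff: "unique_prime_subgroup 2 t \<longleftrightarrow> unique_involution t"
proof -
  have *: "powers t = {\<one>, t}" if "t \<in> carrier G" "t \<otimes> t = \<one>"
  proof -
    have "t [^] (2 * i) = \<one>" for i :: nat using that by (simp add: pow_sq flip: nat_pow_pow)
    then have "t [^] k \<in> {\<one>, t}" for k :: nat using that by (cases "even k") (auto elim!: evenE oddE)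
    then show ?thesis using that one_in_powers powers_self by (auto simp: powers_def simp del: pow_in_powers one_in_powers powers_self)
  qed
  show ?thesis
  proof
    assume "unique_prime_subgroup 2 t"
    then have t: "t \<in> carrier G" "ord t = 2" "\<And>x. x \<in> carrier G \<Longrightarrow> x [^] (2::nat) = \<one> \<Longrightarrow> x \<in> powers t"
      by (auto simp: unique_prime_subgroup_def)
    then have "t \<otimes> t = \<one>" "t \<noteq> \<one>" using prime_ord_iff[of 2 t] pow_sq[of t] by auto
    then show "unique_involution t" using t *[of] pow_sq by (auto simp: unique_involution_def)
  next
    assume "unique_involution t"
    then have t: "t \<in> carrier G" "t \<noteq> \<one>" "t \<otimes> t = \<one>" "\<And>x. x \<in> carrier G \<Longrightarrow> x \<otimes> x = \<one> \<Longrightarrow> x = \<one> \<or> x = t"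
      by (auto simp: unique_involution_def)
    then show "unique_prime_subgroup 2 t"
      using prime_ord_iff[of 2 t] pow_sq * unfolding unique_prime_subgroup_def by (metis insertI1 insertI2 two_is_prime_nat)
  qed
qed

lemma unique_involution_central: "unique_involution t \<Longrightarrow> t \<in> group_center G"
proof -
  assume t: "unique_involution t"
  then have tc: "t \<in> carrier G" by (simp add: unique_involution_def)
  have "t \<otimes> g = g \<otimes> t" if g: "g \<in> carrier G" for g
  proof -
    have "conjugate g t \<otimes> conjugate g t = \<one>" using t g by (simp add: unique_involution_def flip: conjugate_mult)
    moreover have "conjugate g t \<noteq> \<one>" using t g tc conjugate_eq_iff[OF g tc one_closed] by (simp add: unique_involution_def)
    ultimately have "conjugate g t = t" using t g by (auto simp: unique_involution_def)
    then show ?thesis using g tc by (simp add: conjugate_eq_self_iff)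
  qed
  then show ?thesis using tc by (simp add: group_center_def)
qed

lemma quaternion_on_iff:
  assumes F: "subgroup F G"
  shows "group.quaternion_pair (G\<lparr>carrier := F\<rparr>) a b m \<longleftrightarrow> quaternion_on F a b m"
proof -
  interpret F: fin_group "G\<lparr>carrier := F\<rparr>" by (rule fin_group_subgroup[OF F])
  have "F \<subseteq> carrier G" by (rule subgroup.subset[OF F])
  then show ?thesis
    using F pow_sq[of b] by (auto simp: F.quaternion_pair_def quaternion_on_def powers_consistent ord_consistent
      conjugate_consistent m_inv_consistent simp flip: nat_pow_consistent)
qed

text \<open>The automorphism group of a cyclic 2-group is a 2-group. Numerically,
  \<open>s^n - 1\<close> is \<open>s - 1\<close> times a sum of \<open>n\<close> odd terms, and for
  odd \<open>n\<close> that sum is a unit modulo \<open>2^m\<close>.\<close>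

lemma odd_element_normalizing_cyclic:
  assumes a: "a \<in> carrier G" "ord a = 2 ^ m" and x: "odd_element x" "conjugate x a \<in> powers a"
  shows "conjugate x a = a"
proof (cases "m = 0")
  case True
  then have "ord a = 1" using a by simp
  then have "a = \<one>" using a ord_eq_1 by blast
  then show ?thesis using x by (simp add: odd_element_def)
next
  case False
  obtain n :: nat where n: "odd n" "x [^] n = \<one>" and xc: "x \<in> carrier G" using x(1) by (auto simp: odd_element_def)
  obtain s :: nat where s: "conjugate x a = a [^] s" using x(2) by (auto simp: powers_def)
  have "a [^] (s ^ n) = a [^] (1::nat)" using conjugate_pow_exponent[OF a(1) xc s, of n] n a by simp
  then have sn: "[s ^ n = 1] (mod 2 ^ m)" using pow_eq_pow_iff[OF a(1), of "s ^ n" 1] a(2) by (simp only:)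
  have "odd s"
  proof
    assume "even s"
    then have "even (s ^ n)" using n by (cases n) auto
    moreover have "[s ^ n = 1] (mod 2)" using False by (intro cong_dvd_modulus_nat[OF sn]) (cases m, auto)
    ultimately show False by (simp add: cong_def even_iff_mod_2_eq_zero)
  qed
  have "[int (s ^ n) = int 1] (mod int (2 ^ m))" using sn by (simp only: cong_int_iff)
  then have "2 ^ m dvd int s ^ n - 1" by (simp add: cong_iff_dvd_diff)
  then have "2 ^ m dvd (int s - 1) * (\<Sum>i<n. int s ^ i)" by (simp only: power_diff_1_eq)
  moreover have "coprime (2 ^ m) (\<Sum>i<n. int s ^ i)"
    using odd_geometric_sum[of "int s" n] \<open>odd s\<close> n by simp
  ultimately have "2 ^ m dvd int s - 1" by (simp add: coprime_dvd_mult_left_iff)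
  then have "[int s = int 1] (mod int (2 ^ m))" by (simp add: cong_iff_dvd_diff)
  then have "[s = 1] (mod 2 ^ m)" by (simp only: cong_int_iff)
  then have "a [^] s = a [^] (1::nat)" using pow_eq_pow_iff[OF a(1)] a(2) by metis
  then show ?thesis using s a by simp
qed

lemma odd_element_p_subgroup_trivial:
  assumes "odd_element x" "x \<in> F" "subgroup F G" "card F = 2 ^ k" shows "x = \<one>"
proof -
  obtain n :: nat where "odd n" "x [^] n = \<one>" "x \<in> carrier G" using assms(1) by (auto simp: odd_element_def)
  moreover have "x [^] (2 ^ k :: nat) = \<one>" using subgroup_pow_card[OF assms(3,2)] assms(4) by simp
  ultimately show ?thesis using pow_eq_one_coprime[of x n "2 ^ k"] by simp
qed

text \<open>Raising \<open>x\<close> to the 2-part of the group order leaves an element killed by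
  the odd part, hence a trivial one.\<close>

lemma odd_elements_trivial_imp_2_group:
  assumes H: "subgroup H G" and triv: "\<And>x. x \<in> H \<Longrightarrow> odd_element x \<Longrightarrow> x = \<one>"
  shows "\<exists>k. card H = 2 ^ k"
proof (rule card_prime_powerI[OF two_is_prime_nat H])
  fix x assume x: "x \<in> H"
  obtain r where r: "card H = 2 ^ multiplicity 2 (card H) * r" "\<not> 2 dvd r"
    using multiplicity_decompose'[of "card H" 2] card_subgroup_pos[OF H] by auto
  have xc: "x \<in> carrier G" using H x by (rule subgroup.mem_carrier)
  let ?y = "x [^] (2 ^ multiplicity 2 (card H) :: nat)"
  have "?y [^] r = \<one>" using subgroup_pow_card[OF H x] r(1) xc by (metis nat_pow_pow)
  then have "odd_element ?y" using r(2) xc by (auto simp: odd_element_def)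
  then have "?y = \<one>" using triv subgroup_pow_closed[OF H x] by blast
  then show "\<exists>k::nat. x [^] (2 ^ k :: nat) = \<one>" by blast
qed

lemma odd_element_pow: "odd_element x \<Longrightarrow> odd_element (x [^] (k::nat))"
  unfolding odd_element_def by (metis nat_pow_closed nat_pow_pow mult.commute nat_pow_one)

lemma odd_element_square_trivial:
  assumes "odd_element x" "x [^] (2 ^ k :: nat) = \<one>" shows "x = \<one>"
proof -
  obtain n :: nat where "odd n" "x [^] n = \<one>" "x \<in> carrier G" using assms(1) by (auto simp: odd_element_def)
  then show ?thesis using pow_eq_one_coprime[of x n "2 ^ k"] assms(2) by simp
qed

context
  fixes F a b m
  assumes q: "quaternion_on F a b m"
begin

lemma quaternion_on_facts:
  shows "subgroup F G" "a \<in> F" "b \<in> F" "m \<ge> 2" "ord a = 2 ^ m" "b \<notin> powers a" "conjugate b a = inv a"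
    "F = powers a \<union> (\<lambda>x. x \<otimes> b) ` powers a" "a \<in> carrier G" "b \<in> carrier G" "F \<subseteq> carrier G"
    "powers a \<subseteq> F"
proof -
  show F: "subgroup F G" and a: "a \<in> F" "b \<in> F" "m \<ge> 2" "ord a = 2 ^ m" "b \<notin> powers a" "conjugate b a = inv a"
    "F = powers a \<union> (\<lambda>x. x \<otimes> b) ` powers a"
    using q unfolding quaternion_on_def by blast+
  show "F \<subseteq> carrier G" using F by (rule subgroup.subset)
  then show "a \<in> carrier G" "b \<in> carrier G" using a by auto
  show "powers a \<subseteq> F" using powers_subset[OF F a(1)] .
qed

lemma quaternion_on_outside:
  assumes x: "x \<in> F" "x \<notin> powers a"
  shows "x \<otimes> x = a [^] (2 ^ (m - 1) :: nat)" "conjugate x a = inv a"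
proof -
  note f = quaternion_on_facts
  interpret F: fin_group "G\<lparr>carrier := F\<rparr>" by (rule fin_group_subgroup[OF f(1)])
  have qp: "F.quaternion_pair a b m" using q quaternion_on_iff[OF f(1)] by simp
  show "x \<otimes> x = a [^] (2 ^ (m - 1) :: nat)"
    using F.quaternion_outside(1)[OF qp, of x] x powers_consistent[OF f(1)] by (simp flip: nat_pow_consistent)
  show "conjugate x a = inv a"
    using F.quaternion_outside(2)[OF qp, of x a] x f(1,2,9) powers_consistent[OF f(1)]
    by (simp add: conjugate_consistent m_inv_consistent)
qed

lemma quaternion_on_card: "card F = 2 ^ Suc m"
proof -
  note f = quaternion_on_facts
  interpret F: fin_group "G\<lparr>carrier := F\<rparr>" by (rule fin_group_subgroup[OF f(1)])
  have qp: "F.quaternion_pair a b m" using q quaternion_on_iff[OF f(1)] by simp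
  show ?thesis using F.quaternion_order[OF qp] by (simp add: order_def)
qed

lemma quaternion_on_center:
  assumes "centralizes x F" "x \<in> F"
  shows "x = \<one> \<or> x = a [^] (2 ^ (m - 1) :: nat)"
proof -
  note f = quaternion_on_facts
  interpret F: fin_group "G\<lparr>carrier := F\<rparr>" by (rule fin_group_subgroup[OF f(1)])
  have qp: "F.quaternion_pair a b m" using q quaternion_on_iff[OF f(1)] by simp
  have "x \<in> group_center (G\<lparr>carrier := F\<rparr>)"
    using assms f(11) by (auto simp: group_center_def centralizes_def subset_eq simp flip: conjugate_eq_self_iff)
  then show ?thesis using F.quaternion_center[OF qp] by (simp flip: nat_pow_consistent)
qed

text \<open>It lets the image of one generator under conjugation serve as the second
  generator.\<close>

lemma quaternion_on_switch:
  assumes x: "x \<in> F" "x \<notin> powers a" shows "quaternion_on F a x m"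
proof -
  note f = quaternion_on_facts
  have sA: "subgroup (powers a) G" using f(9) by simp
  obtain w where w: "w \<in> powers a" "x = w \<otimes> b" using x f(8) by blast
  have wc: "w \<in> carrier G" using w(1) powers_in_carrier f(9) by blast
  have "(\<lambda>x. x \<otimes> b) ` powers a = (\<lambda>y. y \<otimes> x) ` powers a"
  proof (intro subset_antisym image_subsetI)
    fix y assume y: "y \<in> powers a"
    then have yc: "y \<in> carrier G" using powers_in_carrier f(9) by blast
    have "y \<otimes> b = (y \<otimes> inv w) \<otimes> x" using yc wc f(10) w by (simp add: m_assoc)
    then show "y \<otimes> b \<in> (\<lambda>y. y \<otimes> x) ` powers a" using y w sA by (auto simp: subgroup.m_closed subgroup.m_inv_closed)
    have "y \<otimes> x = (y \<otimes> w) \<otimes> b" using yc wc f(10) w by (simp add: m_assoc)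
    then show "y \<otimes> x \<in> (\<lambda>x. x \<otimes> b) ` powers a" using y w sA by (auto simp: subgroup.m_closed)
  qed
  then show ?thesis using f x quaternion_on_outside[OF x] unfolding quaternion_on_def by metis
qed

lemma centralizes_quaternion_onI:
  assumes "x \<in> carrier G" "conjugate x a = a" "conjugate x b = b" shows "centralizes x F"
proof -
  note f = quaternion_on_facts
  have *: "conjugate x y = y" if "y \<in> powers a" for y
    using that assms f(9) by (auto simp: powers_def conjugate_pow)
  have "conjugate x (y \<otimes> b) = y \<otimes> b" if "y \<in> powers a" for y
    using *[OF that] assms f(9,10) powers_in_carrier[OF f(9) that] by (simp add: conjugate_mult)
  then show ?thesis using * f(8) assms(1) by (auto simp: centralizes_def)
qed

text \<open>\<open>x\<close> fixes \<open>a\<close>, since a cyclic 2-group has no nontrivial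
  automorphism of odd order, and it sends \<open>b\<close> to \<open>c b\<close> with
  \<open>c\<close> in \<open>powers a\<close>. Iteration gives \<open>c^k b\<close>, so an odd power
  of \<open>c\<close> is trivial, whereas \<open>c\<close> has 2-power order.\<close>

lemma odd_element_centralizes_quaternion:
  assumes x: "odd_element x" and norm: "\<And>y. y \<in> F \<Longrightarrow> conjugate x y \<in> F" and xa: "conjugate x a \<in> powers a"
  shows "centralizes x F"
proof -
  note f = quaternion_on_facts
  obtain n :: nat where n: "odd n" "x [^] n = \<one>" and xc: "x \<in> carrier G" using x by (auto simp: odd_element_def)
  have fa: "conjugate x a = a" using odd_element_normalizing_cyclic[OF f(9,5) x xa] .
  have fA: "conjugate x y = y" if "y \<in> powers a" for y
    using that fa xc f(9) by (auto simp: powers_def conjugate_pow)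
  have "conjugate x b \<notin> powers a"
  proof
    assume "conjugate x b \<in> powers a"
    then have "conjugate x (conjugate x b) = conjugate x b" using fA by blast
    then have "conjugate x b = b" using conjugate_eq_iff[of x "conjugate x b" b] xc f(10) by simp
    then show False using \<open>conjugate x b \<in> powers a\<close> f(6) by simp
  qed
  then obtain c where c: "c \<in> powers a" "conjugate x b = c \<otimes> b" using norm[OF f(3)] f(8) by blast
  have cc: "c \<in> carrier G" using c(1) powers_in_carrier f(9) by blast
  have "conjugate (x [^] k) b = c [^] k \<otimes> b" for k :: nat
  proof (induction k)
    case (Suc k)
    have "conjugate (x [^] Suc k) b = conjugate (x [^] k) (c \<otimes> b)" using f(10) xc by (simp add: conjugate_conjugate c(2))
    also have "\<dots> = conjugate (x [^] k) c \<otimes> (c [^] k \<otimes> b)" using f(10) xc cc by (simp add: conjugate_mult Suc)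
    also have "conjugate (x [^] k) c = c"
    proof -
      have "x \<otimes> c = c \<otimes> x" using fA[OF c(1)] xc cc by (simp add: conjugate_eq_self_iff)
      then show ?thesis using xc cc by (simp add: conjugate_eq_self_iff pow_commute)
    qed
    also have "c \<otimes> (c [^] k \<otimes> b) = c [^] Suc k \<otimes> b" 
    proof -
      have "c \<otimes> c [^] k = c [^] Suc k" using cc by (rule nat_pow_Suc2[symmetric])
      then show ?thesis using cc f(10) m_assoc[of c "c [^] k" b] by (simp only: nat_pow_closed)
    qed
    finally show ?case .
  qed (use f(10) in simp)
  from this[of n] have "c [^] n \<otimes> b = \<one> \<otimes> b" using n f(10) by simp
  then have "c [^] n = \<one>" using cc f(10) by (metis nat_pow_closed one_closed right_cancel)
  moreover have "c [^] (2 ^ m :: nat) = \<one>" using subgroup_pow_card[of "powers a" c] f(5,9) c(1) by (simp add: card_powers)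
  ultimately have "c = \<one>" using pow_eq_one_coprime[OF cc] n(1) by simp
  then show ?thesis using centralizes_quaternion_onI[OF xc fa] c(2) f(10) by simp
qed

end

text \<open>\<open>F\<close> is the intersection of the conjugates of a Sylow 2-subgroup
  \<open>P\<close>. A normal 2-subgroup lies in \<open>P\<close> along with all its conjugates,
  hence in \<open>F\<close>.\<close>

lemma exists_2_core:
  obtains F k where "F \<lhd> G" "card F = 2 ^ k" "\<And>M j. M \<lhd> G \<Longrightarrow> card M = 2 ^ j \<Longrightarrow> M \<subseteq> F"
proof -
  note p = two_is_prime_nat
  obtain P where P: "sylow_subgroup 2 P G" using sylow_exists[OF p] .
  have sP: "subgroup P G" and cP: "card P = 2 ^ multiplicity 2 (order G)" using P by (auto simp: sylow_subgroup_def)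
  have PG: "P \<subseteq> carrier G" using sP by (rule subgroup.subset)
  define F where "F = {x \<in> P. \<forall>g\<in>carrier G. conjugate g x \<in> P}"
  have FP: "F \<subseteq> P" by (auto simp: F_def)
  have sF: "subgroup F G"
  proof (rule finite_subgroupI)
    show "F \<subseteq> carrier G" using FP PG by blast
    show "\<one> \<in> F" using sP by (simp add: F_def subgroup.one_closed)
    show "x \<otimes> y \<in> F" if "x \<in> F" "y \<in> F" for x y
      using that sP PG by (auto simp: F_def conjugate_mult subgroup.m_closed subset_eq)
  qed
  have "F \<lhd> G"
  proof (rule normalI_conjugate[OF sF])
    fix g x assume g: "g \<in> carrier G" and x: "x \<in> F"
    have "conjugate h (conjugate g x) \<in> P" if "h \<in> carrier G" for h
    proof -
      have "conjugate (h \<otimes> g) x \<in> P" using x g that by (simp add: F_def)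
      then show ?thesis using conjugate_conjugate[OF that g, of x] x FP PG by auto
    qed
    then show "conjugate g x \<in> F" using x g by (simp add: F_def)
  qed
  moreover have "card F dvd 2 ^ multiplicity 2 (order G)" using card_subgroup_dvd_subgroup[OF sF sP FP] cP by simp
  then obtain k where "card F = 2 ^ k" using p by (meson divides_primepow_nat)
  moreover have "M \<subseteq> F" if M: "M \<lhd> G" "card M = 2 ^ j" for M j
    using normal_p_subgroup_subset_sylow[OF p P M] conjugate_normal[OF M(1)] by (auto simp: F_def)
  ultimately show ?thesis using that by blast
qed

lemma centralizer_normal:
  assumes F: "F \<lhd> G" shows "{x. centralizes x F} \<lhd> G"
proof -
  have FG: "F \<subseteq> carrier G" using normal_imp_subgroup[OF F] by (rule subgroup.subset)
  have "subgroup {x. centralizes x F} G"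
  proof (rule finite_subgroupI)
    show "x \<otimes> y \<in> {x. centralizes x F}" if "x \<in> {x. centralizes x F}" "y \<in> {x. centralizes x F}" for x y
      using that FG by (auto simp: centralizes_def conjugate_conjugate subset_eq)
  qed (use FG in \<open>auto simp: centralizes_def subset_eq\<close>)
  then show ?thesis
  proof (rule normalI_conjugate)
    fix g x assume g: "g \<in> carrier G" and "x \<in> {x. centralizes x F}"
    then have x: "x \<in> carrier G" "\<And>y. y \<in> F \<Longrightarrow> conjugate x y = y" by (auto simp: centralizes_def)
    have "conjugate (conjugate g x) y = y" if y: "y \<in> F" for y
    proof -
      have yc: "y \<in> carrier G" using y FG by blast
      have "conjugate (conjugate g x) y = conjugate g (conjugate x (conjugate (inv g) y))"
        using g x(1) yc by (simp add: conjugate_def[of g x] conjugate_conjugate)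
      also have "\<dots> = y" using x(2) conjugate_normal[OF F, of "inv g" y] g y yc by simp
      finally show ?thesis .
    qed
    then show "conjugate g x \<in> {x. centralizes x F}" using g x by (simp add: centralizes_def)
  qed
qed

end


context fin_group
begin

lemma exp_derived_normal: "H \<lhd> G \<Longrightarrow> (derived G ^^ n) H \<lhd> G"
  by (induction n) (auto intro: derived_is_normal)

lemma exp_derived_subset: "subgroup H G \<Longrightarrow> (derived G ^^ n) H \<subseteq> H"
proof (induction n)
  case (Suc n)
  then show ?case using derived_incl[of "(derived G ^^ n) H" H] by simp
qed simp

text \<open>If the centralizer of the 2-core were not inside it, take the last term \<open>B\<close> of its derived
  series outside \<open>F\<close>. Then \<open>[B, B] \<subseteq> F\<close> is central in \<open>B\<close>, so the elements of odd order of \<open>B\<close>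
  commute and form a normal subgroup.\<close>

lemma centralizer_2_core_subset:
  assumes solv: "solvable G" and no_odd: "\<And>N. N \<lhd> G \<Longrightarrow> odd (card N) \<Longrightarrow> N = {\<one>}"
    and F: "F \<lhd> G" "card F = 2 ^ k" and Fmax: "\<And>M j. M \<lhd> G \<Longrightarrow> card M = 2 ^ j \<Longrightarrow> M \<subseteq> F"
    and x: "centralizes x F"
  shows "x \<in> F"
proof (rule ccontr)
  assume xF: "x \<notin> F"
  have sF: "subgroup F G" using F(1) by (rule normal_imp_subgroup)
  define C where "C = {x. centralizes x F}"
  have nC: "C \<lhd> G" unfolding C_def by (rule centralizer_normal[OF F(1)])
  have sC: "subgroup C G" using nC by (rule normal_imp_subgroup)
  define D where "D n = (derived G ^^ n) C" for n
  obtain n where n: "(derived G ^^ n) (carrier G) = {\<one>}" using solv solvable_iff_trivial_derived_seq by blast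
  have "D n \<subseteq> F" using mono_exp_of_derived[OF subgroup.subset[OF sC], of n] n subgroup.one_closed[OF sF] by (auto simp: D_def)
  \<comment> \<open>The first index at which the derived series of \<open>C\<close> enters
    \<open>F\<close>; it is not 0 because \<open>x\<close> lies in \<open>C\<close> but not in
    \<open>F\<close>.\<close>
  define j where "j = (LEAST n. D n \<subseteq> F)"
  have j: "D j \<subseteq> F" unfolding j_def by (rule LeastI) fact
  have "j \<noteq> 0" using j x xF by (intro notI) (auto simp: D_def C_def)
  then obtain i where i: "j = Suc i" by (cases j) auto
  have notF: "\<not> D i \<subseteq> F" using not_less_Least[of i "\<lambda>n. D n \<subseteq> F"] i by (auto simp: j_def)
  define B where "B = D i"
  have nB: "B \<lhd> G" using exp_derived_normal[OF nC] by (simp add: B_def D_def)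
  have sB: "subgroup B G" using nB by (rule normal_imp_subgroup)
  have BC: "B \<subseteq> C" using exp_derived_subset[OF sC] by (simp add: B_def D_def)
  have BG: "B \<subseteq> carrier G" using sB by (rule subgroup.subset)
  have dB: "derived G B \<subseteq> F" using j i by (simp add: B_def D_def)
  have comm: "u \<otimes> v \<otimes> inv u \<otimes> inv v \<in> F" if "u \<in> B" "v \<in> B" for u v
    using dB that by (auto simp: derived_def intro!: generate.incl)
  have odd_commute: "u \<otimes> v = v \<otimes> u" if u: "u \<in> B" "odd_element u" and v: "v \<in> B" "odd_element v" for u v
  proof -
    have uv: "u \<in> carrier G" "v \<in> carrier G" using u v BG by auto
    obtain n :: nat where n: "odd n" "v [^] n = \<one>" using v(2) by (auto simp: odd_element_def)
    \<comment> \<open>\<open>c\<close> lies in \<open>F\<close> and so commutes with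
      \<open>v\<close>. Comparing \<open>n\<close>-th powers in \<open>u v u^-1 = c v\<close> gives
      \<open>c^n = 1\<close> with \<open>n\<close> odd, for an element of a 2-group.\<close>
    define c where "c = u \<otimes> v \<otimes> inv u \<otimes> inv v"
    have cF: "c \<in> F" using comm u v by (simp add: c_def)
    have cc: "c \<in> carrier G" using uv by (simp add: c_def)
    have uvc: "conjugate u v = c \<otimes> v" using uv by (simp add: c_def conjugate_def m_assoc)
    have "conjugate v c = c" using v BC cF by (auto simp: C_def centralizes_def)
    then have cv: "c \<otimes> v = v \<otimes> c" using uv cc by (simp add: conjugate_eq_self_iff)
    have "conjugate u v [^] n = \<one>" using n uv by (simp flip: conjugate_pow)
    then have "c [^] n = \<one>" using uvc n uv cc pow_mult_distrib[OF cv cc uv(2), of n] by simp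
    moreover have "c [^] (2 ^ k :: nat) = \<one>" using subgroup_pow_card[OF sF cF] F(2) by simp
    ultimately have "c = \<one>" using pow_eq_one_coprime[OF cc] n(1) by simp
    then show ?thesis using uvc uv by (simp add: conjugate_eq_self_iff)
  qed
  define M where "M = {u \<in> B. odd_element u}"
  have sM: "subgroup M G"
  proof (rule finite_subgroupI)
    show "M \<subseteq> carrier G" using BG by (auto simp: M_def)
    show "\<one> \<in> M" using subgroup.one_closed[OF sB] by (auto simp: M_def odd_element_def intro!: exI[of _ "1::nat"])
    fix u v assume u: "u \<in> M" and v: "v \<in> M"
    obtain n n' :: nat where n: "odd n" "u [^] n = \<one>" "odd n'" "v [^] n' = \<one>" and uv: "u \<in> carrier G" "v \<in> carrier G"
      using u v by (auto simp: M_def odd_element_def)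
    have "(u \<otimes> v) [^] (n * n') = u [^] (n * n') \<otimes> v [^] (n * n')"
      using uv u v odd_commute by (intro pow_mult_distrib) (auto simp: M_def)
    also have "u [^] (n * n') = \<one>" using n uv by (simp flip: nat_pow_pow)
    also have "v [^] (n * n') = \<one>" using n uv by (simp add: mult.commute[of n] flip: nat_pow_pow)
    finally have "odd_element (u \<otimes> v)" using n uv by (auto simp: odd_element_def intro!: exI[of _ "n * n'"])
    then show "u \<otimes> v \<in> M" using u v sB by (auto simp: M_def subgroup.m_closed)
  qed
  have "M \<lhd> G"
  proof (rule normalI_conjugate[OF sM])
    fix g u assume g: "g \<in> carrier G" and u: "u \<in> M"
    obtain n :: nat where n: "odd n" "u [^] n = \<one>" "u \<in> carrier G" using u by (auto simp: M_def odd_element_def)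
    have "conjugate g u [^] n = \<one>" using n g by (simp flip: conjugate_pow)
    then show "conjugate g u \<in> M" using u g n conjugate_normal[OF nB] by (auto simp: M_def odd_element_def)
  qed
  moreover have "odd (card M)"
  proof
    assume "even (card M)"
    then obtain u where u: "u \<in> M" "u [^] (2::nat) = \<one>" "u \<noteq> \<one>" using cauchy_subgroup[OF two_is_prime_nat sM] by metis
    then show False using odd_element_square_trivial[of u 1] by (simp add: M_def)
  qed
  \<comment> \<open>The identity is now the only element of odd order in \<open>B\<close>, so
    \<open>B\<close> is a normal 2-subgroup, contrary to the choice of \<open>i\<close>.\<close>
  ultimately have M1: "M = {\<one>}" using no_odd by blast
  have "\<exists>l. card B = 2 ^ l"
    by (rule odd_elements_trivial_imp_2_group[OF sB]) (use M1 in \<open>auto simp: M_def\<close>)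
  then show False using Fmax nB notF by (auto simp: B_def)
qed

text \<open>The 2-core is cyclic or generalized quaternion. Unless it is the quaternion group of order 8,
  elements of odd order centralize it.\<close>

lemma two_group_or_quaternion_8_core:
  assumes solv: "solvable G" and no_odd: "\<And>N. N \<lhd> G \<Longrightarrow> odd (card N) \<Longrightarrow> N = {\<one>}"
    and t: "unique_involution t" and not2: "\<not> (\<exists>k. order G = 2 ^ k)"
  obtains F a b where "F \<lhd> G" "quaternion_on F a b 2" "\<And>x. centralizes x F \<Longrightarrow> x \<in> F"
proof -
  obtain F k where F: "F \<lhd> G" "card F = 2 ^ k" and Fmax: "\<And>M j. M \<lhd> G \<Longrightarrow> card M = 2 ^ j \<Longrightarrow> M \<subseteq> F"
    using exists_2_core by metis
  have sF: "subgroup F G" using F(1) by (rule normal_imp_subgroup)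
  have FG: "F \<subseteq> carrier G" using sF by (rule subgroup.subset)
  have CF: "x \<in> F" if "centralizes x F" for x
    by (rule centralizer_2_core_subset[of F k]) (fact solv F that | erule (1) no_odd | erule (1) Fmax)+
  \<comment> \<open>Odd elements centralizing \<open>F\<close> lie in \<open>F\<close> and are
    trivial, so \<open>G\<close> would be a 2-group. The cyclic case and the quaternion cases with
    \<open>m > 2\<close> are both refuted this way.\<close>
  have *: False if "\<And>x. odd_element x \<Longrightarrow> centralizes x F"
  proof -
    have "x = \<one>" if "x \<in> carrier G" "odd_element x" for x
      using odd_element_p_subgroup_trivial[OF that(2) _ sF F(2)] CF \<open>\<And>x. odd_element x \<Longrightarrow> centralizes x F\<close> that by blast
    then show False using odd_elements_trivial_imp_2_group[OF subgroup_self] not2 by (auto simp: order_def)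
  qed
  interpret F: fin_group "G\<lparr>carrier := F\<rparr>" by (rule fin_group_subgroup[OF sF])
  have "F \<noteq> {\<one>}"
  proof
    assume F1: "F = {\<one>}"
    have "centralizes x F" if "odd_element x" for x using that F1 by (auto simp: centralizes_def odd_element_def)
    then show False using * by blast
  qed
  then have "card F \<noteq> 1" using subgroup.one_closed[OF sF] by (auto simp: card_1_singleton_iff)
  then have "2 dvd card F" using F(2) by (cases k) auto
  then obtain u where u: "u \<in> F" "u [^] (2::nat) = \<one>" "u \<noteq> \<one>" using cauchy_subgroup[OF two_is_prime_nat sF] by metis
  have uc: "u \<in> carrier G" using u(1) FG by blast
  have "u \<otimes> u = \<one>" using u(2) pow_sq[OF uc] by simp
  then have "u = t" using t uc u(3) unfolding unique_involution_def by blast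
  then have tF: "t \<in> F" using u(1) by simp
  have "F.unique_involution t" using t tF FG by (simp add: unique_involution_def F.unique_involution_def subset_eq)
  then have "F.unique_prime_subgroup 2 t" using F.unique_prime_subgroup_2_iff by blast
  moreover have "order (G\<lparr>carrier := F\<rparr>) = 2 ^ k" using F(2) by (simp add: order_def)
  ultimately have "(\<exists>a\<in>F. F = powers a) \<or> (\<exists>a b m. quaternion_on F a b m)"
    using F.unique_prime_subgroup_classification[OF two_is_prime_nat] quaternion_on_iff[OF sF] powers_consistent[OF sF]
    by simp
  then consider (cyc) a where "a \<in> F" "F = powers a" | (quat) a b m where "quaternion_on F a b m" by blast
  then show ?thesis
  proof cases
    case cyc
    have ac: "a \<in> carrier G" using cyc FG by blast
    have oa: "ord a = 2 ^ k" using F(2) cyc card_powers[OF ac] by simp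
    have "centralizes x F" if x: "odd_element x" for x
    proof -
      have xc: "x \<in> carrier G" using x by (simp add: odd_element_def)
      have "conjugate x a \<in> powers a" using conjugate_normal[OF F(1) xc cyc(1)] cyc(2) by simp
      then have "conjugate x a = a" using odd_element_normalizing_cyclic[OF ac oa x] by blast
      then have "conjugate x y = y" if "y \<in> powers a" for y
        using that xc ac by (auto simp: powers_def conjugate_pow)
      then show ?thesis using cyc(2) xc by (auto simp: centralizes_def)
    qed
    then show ?thesis using * by blast
  next
    case quat
    note f = quaternion_on_facts[OF quat]
    have norm: "conjugate x y \<in> F" if "odd_element x" "y \<in> F" for x y
      using that conjugate_normal[OF F(1)] by (simp add: odd_element_def)
    have "m = 2"
    proof (rule ccontr)
      assume "m \<noteq> 2"
      then have m3: "m \<ge> 3" using f(4) by simp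
      have "centralizes x F" if x: "odd_element x" for x
      proof (rule odd_element_centralizes_quaternion[OF quat x norm[OF x]])
        have xc: "x \<in> carrier G" using x by (simp add: odd_element_def)
        show "conjugate x a \<in> powers a"
        proof (rule ccontr)
          \<comment> \<open>Elements of \<open>F\<close> outside \<open>powers a\<close> have
            trivial fourth power, so \<open>a\<close> can be moved out of \<open>powers a\<close>
            only if its order is at most 4.\<close>
          assume na: "conjugate x a \<notin> powers a"
          define s where "s = a [^] (2 ^ (m - 1) :: nat)"
          have sc: "s \<in> carrier G" using f(9) by (simp add: s_def)
          have "conjugate x a \<otimes> conjugate x a = s"
            using quaternion_on_outside(1)[OF quat norm[OF x f(2)] na] by (simp add: s_def)
          then have "conjugate x (a \<otimes> a) = s" using xc f(9) by (simp add: conjugate_mult)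
          then have "conjugate x ((a \<otimes> a) \<otimes> (a \<otimes> a)) = s \<otimes> s" using xc f(9) by (simp add: conjugate_mult)
          also have "s \<otimes> s = \<one>"
          proof -
            have "2 ^ (m - 1) + 2 ^ (m - 1) = (2 ^ m :: nat)" using f(4) by (cases m) auto
            then show ?thesis using f(5,9) by (simp add: s_def nat_pow_mult pow_eq_id)
          qed
          finally have "(a \<otimes> a) \<otimes> (a \<otimes> a) = \<one>" using xc f(9) conjugate_eq_iff[of x "(a \<otimes> a) \<otimes> (a \<otimes> a)" \<one>] by simp
          then have "a [^] (4::nat) = \<one>" using f(9) by (simp add: numeral_eq_Suc m_assoc)
          then have "2 ^ m dvd (2 ^ 2 :: nat)" using f(5,9) by (simp add: pow_eq_id)
          then have "m \<le> 2" by (rule power_dvd_imp_le) simp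
          then show False using m3 by simp
        qed
      qed
      then show False using * by blast
    qed
    then show ?thesis using that F(1) quat CF by blast
  qed
qed

end


section \<open>A quaternion 2-core of order 8\<close>

context fin_group
begin

section \<open>Counting the images of a generating pair\<close>

context
  fixes F t
  assumes t: "unique_involution t" and F: "F \<lhd> G" and CF: "\<forall>x. centralizes x F \<longrightarrow> x \<in> F"
begin

lemma core_involution_facts: "t \<in> carrier G" "t \<noteq> \<one>" "t \<otimes> t = \<one>" "\<And>x. x \<in> carrier G \<Longrightarrow> x \<otimes> x = \<one> \<Longrightarrow> x = \<one> \<or> x = t"
  "\<And>x. x \<in> carrier G \<Longrightarrow> x \<otimes> t = t \<otimes> x" "\<And>x. x \<in> carrier G \<Longrightarrow> conjugate x t = t"
proof -
  show "t \<in> carrier G" "t \<noteq> \<one>" "t \<otimes> t = \<one>" "\<And>x. x \<in> carrier G \<Longrightarrow> x \<otimes> x = \<one> \<Longrightarrow> x = \<one> \<or> x = t"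
    using t by (auto simp: unique_involution_def)
  have "t \<in> group_center G" using unique_involution_central[OF t] .
  then show *: "x \<otimes> t = t \<otimes> x" if "x \<in> carrier G" for x using that by (auto simp: group_center_def)
  show "conjugate x t = t" if "x \<in> carrier G" for x
    using *[OF that] that \<open>t \<in> carrier G\<close> by (simp add: conjugate_eq_self_iff)
qed

context
  fixes i j
  assumes q: "quaternion_on F i j 2"
begin

lemmas q8_facts = quaternion_on_facts[OF q]

lemma q8_squares: "i \<otimes> i = t" "j \<otimes> j = t"
proof -
  note f = q8_facts
  have o: "ord i = 4" using f(5) by simp
  have "i [^] (4::nat) = \<one>" "i [^] (2::nat) \<noteq> \<one>" using f(9) o by (simp_all add: pow_eq_id)
  then have "(i \<otimes> i) \<otimes> (i \<otimes> i) = \<one>" "i \<otimes> i \<noteq> \<one>" using f(9) by (simp_all add: numeral_eq_Suc m_assoc)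
  then show ii: "i \<otimes> i = t" using core_involution_facts(4)[of "i \<otimes> i"] f(9) by simp
  show "j \<otimes> j = t" using quaternion_on_outside(1)[OF q f(3,6)] ii f(9) by (simp add: pow_sq)
qed

lemma q8_inv: "inv i = t \<otimes> i" "inv j = t \<otimes> j"
  using q8_squares q8_facts(9,10) core_involution_facts(1,3) by (simp_all add: inv_equality m_assoc)

lemma q8_ji: "j \<otimes> i = t \<otimes> i \<otimes> j"
proof -
  have "conjugate j i \<otimes> j = j \<otimes> i" using q8_facts(9,10) by (simp add: conjugate_def m_assoc)
  then show ?thesis using q8_facts(7) q8_inv(1) by simp
qed

lemma q8_powers: "powers i = {\<one>, i, t, t \<otimes> i}"
proof -
  have o: "ord i = 4" using q8_facts(5) by simp
  have 3: "i [^] (3::nat) = t \<otimes> i" using q8_squares q8_facts(9) by (simp add: numeral_eq_Suc)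
  have sub: "i [^] k \<in> {\<one>, i, t, t \<otimes> i}" for k :: nat
  proof -
    have "i [^] k = i [^] (k mod 4)" using pow_eq_pow_iff[OF q8_facts(9)] o by (simp add: cong_def)
    moreover have "k mod 4 = 0 \<or> k mod 4 = 1 \<or> k mod 4 = 2 \<or> k mod 4 = 3" by presburger
    ultimately show ?thesis using 3 q8_squares q8_facts(9) pow_sq[of i] by auto
  qed
  have "t = i [^] (2::nat)" using q8_squares q8_facts(9) pow_sq by simp
  then have "t \<in> powers i" "t \<otimes> i \<in> powers i" using 3 pow_in_powers[of i 2] pow_in_powers[of i 3] by simp_all
  then have "{\<one>, i, t, t \<otimes> i} \<subseteq> powers i" using q8_facts(9) by simp
  moreover have "powers i \<subseteq> {\<one>, i, t, t \<otimes> i}" unfolding powers_def using sub by blast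
  ultimately show ?thesis by blast
qed

lemma q8_elements: "F = {\<one>, i, t, t \<otimes> i, j, i \<otimes> j, t \<otimes> j, t \<otimes> i \<otimes> j}"
  using q8_facts(8,10) by (auto simp: q8_powers)

lemma q8_order_4: assumes x: "x \<in> F" "x \<noteq> \<one>" "x \<noteq> t" shows "x \<otimes> x = t" "ord x = 4"
proof -
  note f = q8_facts
  have xc: "x \<in> carrier G" using x f by blast
  show xx: "x \<otimes> x = t"
  proof (cases "x \<in> powers i")
    case True
    then have "x = i \<or> x = t \<otimes> i" using x by (simp add: q8_powers)
    moreover have "(t \<otimes> i) \<otimes> (t \<otimes> i) = t \<otimes> (i \<otimes> t) \<otimes> i" using f(9) core_involution_facts(1) by (simp add: m_assoc)
    moreover have "\<dots> = t" using f(9) core_involution_facts(1,3) core_involution_facts(5)[of i] q8_squares by (simp add: m_assoc)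
    ultimately show ?thesis using q8_squares by auto
  next
    case False
    then show ?thesis using quaternion_on_outside(1)[OF q x(1)] q8_squares f(9) by (simp add: pow_sq)
  qed
  have "x [^] (4::nat) = (x \<otimes> x) \<otimes> (x \<otimes> x)" using xc by (simp add: numeral_eq_Suc m_assoc)
  then have 4: "ord x dvd 2 ^ 2" using xx core_involution_facts(3) xc by (simp add: pow_eq_id)
  then obtain k where k: "k \<le> 2" "ord x = 2 ^ k" using divides_primepow_nat[OF two_is_prime_nat] by blast
  have "\<not> ord x dvd 2" using xx xc core_involution_facts(2) pow_sq[of x] by (simp flip: pow_eq_id)
  then have "k \<noteq> 0" "k \<noteq> 1" using k(2) by (intro notI; simp)+
  then show "ord x = 4" using k by (cases "k = 2") auto
qed

text \<open>The conjugation action on these pairs has the cosets of \<open>{1, t}\<close> as fibres of its orbit maps,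
  which bounds the order of \<open>G\<close> by 48.\<close>

definition pair_image :: "'a \<Rightarrow> 'a \<times> 'a" where
  "pair_image g = (conjugate g i, conjugate g j)"

definition noncommuting_pairs :: "('a \<times> 'a) set" where
  "noncommuting_pairs = Sigma (F - {\<one>, t}) (\<lambda>x. F - powers x)"

text \<open>The first entry is one of six elements of order 4, the second one of the four elements
  outside its cyclic group.\<close>

lemma card_noncommuting_pairs: "card noncommuting_pairs = 24" "finite noncommuting_pairs"
proof -
  note f = q8_facts
  have cF: "card F = 8" using quaternion_on_card[OF q] by simp
  have fF: "finite F" using f(1) by simp
  have tF: "t \<in> F" using q8_elements by blast
  have "card (F - powers x) = 4" if "x \<in> F - {\<one>, t}" for x
  proof -
    have x: "x \<in> F" "x \<in> carrier G" "ord x = 4" using that q8_order_4 f(11) by auto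
    have "powers x \<subseteq> F" using powers_subset[OF f(1)] x by blast
    then show ?thesis using card_Diff_subset[of "powers x" F] fF finite_subset x cF by (simp add: card_powers)
  qed
  moreover have "card (F - {\<one>, t}) = 6"
    using card_Diff_subset[of "{\<one>, t}" F] core_involution_facts(2) tF subgroup.one_closed[OF f(1)] cF by simp
  ultimately show "card noncommuting_pairs = 24"
    unfolding noncommuting_pairs_def using fF by (subst card_SigmaI) auto
  show "finite noncommuting_pairs" unfolding noncommuting_pairs_def using fF by auto
qed

lemma pair_image_in: "g \<in> carrier G \<Longrightarrow> pair_image g \<in> noncommuting_pairs"
proof -
  note f = q8_facts
  assume g: "g \<in> carrier G"
  have "i \<noteq> \<one>" "i \<noteq> t" using q8_squares core_involution_facts(2,3) f(9) by auto
  then have "conjugate g i \<noteq> \<one>" "conjugate g i \<noteq> t"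
    using conjugate_eq_iff[OF g f(9) one_closed] conjugate_eq_iff[OF g f(9) core_involution_facts(1)] core_involution_facts(6)[OF g] g by auto
  moreover have "conjugate g j \<notin> powers (conjugate g i)"
  proof
    assume "conjugate g j \<in> powers (conjugate g i)"
    then obtain k :: nat where "conjugate g j = conjugate g (i [^] k)" using g f(9) by (auto simp: powers_def conjugate_pow)
    then have "j = i [^] k" using conjugate_eq_iff[OF g] f(9,10) by simp
    then show False using f(6) by simp
  qed
  ultimately show ?thesis using conjugate_normal[OF F g] f(2,3) by (simp add: pair_image_def noncommuting_pairs_def)
qed

text \<open>Two elements with the same image differ by one fixing \<open>i\<close> and
  \<open>j\<close>. Such an element centralizes \<open>F\<close>, hence lies in \<open>F\<close> and
  in its center \<open>{1, t}\<close>.\<close>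

lemma pair_image_fiber:
  assumes g: "g \<in> carrier G" shows "{x \<in> carrier G. pair_image x = pair_image g} = {g, g \<otimes> t}"
proof (intro subset_antisym subsetI)
  note f = q8_facts
  fix x assume "x \<in> {x \<in> carrier G. pair_image x = pair_image g}"
  then have x: "x \<in> carrier G" "conjugate x i = conjugate g i" "conjugate x j = conjugate g j" by (auto simp: pair_image_def)
  let ?u = "inv g \<otimes> x"
  have uc: "?u \<in> carrier G" using x g by simp
  have "conjugate ?u i = i" "conjugate ?u j = j" using x g f(9,10) by (simp_all add: conjugate_conjugate)
  then have u: "centralizes ?u F" using centralizes_quaternion_onI[OF q uc] by simp
  have "?u = \<one> \<or> ?u = i [^] (2 ^ (2 - 1) :: nat)" by (rule quaternion_on_center[OF q u CF[rule_format, OF u]])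
  then have "?u = \<one> \<or> ?u = t" using q8_squares f(9) by (simp add: pow_sq)
  then have "g \<otimes> ?u = g \<or> g \<otimes> ?u = g \<otimes> t" using g by auto
  then show "x \<in> {g, g \<otimes> t}" using x g by simp
next
  note f = q8_facts
  fix x assume "x \<in> {g, g \<otimes> t}"
  moreover have "conjugate t i = i" "conjugate t j = j"
    using core_involution_facts(5)[OF f(9)] core_involution_facts(5)[OF f(10)] core_involution_facts(1) f(9,10) by (simp_all add: conjugate_eq_self_iff)
  ultimately show "x \<in> {x \<in> carrier G. pair_image x = pair_image g}"
    using g core_involution_facts(1) f(9,10) by (auto simp: pair_image_def conjugate_conjugate)
qed

lemma order_eq_pair_image: "order G = 2 * card (pair_image ` carrier G)"
proof -
  have "(\<Sum>y\<in>pair_image ` carrier G. \<Sum>x\<in>{x \<in> carrier G. pair_image x = y}. 1) = (\<Sum>x\<in>carrier G. (1::nat))"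
    by (rule sum.group) auto
  moreover have "(\<Sum>x\<in>{x \<in> carrier G. pair_image x = y}. (1::nat)) = 2" if "y \<in> pair_image ` carrier G" for y
  proof -
    obtain g where g: "g \<in> carrier G" "y = pair_image g" using \<open>y \<in> pair_image ` carrier G\<close> by blast
    have "g \<noteq> g \<otimes> t" using g core_involution_facts(1,2) by (metis r_one one_closed l_cancel)
    then show ?thesis using pair_image_fiber[OF g(1)] g(2) by simp
  qed
  ultimately show ?thesis by (simp add: order_def)
qed

lemma order_le_48: "order G \<le> 48"
proof -
  have "card (pair_image ` carrier G) \<le> 24"
    using card_mono[OF card_noncommuting_pairs(2)] pair_image_in card_noncommuting_pairs(1) by (metis image_subsetI)
  then show ?thesis using order_eq_pair_image by simp
qed

text \<open>With 48 elements and fibres of size 2, all 24 pairs are attained.\<close>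

lemma order_48_transitive:
  assumes "order G = 48" "(x, y) \<in> noncommuting_pairs"
  obtains d where "d \<in> carrier G" "conjugate d i = x" "conjugate d j = y"
proof -
  have "card (pair_image ` carrier G) = card noncommuting_pairs"
    using assms(1) order_eq_pair_image card_noncommuting_pairs(1) by simp
  then have "pair_image ` carrier G = noncommuting_pairs"
    using card_subset_eq[OF card_noncommuting_pairs(2), of "pair_image ` carrier G"] pair_image_in by blast
  then have "(x, y) \<in> pair_image ` carrier G" using assms(2) by simp
  then obtain d where "d \<in> carrier G" "pair_image d = (x, y)" by (elim imageE) simp
  then show ?thesis using that by (simp add: pair_image_def)
qed

end

end

end


section \<open>Odd elements and an inverting element acting on the quaternion group\<close>

context fin_group
begin

lemma powers_inv: "a \<in> carrier G \<Longrightarrow> powers (inv a) = powers a"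
proof -
  have *: "powers (inv a) \<subseteq> powers a" if "a \<in> carrier G" for a
    using powers_subset[OF powers_subgroup[OF that] subgroup.m_inv_closed[OF powers_subgroup[OF that] powers_self[OF that]]] .
  show "a \<in> carrier G \<Longrightarrow> powers (inv a) = powers a" using *[of a] *[of "inv a"] by auto
qed

context
  fixes F t
  assumes t: "unique_involution t" and F: "F \<lhd> G" and CF: "\<forall>x. centralizes x F \<longrightarrow> x \<in> F"
begin

lemmas involution_facts = core_involution_facts[OF t F CF]
lemmas q8_rules = q8_squares[OF t F CF] q8_inv[OF t F CF] q8_ji[OF t F CF]

text \<open>Conjugation with \<open>i -> j -> i j\<close> sends \<open>i j\<close> to
  \<open>j (i j)\<close>; the identity closes the cycle.\<close>

lemma q8_jij:
  assumes q: "quaternion_on F i j 2" shows "j \<otimes> (i \<otimes> j) = i"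
proof -
  note f = quaternion_on_facts[OF q]
  have "j \<otimes> (i \<otimes> j) = (t \<otimes> i \<otimes> j) \<otimes> j" using q8_rules(5)[OF q] f(9,10) by (simp flip: m_assoc)
  also have "\<dots> = t \<otimes> (i \<otimes> t)" using q8_rules(2)[OF q] f(9,10) involution_facts(1) by (simp add: m_assoc)
  also have "\<dots> = i" using involution_facts(1,3) involution_facts(5)[OF f(9)] f(9) by (simp flip: m_assoc)
  finally show ?thesis .
qed

text \<open>Inverting both generators absorbs a sign: \<open>c j c^-1 = t a j\<close> takes the
  standard form for the inverse pair.\<close>

lemma q8_inv_pair:
  assumes q: "quaternion_on F i j 2" shows "quaternion_on F (inv i) (inv j) 2"
proof -
  note f = quaternion_on_facts[OF q]
  have 1: "inv i [^] (2::nat) = i [^] (2::nat)"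
  proof -
    have "inv i [^] (2::nat) = inv (i [^] (2::nat))" using f(9) by (rule nat_pow_inv)
    also have "\<dots> = i [^] (2::nat)" using q8_rules(1)[OF q] f(9) involution_facts(1,3) by (simp add: pow_sq inv_equality)
    finally show ?thesis .
  qed
  have "conjugate j (inv i) = inv (inv i)" using f(7,9,10) by (simp add: conjugate_inv)
  moreover have "j \<otimes> j = inv i [^] (2 ^ (2 - 1) :: nat)" using q8_rules(1,2)[OF q] 1 f(9) by (simp add: pow_sq)
  ultimately have "quaternion_on F (inv i) j 2"
    using f(1,3,4,5,6,8) subgroup.m_inv_closed[OF f(1,2)]
    unfolding quaternion_on_def powers_inv[OF f(9)] ord_inv[OF f(9)] by blast
  moreover have "inv j \<notin> powers (inv i)"
  proof
    assume "inv j \<in> powers (inv i)"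
    then have "inv (inv j) \<in> powers i"
      using powers_inv[OF f(9)] subgroup.m_inv_closed[OF powers_subgroup[OF f(9)]] by simp
    then show False using f(6,10) by simp
  qed
  ultimately show ?thesis using quaternion_on_switch subgroup.m_inv_closed[OF f(1,3)] by blast
qed

lemma odd_element_normalizing_axis_trivial:
  assumes q: "quaternion_on F i j 2" and x: "odd_element x" and xi: "conjugate x i \<in> powers i"
  shows "x = \<one>"
proof -
  note f = quaternion_on_facts[OF q]
  have "centralizes x F"
    by (rule odd_element_centralizes_quaternion[OF q x _ xi])
       (use x conjugate_normal[OF F] in \<open>auto simp: odd_element_def\<close>)
  then have "x \<in> F" using CF by blast
  then show ?thesis using odd_element_p_subgroup_trivial[OF x _ f(1)] quaternion_on_card[OF q] by blast
qed

text \<open>Neither \<open>c\<close> nor \<open>c^2\<close> normalizes \<open>powers a\<close>, so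
  \<open>j = c a c^-1\<close> and \<open>c j c^-1\<close> lie outside it, and the latter is
  \<open>j\<close> or \<open>a j\<close> up to a factor \<open>t\<close>. The first option
  contradicts injectivity of conjugation, and the factor \<open>t\<close> is removed by inverting
  the generators. Finally \<open>c^3\<close> fixes \<open>i\<close> and is therefore
  trivial.\<close>

lemma odd_element_quaternion_8_action:
  assumes q: "quaternion_on F a b 2" and c: "odd_element c" "c \<noteq> \<one>"
  obtains i j where "quaternion_on F i j 2" "c [^] (3::nat) = \<one>" "conjugate c i = j" "conjugate c j = i \<otimes> j"
proof -
  note f = quaternion_on_facts[OF q]
  have cc: "c \<in> carrier G" using c(1) by (simp add: odd_element_def)
  have norm: "conjugate c y \<in> F" if "y \<in> F" for y using conjugate_normal[OF F cc that] .
  note result = that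
  have *: thesis if q: "quaternion_on F i j 2" and ij: "conjugate c i = j" "conjugate c j = i \<otimes> j" for i j
  proof -
    note f = quaternion_on_facts[OF q]
    have "conjugate c (i \<otimes> j) = i" using ij cc f(9,10) q8_jij[OF q] by (simp add: conjugate_mult)
    then have "conjugate (c \<otimes> c \<otimes> c) i = i" using ij cc f(9,10) by (simp add: conjugate_conjugate)
    moreover have "c \<otimes> c \<otimes> c = c [^] (3::nat)" using cc by (simp add: numeral_eq_Suc)
    ultimately have "c [^] (3::nat) = \<one>"
      using odd_element_normalizing_axis_trivial[OF q odd_element_pow[OF c(1), of 3]] powers_self[OF f(9)] by simp
    then show thesis using result[OF q _ ij] by blast
  qed
  define j where "j = conjugate c a"
  have jF: "j \<in> F" using norm[OF f(2)] by (simp add: j_def)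
  have ja: "j \<notin> powers a" using odd_element_normalizing_axis_trivial[OF q c(1)] c(2) by (auto simp: j_def)
  have q1: "quaternion_on F a j 2" using quaternion_on_switch[OF q jF ja] .
  note f1 = quaternion_on_facts[OF q1]
  define k where "k = conjugate c j"
  have kF: "k \<in> F" using norm[OF jF] by (simp add: k_def)
  have "k \<notin> powers a"
  proof
    assume "k \<in> powers a"
    then have "conjugate (c [^] (2::nat)) a \<in> powers a" using cc f(9) by (simp add: k_def j_def pow_sq conjugate_conjugate)
    then have "c [^] (2::nat) = \<one>" using odd_element_normalizing_axis_trivial[OF q odd_element_pow[OF c(1)]] by blast
    then show False using odd_element_square_trivial[OF c(1), of 1] c(2) by simp
  qed
  then have "k \<in> {j, a \<otimes> j, t \<otimes> j, t \<otimes> a \<otimes> j}"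
    using kF q8_elements[OF t F CF q1] q8_powers[OF t F CF q1] by auto
  moreover have "k \<noteq> j"
  proof
    assume "k = j"
    then have "j = a" using conjugate_eq_iff[OF cc f1(10) f1(9)] by (simp add: k_def j_def)
    then show False using ja f(9) by simp
  qed
  moreover have "k \<noteq> t \<otimes> j"
  proof
    assume "k = t \<otimes> j"
    then have "conjugate c j = conjugate c (t \<otimes> a)" using cc involution_facts(1,6) f(9) by (simp add: k_def conjugate_mult flip: j_def)
    then have "j = t \<otimes> a" using conjugate_eq_iff[OF cc f1(10), of "t \<otimes> a"] involution_facts(1) f(9) by simp
    then show False using ja q8_powers[OF t F CF q1] by simp
  qed
  ultimately consider "k = a \<otimes> j" | "k = t \<otimes> a \<otimes> j" by blast
  then show thesis
  proof cases
    case 1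
    then show thesis using *[OF q1] by (simp add: k_def flip: j_def)
  next
    case 2
    have "conjugate c (inv a) = inv j" using cc f(9) by (simp add: conjugate_inv j_def)
    moreover have "conjugate c (inv j) = inv a \<otimes> inv j"
    proof -
      have "conjugate c (inv j) = inv (j \<otimes> a)" using cc f1(10) 2 q8_rules(5)[OF q1] by (simp add: conjugate_inv k_def)
      then show ?thesis using f1(9,10) by (simp add: inv_mult_group)
    qed
    ultimately show thesis using *[OF q8_inv_pair[OF q1]] by simp
  qed
qed

text \<open>In order 48 every noncommuting pair is an image of \<open>(i, j)\<close>. The pair
  \<open>(j^-1, i^-1)\<close> is chosen because the corresponding automorphism reverses the cycle
  \<open>i -> j -> i j\<close>.\<close>

lemma order_48_inverting_element:
  assumes ord: "order G = 48" and q: "quaternion_on F i j 2"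
    and c: "c \<in> carrier G" "c [^] (3::nat) = \<one>" "conjugate c i = j" "conjugate c j = i \<otimes> j"
  obtains d where "d \<in> carrier G" "conjugate d i = inv j" "conjugate d j = inv i" "conjugate d c = inv c"
proof -
  note f = quaternion_on_facts[OF q]
  have "i \<notin> powers j"
  proof
    assume "i \<in> powers j"
    then have "i \<otimes> j = j \<otimes> i" using powers_commute f(10) by blast
    then have "\<one> \<otimes> (i \<otimes> j) = t \<otimes> (i \<otimes> j)" using q8_rules(5)[OF q] f(9,10) involution_facts(1) by (simp add: m_assoc)
    then have "\<one> = t" using f(9,10) involution_facts(1) right_cancel[of "i \<otimes> j" \<one> t] by simp
    then show False using involution_facts(2) by simp
  qed
  then have "inv i \<notin> powers (inv j)"
    using powers_inv[OF f(10)] subgroup.m_inv_closed[OF powers_subgroup[OF f(10)], of "inv i"] f(9) by auto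
  moreover have "inv j \<noteq> \<one>" "inv j \<noteq> t"
  proof -
    have "j \<noteq> \<one>" "j \<noteq> t" using q8_rules(2)[OF q] involution_facts(1,2,3) by auto
    then show "inv j \<noteq> \<one>" "inv j \<noteq> t" using f(10) involution_facts(1,3) inv_equality[of t t] by (metis inv_inv inv_one)+
  qed
  ultimately have "(inv j, inv i) \<in> noncommuting_pairs F t"
    using subgroup.m_inv_closed[OF f(1)] f(2,3) by (simp add: noncommuting_pairs_def[OF t F CF q])
  then obtain d where d: "d \<in> carrier G" "conjugate d i = inv j" "conjugate d j = inv i"
    using order_48_transitive[OF t F CF q ord] by blast
  \<comment> \<open>\<open>e\<close> acts on \<open>i\<close> and \<open>j\<close> like the inverse
    of \<open>c\<close>, so \<open>c e\<close> centralizes \<open>F\<close> and is 1 or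
    \<open>t\<close>.\<close>
  define e where "e = conjugate d c"
  have ec: "e \<in> carrier G" using d c by (simp add: e_def)
  have ce: "conjugate e x = conjugate d (conjugate c (conjugate (inv d) x))" if "x \<in> carrier G" for x
    using that d(1) c(1) by (simp add: e_def conjugate_def[of d c] conjugate_conjugate)
  have "conjugate d (inv j) = i" "conjugate d (inv i) = j" using d f(9,10) by (simp_all add: conjugate_inv)
  then have "conjugate (inv d) i = inv j" "conjugate (inv d) j = inv i"
    using conjugate_cancel(2)[of d "inv j"] conjugate_cancel(2)[of d "inv i"] d(1) f(9,10) by (simp_all only: inv_closed)
  then have "conjugate e i = i \<otimes> j" "conjugate e j = i"
    using ce[OF f(9)] ce[OF f(10)] c d f(9,10) by (simp_all add: conjugate_inv conjugate_mult inv_mult_group)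
  then have "conjugate (c \<otimes> e) i = i" "conjugate (c \<otimes> e) j = j"
    using c ec f(9,10) q8_jij[OF q] by (simp_all add: conjugate_conjugate conjugate_mult)
  then have u: "centralizes (c \<otimes> e) F" using centralizes_quaternion_onI[OF q] c(1) ec by simp
  then have "c \<otimes> e = \<one> \<or> c \<otimes> e = i [^] (2 ^ (2 - 1) :: nat)" using quaternion_on_center[OF q u] CF by blast
  then have cet: "c \<otimes> e = \<one> \<or> c \<otimes> e = t" using q8_rules(1)[OF q] f(9) by (simp add: pow_sq)
  \<comment> \<open>The value \<open>t\<close> would give \<open>e^3 = t\<close>, but
    \<open>e\<close> is a conjugate of \<open>c\<close> and has trivial cube.\<close>
  have "c \<otimes> e \<noteq> t"
  proof
    assume "c \<otimes> e = t"
    then have "inv c \<otimes> (c \<otimes> e) = inv c \<otimes> t" by simp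
    then have et: "e = inv c \<otimes> t" using c(1) ec by simp
    have "e [^] (3::nat) = inv c [^] (3::nat) \<otimes> t [^] (3::nat)"
      unfolding et using c(1) involution_facts(1) involution_facts(5)[of "inv c"] by (intro pow_mult_distrib) auto
    also have "inv c [^] (3::nat) = \<one>" using c(1,2) by (simp add: nat_pow_inv)
    also have "t [^] (3::nat) = t" using involution_facts(1,3) by (simp add: numeral_eq_Suc)
    finally have "e [^] (3::nat) = t" using involution_facts(1) by simp
    moreover have "e [^] (3::nat) = \<one>" using c d(1) by (simp add: e_def flip: conjugate_pow)
    ultimately show False using involution_facts(2) by simp
  qed
  then have "c \<otimes> e = \<one>" using cet by blast
  then have "e = inv c" using c(1) ec by (metis inv_equality inv_inv inv_closed m_closed l_inv r_inv inv_comm)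
  then show ?thesis using that d by (simp add: e_def)
qed

end

text \<open>All nontrivial odd \<open>c\<close> are covered because the argument about 3 dividing
  \<open>|K(G)|\<close> applies this to the image of a generator of a Sylow 3-subgroup. The order is
  a multiple of 8 and of 3, and at most 48.\<close>

theorem quaternion_8_core_structure:
  assumes solv: "solvable G" and no_odd: "\<And>N. N \<lhd> G \<Longrightarrow> odd (card N) \<Longrightarrow> N = {\<one>}"
    and t: "unique_involution t" and not2: "\<not> (\<exists>k. order G = 2 ^ k)"
  obtains F where "F \<lhd> G" "order G = 24 \<or> order G = 48" "\<exists>c. odd_element c \<and> c \<noteq> \<one>"
    "\<forall>c. odd_element c \<and> c \<noteq> \<one> \<longrightarrow> (\<exists>i j. quaternion_on F i j 2 \<and> i \<otimes> i = t \<and> j \<otimes> j = t \<and>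
      j \<otimes> i = t \<otimes> i \<otimes> j \<and> c [^] (3::nat) = \<one> \<and> conjugate c i = j \<and> conjugate c j = i \<otimes> j \<and>
      (order G = 48 \<longrightarrow> (\<exists>d\<in>carrier G. conjugate d i = inv j \<and> conjugate d j = inv i \<and> conjugate d c = inv c)))"
proof -
  obtain F a b where F: "F \<lhd> G" and q: "quaternion_on F a b 2" and "\<And>x. centralizes x F \<Longrightarrow> x \<in> F"
    by (rule two_group_or_quaternion_8_core[OF solv _ t not2]) (erule (1) no_odd, blast)
  then have CF: "\<forall>x. centralizes x F \<longrightarrow> x \<in> F" by blast
  note f = quaternion_on_facts[OF q]
  obtain c where c: "odd_element c" "c \<noteq> \<one>"
    using odd_elements_trivial_imp_2_group[OF subgroup_self] not2 by (auto simp: order_def)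
  have all: "\<forall>c. odd_element c \<and> c \<noteq> \<one> \<longrightarrow> (\<exists>i j. quaternion_on F i j 2 \<and> i \<otimes> i = t \<and> j \<otimes> j = t \<and>
      j \<otimes> i = t \<otimes> i \<otimes> j \<and> c [^] (3::nat) = \<one> \<and> conjugate c i = j \<and> conjugate c j = i \<otimes> j \<and>
      (order G = 48 \<longrightarrow> (\<exists>d\<in>carrier G. conjugate d i = inv j \<and> conjugate d j = inv i \<and> conjugate d c = inv c)))"
  proof (intro allI impI)
    fix c assume "odd_element c \<and> c \<noteq> \<one>"
    then have c: "odd_element c" "c \<noteq> \<one>" by auto
    then have cc: "c \<in> carrier G" by (simp add: odd_element_def)
    obtain i j where ij: "quaternion_on F i j 2" "c [^] (3::nat) = \<one>" "conjugate c i = j" "conjugate c j = i \<otimes> j"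
      using odd_element_quaternion_8_action[OF t F CF q c] .
    have "\<exists>d\<in>carrier G. conjugate d i = inv j \<and> conjugate d j = inv i \<and> conjugate d c = inv c" if "order G = 48"
      using order_48_inverting_element[OF t F CF that ij(1) cc ij(2-4)] by blast
    then show "\<exists>i j. quaternion_on F i j 2 \<and> i \<otimes> i = t \<and> j \<otimes> j = t \<and>
      j \<otimes> i = t \<otimes> i \<otimes> j \<and> c [^] (3::nat) = \<one> \<and> conjugate c i = j \<and> conjugate c j = i \<otimes> j \<and>
      (order G = 48 \<longrightarrow> (\<exists>d\<in>carrier G. conjugate d i = inv j \<and> conjugate d j = inv i \<and> conjugate d c = inv c))"
      using ij q8_squares[OF t F CF ij(1)] q8_ji[OF t F CF ij(1)] by blast
  qed
  have "8 dvd order G" using card_subgroup_dvd[OF f(1)] quaternion_on_card[OF q] by simp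
  moreover have "3 dvd order G"
  proof -
    have "c [^] (3::nat) = \<one>" "c \<in> carrier G" using all c by (auto simp: odd_element_def)
    moreover have "Factorial_Ring.prime (3::nat)" by simp
    ultimately have "ord c = 3" using prime_ord_iff c(2) by blast
    then show ?thesis using ord_dvd_group_order[OF \<open>c \<in> carrier G\<close>] by simp
  qed
  moreover have "order G \<le> 48" by (rule order_le_48[OF t F CF q])
  ultimately have "order G = 24 \<or> order G = 48" using order_pos by presburger
  then show ?thesis using that[OF F _ _ all] c by blast
qed

end


section \<open>The relations of \<open>SL\<^sub>2(3)\<close> and \<open>GL\<^sub>2(3)\<close>\<close>

text \<open>The relations of \<open>SL\<^sub>2(3)\<close>: \<open>i, j\<close> generate a quaternion group with centre \<open>t\<close>, and \<open>c\<close> acts on it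
  by \<open>i \<mapsto> j \<mapsto> i j\<close>.\<close>

definition sl_relations :: "('a, 'b) monoid_scheme \<Rightarrow> 'a \<Rightarrow> 'a \<Rightarrow> 'a \<Rightarrow> 'a \<Rightarrow> bool" where
  "sl_relations G i j t c \<longleftrightarrow> i \<in> carrier G \<and> j \<in> carrier G \<and> t \<in> carrier G \<and> c \<in> carrier G \<and>
     i \<otimes>\<^bsub>G\<^esub> i = t \<and> j \<otimes>\<^bsub>G\<^esub> j = t \<and> t \<otimes>\<^bsub>G\<^esub> t = \<one>\<^bsub>G\<^esub> \<and> j \<otimes>\<^bsub>G\<^esub> i = t \<otimes>\<^bsub>G\<^esub> (i \<otimes>\<^bsub>G\<^esub> j) \<and>
     c \<otimes>\<^bsub>G\<^esub> (c \<otimes>\<^bsub>G\<^esub> c) = \<one>\<^bsub>G\<^esub> \<and> c \<otimes>\<^bsub>G\<^esub> i = j \<otimes>\<^bsub>G\<^esub> c \<and> c \<otimes>\<^bsub>G\<^esub> j = i \<otimes>\<^bsub>G\<^esub> (j \<otimes>\<^bsub>G\<^esub> c)"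

text \<open>The square of \<open>d\<close> is left open: it distinguishes \<open>GL\<^sub>2(3)\<close> from the isoclinic group with
  generalized quaternion Sylow 2-subgroups.\<close>

definition gl_relations :: "('a, 'b) monoid_scheme \<Rightarrow> 'a \<Rightarrow> 'a \<Rightarrow> 'a \<Rightarrow> 'a \<Rightarrow> 'a \<Rightarrow> bool" where
  "gl_relations G i j t c d \<longleftrightarrow> sl_relations G i j t c \<and> d \<in> carrier G \<and>
     d \<otimes>\<^bsub>G\<^esub> i = inv\<^bsub>G\<^esub> j \<otimes>\<^bsub>G\<^esub> d \<and> d \<otimes>\<^bsub>G\<^esub> j = inv\<^bsub>G\<^esub> i \<otimes>\<^bsub>G\<^esub> d \<and> d \<otimes>\<^bsub>G\<^esub> c = inv\<^bsub>G\<^esub> c \<otimes>\<^bsub>G\<^esub> d"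

section \<open>Normal forms, and the orders forced by the relations\<close>

context fin_group
begin

text \<open>In a finite group the inverses of the generators are powers of them. A list of normal
  forms thus has to be tested only against left multiplication by generators.\<close>

lemma generate_subset_left_closed:
  assumes K: "K \<subseteq> carrier G" and S: "S \<subseteq> carrier G" "\<one> \<in> S" and cl: "\<And>k s. k \<in> K \<Longrightarrow> s \<in> S \<Longrightarrow> k \<otimes> s \<in> S"
  shows "generate G K \<subseteq> S"
proof
  have pow: "k [^] (n::nat) \<otimes> s \<in> S" if "k \<in> K" "s \<in> S" for k s n
    using that(2)
  proof (induction n arbitrary: s)
    case (Suc n)
    have "k [^] Suc n \<otimes> s = k [^] n \<otimes> (k \<otimes> s)" using that(1) Suc(2) K S by (auto simp: m_assoc subset_eq)
    then show ?case using Suc cl[OF that(1) Suc(2)] by simp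
  qed (use S in auto)
  have inv_mem: "inv k \<otimes> s \<in> S" if "k \<in> K" "s \<in> S" for k s
  proof -
    have kc: "k \<in> carrier G" using that K by blast
    then show ?thesis using pow that inv_eq_pow by simp
  qed
  have *: "x \<in> generate G K \<Longrightarrow> \<forall>s\<in>S. x \<otimes> s \<in> S" for x
  proof (induction rule: generate.induct)
    case one then show ?case using S by (auto simp: subset_eq)
  next
    case (incl h) then show ?case using cl by blast
  next
    case (inv h) then show ?case using inv_mem by blast
  next
    case (eng h1 h2)
    have h: "h1 \<in> carrier G" "h2 \<in> carrier G" using eng(1,2) generate_in_carrier[OF K] by blast+
    show ?case
    proof
      fix s assume s: "s \<in> S"
      then have "h1 \<otimes> h2 \<otimes> s = h1 \<otimes> (h2 \<otimes> s)" using h S by (auto simp: m_assoc)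
      then show "h1 \<otimes> h2 \<otimes> s \<in> S" using eng s by simp
    qed
  qed
  fix x assume x: "x \<in> generate G K"
  then have "x \<otimes> \<one> \<in> S" using * S(2) by blast
  then show "x \<in> S" using generate_in_carrier[OF K x] by simp
qed

context
  fixes i j t c
  assumes r: "sl_relations G i j t c"
begin

lemma sl_relations_facts:
  "i \<in> carrier G" "j \<in> carrier G" "t \<in> carrier G" "c \<in> carrier G"
  "i \<otimes> i = t" "j \<otimes> j = t" "t \<otimes> t = \<one>" "j \<otimes> i = t \<otimes> (i \<otimes> j)" "c \<otimes> (c \<otimes> c) = \<one>" "c \<otimes> i = j \<otimes> c" "c \<otimes> j = i \<otimes> (j \<otimes> c)"
  using r by (auto simp: sl_relations_def)

lemma sl_t_comm: "i \<otimes> t = t \<otimes> i" "j \<otimes> t = t \<otimes> j" "c \<otimes> t = t \<otimes> c"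
proof -
  note f = sl_relations_facts
  show "i \<otimes> t = t \<otimes> i" using f(1) f(5)[symmetric] by (simp add: m_assoc)
  show "j \<otimes> t = t \<otimes> j" using f(2) f(6)[symmetric] by (simp add: m_assoc)
  have "c \<otimes> (i \<otimes> i) = j \<otimes> (j \<otimes> c)" using f(1,2,4) f(10) by (metis m_assoc)
  then show "c \<otimes> t = t \<otimes> c" using f(2,4) by (simp add: f(5) f(6) flip: m_assoc)
qed

text \<open>Together with associativity these rules carry words to a normal form with the letters in
  the order \<open>t\<close>, \<open>i\<close>, \<open>j\<close>, \<open>c\<close>; the trailing
  \<open>x\<close> lets them act inside right-nested products.\<close>

lemma sl_rewrite:
  assumes x: "x \<in> carrier G"
  shows "i \<otimes> (i \<otimes> x) = t \<otimes> x" "j \<otimes> (j \<otimes> x) = t \<otimes> x" "t \<otimes> (t \<otimes> x) = x" "j \<otimes> (i \<otimes> x) = t \<otimes> (i \<otimes> (j \<otimes> x))"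
    "c \<otimes> (c \<otimes> (c \<otimes> x)) = x" "c \<otimes> (i \<otimes> x) = j \<otimes> (c \<otimes> x)" "c \<otimes> (j \<otimes> x) = i \<otimes> (j \<otimes> (c \<otimes> x))"
    "i \<otimes> (t \<otimes> x) = t \<otimes> (i \<otimes> x)" "j \<otimes> (t \<otimes> x) = t \<otimes> (j \<otimes> x)" "c \<otimes> (t \<otimes> x) = t \<otimes> (c \<otimes> x)"
proof -
  note f = sl_relations_facts
  have assoc: "u \<otimes> (v \<otimes> x) = u \<otimes> v \<otimes> x" if "u \<in> carrier G" "v \<in> carrier G" for u v
    using that x by (simp add: m_assoc)
  show "i \<otimes> (i \<otimes> x) = t \<otimes> x" "j \<otimes> (j \<otimes> x) = t \<otimes> x" "t \<otimes> (t \<otimes> x) = x" using f x by (simp_all add: assoc)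
  show "i \<otimes> (t \<otimes> x) = t \<otimes> (i \<otimes> x)" "j \<otimes> (t \<otimes> x) = t \<otimes> (j \<otimes> x)" "c \<otimes> (t \<otimes> x) = t \<otimes> (c \<otimes> x)"
    using f x by (simp_all add: assoc sl_t_comm)
  show "c \<otimes> (i \<otimes> x) = j \<otimes> (c \<otimes> x)" using f x by (simp add: assoc)
  have "j \<otimes> (i \<otimes> x) = t \<otimes> (i \<otimes> j) \<otimes> x" using f x by (simp add: assoc)
  then show "j \<otimes> (i \<otimes> x) = t \<otimes> (i \<otimes> (j \<otimes> x))" using f x by (simp add: m_assoc)
  have "c \<otimes> (j \<otimes> x) = i \<otimes> (j \<otimes> c) \<otimes> x" using f x by (simp add: assoc)
  then show "c \<otimes> (j \<otimes> x) = i \<otimes> (j \<otimes> (c \<otimes> x))" using f x by (simp add: m_assoc)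
  have "c \<otimes> (c \<otimes> (c \<otimes> x)) = c \<otimes> (c \<otimes> c) \<otimes> x" using f(4) x by (simp add: m_assoc)
  also have "\<dots> = x" unfolding f(9) using x by simp
  finally show "c \<otimes> (c \<otimes> (c \<otimes> x)) = x" .
qed

text \<open>A list of normal forms, possibly with repetitions, from which upper bounds are read off;
  the eight words are distinct once \<open>t\<close> and \<open>c\<close> are nontrivial.\<close>

definition q8_set :: "'a set" where
  "q8_set = {\<one>, i, t, t \<otimes> i, j, i \<otimes> j, t \<otimes> j, t \<otimes> (i \<otimes> j)}"

lemma q8_set_closed:
  "q8_set \<subseteq> carrier G" "x \<in> q8_set \<Longrightarrow> i \<otimes> x \<in> q8_set" "x \<in> q8_set \<Longrightarrow> j \<otimes> x \<in> q8_set"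
  "x \<in> q8_set \<Longrightarrow> \<exists>y\<in>q8_set. c \<otimes> x = y \<otimes> c"
proof -
  note f = sl_relations_facts
  show "q8_set \<subseteq> carrier G" using f by (auto simp: q8_set_def)
  note rew = f sl_rewrite sl_t_comm m_assoc
  show "i \<otimes> x \<in> q8_set" if "x \<in> q8_set"
    using that unfolding q8_set_def by (elim insertE emptyE) (simp_all add: rew)
  show "j \<otimes> x \<in> q8_set" if "x \<in> q8_set"
    using that unfolding q8_set_def by (elim insertE emptyE) (simp_all add: rew)
  show "\<exists>y\<in>q8_set. c \<otimes> x = y \<otimes> c" if "x \<in> q8_set"
    using that unfolding q8_set_def by (elim insertE emptyE) (simp_all add: rew)
qed

lemma sl_generate_q8: "generate G {i, j} \<subseteq> q8_set"
  using sl_relations_facts(1,2) q8_set_closed by (intro generate_subset_left_closed) (auto simp: q8_set_def)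

lemma sl_generate: "generate G {i, j, c} \<subseteq> (\<lambda>(x, y). x \<otimes> y) ` (q8_set \<times> {\<one>, c, c \<otimes> c})"
proof (rule generate_subset_left_closed)
  note f = sl_relations_facts
  let ?S = "(\<lambda>(x, y). x \<otimes> y) ` (q8_set \<times> {\<one>, c, c \<otimes> c})"
  show "{i, j, c} \<subseteq> carrier G" using f by auto
  show "?S \<subseteq> carrier G" using f q8_set_closed(1) by auto
  show "\<one> \<in> ?S" using f by (intro image_eqI[of _ _ "(\<one>, \<one>)"]) (auto simp: q8_set_def)
  fix k s assume k: "k \<in> {i, j, c}" and "s \<in> ?S"
  then obtain x y where s: "s = x \<otimes> y" "x \<in> q8_set" "y \<in> {\<one>, c, c \<otimes> c}" by auto
  have xy: "x \<in> carrier G" "y \<in> carrier G" using s f q8_set_closed(1) by auto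
  have cy: "c \<otimes> y \<in> {\<one>, c, c \<otimes> c}" using s(3) f by auto
  have "\<exists>x'\<in>q8_set. \<exists>y'\<in>{\<one>, c, c \<otimes> c}. k \<otimes> s = x' \<otimes> y'"
  proof (cases "k = c")
    case True
    obtain x' where x': "x' \<in> q8_set" "c \<otimes> x = x' \<otimes> c" using q8_set_closed(4)[OF s(2)] by blast
    have "k \<otimes> s = (c \<otimes> x) \<otimes> y" using True s xy f by (simp add: m_assoc)
    also have "\<dots> = x' \<otimes> (c \<otimes> y)" using x' xy f q8_set_closed(1) by (auto simp: m_assoc)
    finally show ?thesis using x'(1) cy by blast
  next
    case False
    then have "k \<otimes> x \<in> q8_set" using k q8_set_closed(2,3)[OF s(2)] by auto
    moreover have "k \<otimes> s = (k \<otimes> x) \<otimes> y" using k s xy f by (auto simp: m_assoc)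
    ultimately show ?thesis using s(3) by blast
  qed
  then show "k \<otimes> s \<in> ?S" by force
qed

lemma card_q8_le: "card q8_set \<le> 8"
  unfolding q8_set_def by (intro order_trans[OF card_insert_le_m1] card_insert_le_m1; simp)

lemma card_sl_generate_le: "card (generate G {i, j, c}) \<le> 24"
proof -
  note 8 = card_q8_le
  have 3: "card {\<one>, c, c \<otimes> c} \<le> 3" by (intro order_trans[OF card_insert_le_m1] card_insert_le_m1; simp)
  have fin8: "finite q8_set" by (simp add: q8_set_def)
  have "card (generate G {i, j, c}) \<le> card ((\<lambda>(x, y). x \<otimes> y) ` (q8_set \<times> {\<one>, c, c \<otimes> c}))"
    using sl_generate fin8 by (intro card_mono) auto
  also have "\<dots> \<le> card (q8_set \<times> {\<one>, c, c \<otimes> c})" using fin8 by (intro card_image_le) auto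
  also have "\<dots> \<le> 8 * 3" using 8 3 by (simp only: card_cartesian_product mult_le_mono)
  finally show ?thesis by simp
qed

context
  assumes nt: "t \<noteq> \<one>" "c \<noteq> \<one>"
begin

text \<open>\<open>i\<close> has order 4 and does not commute with \<open>j\<close>, so the order is
  a proper multiple of 4 and at most 8.\<close>

lemma card_sl_generate_q8: "card (generate G {i, j}) = 8" "subgroup (generate G {i, j}) G"
proof -
  note f = sl_relations_facts
  show S: "subgroup (generate G {i, j}) G" using f by (intro generate_is_subgroup) auto
  have le: "card (generate G {i, j}) \<le> 8"
    using card_mono[OF _ sl_generate_q8] card_q8_le by (auto simp: q8_set_def)
  have i4: "i [^] (4::nat) = \<one>" using f by (simp add: numeral_eq_Suc m_assoc sl_rewrite)
  have i2: "i [^] (2::nat) \<noteq> \<one>" using f nt by (simp add: pow_sq)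
  have "ord i dvd 2 ^ 2" using i4 f(1) by (simp add: pow_eq_id)
  then obtain k where k: "k \<le> 2" "ord i = 2 ^ k" using divides_primepow_nat[OF two_is_prime_nat] by blast
  have "\<not> ord i dvd 2" using i2 f(1) by (simp add: pow_eq_id)
  then have "k \<noteq> 0" "k \<noteq> 1" using k(2) by (intro notI; simp)+
  then have o4: "ord i = 4" using k by (cases "k = 2") auto
  have ji: "j \<notin> powers i"
  proof
    assume "j \<in> powers i"
    then have "j \<otimes> i = i \<otimes> j" using powers_commute f(1) by blast
    then have "t \<otimes> (i \<otimes> j) = \<one> \<otimes> (i \<otimes> j)" using f by simp
    then show False using nt right_cancel[of "i \<otimes> j" t \<one>] f by simp
  qed
  have gi: "i \<in> generate G {i, j}" "j \<in> generate G {i, j}" by (auto intro: generate.incl)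
  have sub: "powers i \<subseteq> generate G {i, j}" using powers_subset[OF S gi(1)] .
  then have "card (powers i) < card (generate G {i, j})" using ji gi S by (intro psubset_card_mono) auto
  moreover have "card (powers i) dvd card (generate G {i, j})" using card_subgroup_dvd_subgroup[OF _ S sub] f(1) by simp
  ultimately show "card (generate G {i, j}) = 8" using le o4 f(1) by (auto simp: card_powers elim!: dvdE)
qed

lemma card_sl_generate: "card (generate G {i, j, c}) = 24" "subgroup (generate G {i, j, c}) G"
proof -
  note f = sl_relations_facts
  show S: "subgroup (generate G {i, j, c}) G" using f by (intro generate_is_subgroup) auto
  have "generate G {i, j} \<subseteq> generate G {i, j, c}" by (rule mono_generate) auto
  then have 8: "8 dvd card (generate G {i, j, c})"
    using card_subgroup_dvd_subgroup[OF _ S] card_sl_generate_q8 by metis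
  have cg: "c \<in> generate G {i, j, c}" by (auto intro: generate.incl)
  have c3: "c [^] (3::nat) = \<one>" using f by (simp add: numeral_eq_Suc m_assoc)
  have "Factorial_Ring.prime (3::nat)" by simp
  then have o3: "ord c = 3" using c3 nt f(4) prime_ord_iff by blast
  have "c [^] card (generate G {i, j, c}) = \<one>" using subgroup_pow_card[OF S cg] .
  then have "3 dvd card (generate G {i, j, c})" using o3 f(4) by (simp add: pow_eq_id)
  then show "card (generate G {i, j, c}) = 24"
    using 8 card_sl_generate_le card_subgroup_pos[OF S] by presburger
qed

text \<open>Modulo the quaternion subgroup the group is cyclic, generated by \<open>c\<close>. An
  element inverting \<open>c\<close> would force \<open>c\<close> into that subgroup of order 8, but
  \<open>c\<close> has order 3. This is what makes \<open>d\<close> a new element.\<close>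

lemma inverting_notin_sl_generate:
  assumes d: "d \<otimes> c = inv c \<otimes> d" shows "d \<notin> generate G {i, j, c}"
proof
  note f = sl_relations_facts
  let ?Q = "generate G {i, j}"
  have Q: "?Q = q8_set"
    using card_subset_eq[OF _ sl_generate_q8] card_sl_generate_q8(1) card_q8_le card_mono[OF _ sl_generate_q8]
    by (simp add: q8_set_def)
  have sQ: "subgroup ?Q G" by (rule card_sl_generate_q8)
  assume "d \<in> generate G {i, j, c}"
  then obtain x y where xy: "d = x \<otimes> y" "x \<in> ?Q" "y \<in> {\<one>, c, c \<otimes> c}" using sl_generate Q by auto
  have yc: "y \<otimes> c = c \<otimes> y" "y \<in> carrier G" "x \<in> carrier G" using xy f subgroup.mem_carrier[OF sQ] by (auto simp: m_assoc)
  have "x \<otimes> c \<otimes> y = inv c \<otimes> x \<otimes> y" using d xy(1) yc f(4) by (simp add: m_assoc)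
  then have e: "x \<otimes> c = inv c \<otimes> x" using yc f(4) by simp
  have "inv x \<in> ?Q" using xy(2) sQ by (simp add: subgroup.m_inv_closed)
  then obtain x' where x': "x' \<in> ?Q" "c \<otimes> inv x = x' \<otimes> c" using q8_set_closed(4) Q by blast
  have xc': "x' \<in> carrier G" using x' subgroup.mem_carrier[OF sQ] by blast
  have "inv c = x \<otimes> c \<otimes> inv x" using e yc f(4) by (simp add: m_assoc)
  also have "\<dots> = (x \<otimes> x') \<otimes> c" using x'(2) yc xc' f(4) by (simp add: m_assoc)
  finally have "(x \<otimes> x') \<otimes> c \<otimes> inv c = inv c \<otimes> inv c" by simp
  then have "x \<otimes> x' = inv (c \<otimes> c)" using yc xc' f(4) by (simp add: m_assoc inv_mult_group)
  also have "\<dots> = c" using f(4,9) by (intro inv_equality) auto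
  finally have cQ: "c \<in> ?Q" using subgroup.m_closed[OF sQ xy(2) x'(1)] by simp
  have c3: "c [^] (3::nat) = \<one>" using f by (simp add: numeral_eq_Suc m_assoc)
  have "c [^] (8::nat) = \<one>" using subgroup_pow_card[OF sQ cQ] card_sl_generate_q8(1) by simp
  then have "c = \<one>" using pow_eq_one_coprime[OF f(4) c3, of 8] by (simp add: coprime_iff_gcd_eq_1 gcd_nat.simps)
  then show False using nt by simp
qed

end

end

lemma gl_generate:
  assumes g: "gl_relations G i j t c d" and nt: "t \<noteq> \<one>" "c \<noteq> \<one>" and le: "order G \<le> 48"
  shows "generate G {i, j, c, d} = carrier G" "order G = 48"
proof -
  have r: "sl_relations G i j t c" and dc: "d \<in> carrier G" and d: "d \<otimes> c = inv c \<otimes> d" using g by (auto simp: gl_relations_def)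
  note f = sl_relations_facts[OF r]
  let ?D = "generate G {i, j, c}" and ?E = "generate G {i, j, c, d}"
  have sE: "subgroup ?E G" using f dc by (intro generate_is_subgroup) auto
  have DE: "?D \<subseteq> ?E" by (rule mono_generate) auto
  have dE: "d \<in> ?E" by (auto intro: generate.incl)
  have "card ?D < card ?E"
    using inverting_notin_sl_generate[OF r nt d] DE dE sE by (intro psubset_card_mono) auto
  moreover have "card ?D dvd card ?E" using card_subgroup_dvd_subgroup[OF card_sl_generate(2)[OF r nt] sE DE] .
  ultimately obtain k where k: "card ?E = 24 * k" "24 < card ?E" using card_sl_generate(1)[OF r nt] by (metis dvdE)
  moreover have "card ?E \<le> order G" using card_subgroup_dvd[OF sE] order_pos by (auto intro: dvd_imp_le)
  ultimately have "card ?E = 48 \<and> order G = 48" using le by presburger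
  then have "card ?E = 48" "order G = 48" by auto
  then show "?E = carrier G" "order G = 48"
    using card_subset_eq[OF fin subgroup.subset[OF sE]] by (auto simp: order_def)
qed

text \<open>Every element is \<open>x d^n\<close> with \<open>x\<close> in
  \<open>generate G {i, j, c}\<close>, which \<open>d\<close> normalizes; the quotient is cyclic and
  commutators vanish in it. The value of the square of \<open>d\<close> does not enter.\<close>

lemma gl_generate_derived:
  assumes g: "gl_relations G i j t c d"
  shows "derived G (generate G {i, j, c, d}) \<subseteq> generate G {i, j, c}"
proof -
  have r: "sl_relations G i j t c" and dc: "d \<in> carrier G" and d: "d \<otimes> i = inv j \<otimes> d" "d \<otimes> j = inv i \<otimes> d" "d \<otimes> c = inv c \<otimes> d"
    using g by (auto simp: gl_relations_def)
  note f = sl_relations_facts[OF r]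
  let ?D = "generate G {i, j, c}" and ?E = "generate G {i, j, c, d}"
  have K: "{i, j, c} \<subseteq> carrier G" using f by auto
  have sD: "subgroup ?D G" by (rule generate_is_subgroup[OF K])
  have gD: "i \<in> ?D" "j \<in> ?D" "c \<in> ?D" by (auto intro: generate.incl)
  have DG: "x \<in> carrier G" if "x \<in> ?D" for x using that subgroup.mem_carrier[OF sD] by blast
  note cl = subgroup.m_closed[OF sD] subgroup.m_inv_closed[OF sD]
  have cd: "conjugate d i = inv j" "conjugate d j = inv i" "conjugate d c = inv c"
    using d dc f(1,2,4) by (auto simp: conjugate_def m_assoc)
  have conj: "conjugate d x \<in> ?D" if "x \<in> ?D" for x
    using that
  proof (induction rule: generate.induct)
    case one then show ?case using dc subgroup.one_closed[OF sD] by simp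
  next
    case (incl h) then show ?case using cd gD cl by auto
  next
    case (inv h)
    then have "conjugate d h \<in> ?D" using cd gD cl by auto
    then show ?case using inv K dc cl by (auto simp: conjugate_inv subset_eq)
  next
    case (eng h1 h2) then show ?case using DG dc cl by (simp add: conjugate_mult)
  qed
  have conjn: "conjugate (d [^] (n::nat)) x \<in> ?D" if "x \<in> ?D" for x n
    using that
  proof (induction n arbitrary: x)
    case (Suc n) then show ?case using conj dc DG by (simp add: conjugate_conjugate)
  qed (use DG in simp)
  define S where "S = {x \<otimes> d [^] (n::nat) | x n. x \<in> ?D}"
  have "?E \<subseteq> S"
  proof (rule generate_subset_left_closed)
    show "{i, j, c, d} \<subseteq> carrier G" using f dc by auto
    show "S \<subseteq> carrier G" using DG dc by (auto simp: S_def)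
    show "\<one> \<in> S" unfolding S_def using subgroup.one_closed[OF sD] by (intro CollectI exI[of _ \<one>] exI[of _ "0::nat"]) auto
    fix k s assume k: "k \<in> {i, j, c, d}" and "s \<in> S"
    then obtain x n where s: "s = x \<otimes> d [^] (n::nat)" "x \<in> ?D" by (auto simp: S_def)
    show "k \<otimes> s \<in> S"
    proof (cases "k \<in> {i, j, c}")
      case True
      then have "k \<otimes> s = (k \<otimes> x) \<otimes> d [^] n" using s DG dc K by (auto simp: m_assoc)
      moreover have "k \<otimes> x \<in> ?D" using True gD s cl by auto
      ultimately show ?thesis by (auto simp: S_def)
    next
      case False
      then have "k \<otimes> s = conjugate d x \<otimes> (d \<otimes> d [^] n)" using k s DG[OF s(2)] dc by (simp add: conjugate_def m_assoc)
      also have "d \<otimes> d [^] n = d [^] Suc n" using dc by (rule nat_pow_Suc2[symmetric])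
      finally show ?thesis using conj[OF s(2)] unfolding S_def by blast
    qed
  qed
  have "x \<otimes> y \<otimes> inv x \<otimes> inv y \<in> ?D" if xy: "x \<in> S" "y \<in> S" for x y
  proof -
    obtain u v and n m :: nat where u: "x = u \<otimes> d [^] n" "u \<in> ?D" and v: "y = v \<otimes> d [^] m" "v \<in> ?D"
      using xy by (auto simp: S_def)
    have uv: "u \<in> carrier G" "v \<in> carrier G" using u v DG by auto
    have comm: "d [^] m \<otimes> inv (d [^] n) = inv (d [^] n) \<otimes> d [^] m"
      using dc powers_abelian[OF dc, of "d [^] m" "inv (d [^] n)"] subgroup.m_inv_closed[OF powers_subgroup[OF dc]] by simp
    have "x \<otimes> y \<otimes> inv x \<otimes> inv y = u \<otimes> d [^] n \<otimes> v \<otimes> (d [^] m \<otimes> inv (d [^] n)) \<otimes> inv u \<otimes> inv (d [^] m) \<otimes> inv v"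
      using u v uv dc by (simp add: grp_simps)
    also have "\<dots> = u \<otimes> conjugate (d [^] n) v \<otimes> conjugate (d [^] m) (inv u) \<otimes> inv v"
      unfolding comm conjugate_def using uv dc by (simp add: grp_simps)
    also have "\<dots> \<in> ?D" using u v cl conjn by simp
    finally show ?thesis .
  qed
  then have "derived_set G ?E \<subseteq> ?D" using \<open>?E \<subseteq> S\<close> by blast
  then show ?thesis unfolding derived_def using generate_subgroup_incl[OF _ sD] by blast
qed

end


section \<open>Isomorphism and isoclinism from subgroups of a product\<close>

lemma (in group) group_center_normal: "group_center G \<lhd> G"
proof (rule normalI_conjugate)
  show "subgroup (group_center G) G"
  proof (rule subgroupI)
    show "group_center G \<noteq> {}" by (auto simp: group_center_def intro!: exI[of _ \<one>])
    show "inv x \<in> group_center G" if "x \<in> group_center G" for x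
    proof -
      have x: "x \<in> carrier G" "\<And>y. y \<in> carrier G \<Longrightarrow> x \<otimes> y = y \<otimes> x" using that by (auto simp: group_center_def)
      have "inv x \<otimes> y = y \<otimes> inv x" if y: "y \<in> carrier G" for y
      proof -
        have "inv x \<otimes> y = inv x \<otimes> (y \<otimes> x) \<otimes> inv x" using x(1) y by (simp add: m_assoc)
        also have "\<dots> = y \<otimes> inv x" using x(1) y by (simp add: m_assoc flip: x(2)[OF y])
        finally show ?thesis .
      qed
      then show ?thesis using x(1) by (simp add: group_center_def)
    qed
    show "x \<otimes> y \<in> group_center G" if "x \<in> group_center G" "y \<in> group_center G" for x y
    proof -
      have xy: "x \<in> carrier G" "y \<in> carrier G" "\<And>z. z \<in> carrier G \<Longrightarrow> x \<otimes> z = z \<otimes> x" "\<And>z. z \<in> carrier G \<Longrightarrow> y \<otimes> z = z \<otimes> y"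
        using that by (auto simp: group_center_def)
      have "x \<otimes> y \<otimes> z = z \<otimes> (x \<otimes> y)" if z: "z \<in> carrier G" for z
      proof -
        have "x \<otimes> y \<otimes> z = x \<otimes> (y \<otimes> z)" by (rule m_assoc[OF xy(1,2) z])
        also have "\<dots> = x \<otimes> z \<otimes> y" unfolding xy(4)[OF z] by (rule m_assoc[OF xy(1) z xy(2), symmetric])
        also have "\<dots> = z \<otimes> (x \<otimes> y)" unfolding xy(3)[OF z] by (rule m_assoc[OF z xy(1,2)])
        finally show ?thesis .
      qed
      then show ?thesis using xy(1,2) by (simp add: group_center_def)
    qed
  qed (auto simp: group_center_def)
  show "conjugate g x \<in> group_center G" if "g \<in> carrier G" "x \<in> group_center G" for g x
  proof -
    have "conjugate g x = x" using that by (auto simp: group_center_def conjugate_eq_self_iff)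
    then show ?thesis using that by simp
  qed
qed

lemma (in group) commutator_eq_one_iff:
  assumes "x \<in> carrier G" "y \<in> carrier G"
  shows "commutator G x y = \<one> \<longleftrightarrow> x \<otimes> y = y \<otimes> x"
proof -
  have c: "commutator G x y \<in> carrier G" using assms by (simp add: commutator_def)
  have "commutator G x y \<otimes> (y \<otimes> x) = x \<otimes> y" using assms by (simp add: commutator_def m_assoc)
  then show ?thesis using assms c right_cancel[of "y \<otimes> x" "commutator G x y" \<one>] by auto
qed

lemma (in group) rcos_eq_iff:
  assumes N: "subgroup N G" and x: "x \<in> carrier G" "y \<in> carrier G"
  shows "N #> x = N #> y \<longleftrightarrow> x \<otimes> inv y \<in> N"
proof -
  have "N #> x = N #> y \<longleftrightarrow> x \<in> N #> y"
    using repr_independence[OF _ x(2) N, of x] rcos_self[OF x(1) N] by auto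
  also have "\<dots> \<longleftrightarrow> x \<otimes> inv y \<in> N" by (rule subgroup.rcos_module[OF N is_group x(2,1)])
  finally show ?thesis .
qed

lemma fin_group_DirProd: "fin_group H \<Longrightarrow> fin_group M \<Longrightarrow> fin_group (H \<times>\<times> M)"
  by (simp add: fin_group_def fin_group_axioms_def DirProd_group)

lemma fst_hom_DirProd: "group H \<Longrightarrow> group M \<Longrightarrow> group_hom (H \<times>\<times> M) H fst"
  by (auto simp: group_hom_def group_hom_axioms_def DirProd_group hom_def)

lemma snd_hom_DirProd: "group H \<Longrightarrow> group M \<Longrightarrow> group_hom (H \<times>\<times> M) M snd"
  by (auto simp: group_hom_def group_hom_axioms_def DirProd_group hom_def)

lemma sl_relations_DirProd:
  "sl_relations H i j t c \<Longrightarrow> sl_relations M i' j' t' c' \<Longrightarrow>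
   sl_relations (H \<times>\<times> M) (i, i') (j, j') (t, t') (c, c')"
  by (auto simp: sl_relations_def)

lemma gl_relations_DirProd:
  assumes "group H" "group M" "gl_relations H i j t c d" "gl_relations M i' j' t' c' d'"
  shows "gl_relations (H \<times>\<times> M) (i, i') (j, j') (t, t') (c, c') (d, d')"
proof -
  have "sl_relations H i j t c" "sl_relations M i' j' t' c'" using assms by (auto simp: gl_relations_def)
  then show ?thesis
    using assms sl_relations_DirProd[of H i j t c M i' j' t' c']
    unfolding gl_relations_def sl_relations_def by (simp add: inv_DirProd)
qed

text \<open>The relations alone bound the order of \<open>D\<close> by 24, the order of its two projections; so \<open>D\<close> is the
  graph of an isomorphism.\<close>

lemma sl_generate_product_inj:
  assumes H: "fin_group H" and M: "fin_group M"
    and rH: "sl_relations H i j t c" "t \<noteq> \<one>\<^bsub>H\<^esub>" "c \<noteq> \<one>\<^bsub>H\<^esub>"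
    and rM: "sl_relations M i' j' t' c'" "t' \<noteq> \<one>\<^bsub>M\<^esub>" "c' \<noteq> \<one>\<^bsub>M\<^esub>"
  defines "D \<equiv> generate (H \<times>\<times> M) {(i, i'), (j, j'), (c, c')}"
  shows "inj_on fst D" "inj_on snd D" "fst ` D = generate H {i, j, c}" "snd ` D = generate M {i', j', c'}"
proof -
  interpret H: fin_group H by fact
  interpret M: fin_group M by fact
  interpret P: fin_group "H \<times>\<times> M" by (rule fin_group_DirProd[OF H M])
  note r = sl_relations_DirProd[OF rH(1) rM(1)]
  have K: "{(i, i'), (j, j'), (c, c')} \<subseteq> carrier (H \<times>\<times> M)" using r by (auto simp: sl_relations_def)
  have fD: "finite D" unfolding D_def using P.finite_subgroup[OF P.generate_is_subgroup[OF K]] .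
  have le: "card D \<le> 24" unfolding D_def by (rule P.card_sl_generate_le[OF r])
  show 1: "fst ` D = generate H {i, j, c}"
    using group_hom.generate_img[OF fst_hom_DirProd[OF H.is_group M.is_group] K] by (simp add: D_def)
  show 2: "snd ` D = generate M {i', j', c'}"
    using group_hom.generate_img[OF snd_hom_DirProd[OF H.is_group M.is_group] K] by (simp add: D_def)
  have "card (fst ` D) = 24" using 1 H.card_sl_generate(1)[OF rH] by simp
  then have "card (fst ` D) = card D" using le card_image_le[OF fD, of fst] by simp
  then show "inj_on fst D" by (rule eq_card_imp_inj_on[OF fD])
  have "card (snd ` D) = 24" using 2 M.card_sl_generate(1)[OF rM] by simp
  then have "card (snd ` D) = card D" using le card_image_le[OF fD, of snd] by simp
  then show "inj_on snd D" by (rule eq_card_imp_inj_on[OF fD])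
qed

text \<open>Injectivity of both projections makes \<open>D\<close> the graph of a bijection, and
  closure of \<open>D\<close> under products makes the bijection multiplicative.\<close>

lemma graph_iso:
  assumes H: "group H" and M: "group M" and D: "subgroup D (H \<times>\<times> M)"
    and inj: "inj_on fst D" "inj_on snd D"
  shows "(\<lambda>x. THE y. (x, y) \<in> D) \<in> iso (H\<lparr>carrier := fst ` D\<rparr>) (M\<lparr>carrier := snd ` D\<rparr>)"
    and "\<And>x y. (x, y) \<in> D \<Longrightarrow> (THE y. (x, y) \<in> D) = y"
proof -
  show the: "(THE y. (x, y) \<in> D) = y" if "(x, y) \<in> D" for x y
    using that inj_onD[OF inj(1), of _ "(x, y)"] by (intro the_equality) auto
  let ?f = "\<lambda>x. THE y. (x, y) \<in> D"
  show "?f \<in> iso (H\<lparr>carrier := fst ` D\<rparr>) (M\<lparr>carrier := snd ` D\<rparr>)"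
  proof (rule isoI)
    show "?f \<in> hom (H\<lparr>carrier := fst ` D\<rparr>) (M\<lparr>carrier := snd ` D\<rparr>)"
    proof (rule homI)
      show "?f x \<in> carrier (M\<lparr>carrier := snd ` D\<rparr>)" if "x \<in> carrier (H\<lparr>carrier := fst ` D\<rparr>)" for x
      proof -
        obtain y where y: "(x, y) \<in> D" using \<open>x \<in> carrier (H\<lparr>carrier := fst ` D\<rparr>)\<close> by auto
        then have "y \<in> snd ` D" by (intro image_eqI[of _ _ "(x, y)"]) simp_all
        then show ?thesis using the[OF y] by simp
      qed
      fix x x' assume "x \<in> carrier (H\<lparr>carrier := fst ` D\<rparr>)" "x' \<in> carrier (H\<lparr>carrier := fst ` D\<rparr>)"
      then obtain y y' where y: "(x, y) \<in> D" "(x', y') \<in> D" by auto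
      then have "(x \<otimes>\<^bsub>H\<^esub> x', y \<otimes>\<^bsub>M\<^esub> y') \<in> D" using subgroup.m_closed[OF D y] by simp
      then show "?f (x \<otimes>\<^bsub>H\<lparr>carrier := fst ` D\<rparr>\<^esub> x') = ?f x \<otimes>\<^bsub>M\<lparr>carrier := snd ` D\<rparr>\<^esub> ?f x'"
        using y the by simp
    qed
    show "bij_betw ?f (carrier (H\<lparr>carrier := fst ` D\<rparr>)) (carrier (M\<lparr>carrier := snd ` D\<rparr>))"
    proof (rule bij_betw_imageI)
      show "inj_on ?f (carrier (H\<lparr>carrier := fst ` D\<rparr>))"
      proof (rule inj_onI)
        fix x x' assume "x \<in> carrier (H\<lparr>carrier := fst ` D\<rparr>)" "x' \<in> carrier (H\<lparr>carrier := fst ` D\<rparr>)" and e: "?f x = ?f x'"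
        then obtain y y' where y: "(x, y) \<in> D" "(x', y') \<in> D" by auto
        then have "y = y'" using e the by simp
        then show "x = x'" using inj_onD[OF inj(2), of "(x, y)" "(x', y')"] y by simp
      qed
      have "?f (fst u) = snd u" if "u \<in> D" for u using the[of "fst u" "snd u"] that by simp
      then have "(\<lambda>u. ?f (fst u)) ` D = snd ` D" by (intro image_cong) auto
      then show "?f ` carrier (H\<lparr>carrier := fst ` D\<rparr>) = carrier (M\<lparr>carrier := snd ` D\<rparr>)"
        by (simp add: image_image)
    qed
  qed
qed

text \<open>\<open>E\<close> relates elements that correspond up to the centers. Commutators of
  related pairs lie in the derived subgroup of \<open>E\<close>, the graph of a bijection, so one of
  them is trivial exactly when the other is. Hence related elements are central simultaneously, and
  \<open>E\<close> induces compatible isomorphisms of central quotients and derived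
  subgroups.\<close>

lemma subdirect_product_isoclinic:
  fixes H :: "('a, 'c) monoid_scheme" and M :: "('b, 'd) monoid_scheme"
  assumes H: "group H" and M: "group M" and E: "subgroup E (H \<times>\<times> M)"
    and surj: "fst ` E = carrier H" "snd ` E = carrier M"
    and inj: "inj_on fst (derived (H \<times>\<times> M) E)" "inj_on snd (derived (H \<times>\<times> M) E)"
  shows "isoclinic H M"
proof -
  interpret H: group H by fact
  interpret M: group M by fact
  interpret P: group "H \<times>\<times> M" using H M by (rule DirProd_group)
  let ?P = "H \<times>\<times> M" and ?ZH = "group_center H" and ?ZM = "group_center M"
  interpret ZH: normal ?ZH H by (rule H.group_center_normal)
  interpret ZM: normal ?ZM M by (rule M.group_center_normal)
  have EP: "E \<subseteq> carrier ?P" by (rule subgroup.subset[OF E])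
  define D where "D = derived ?P E"
  have sD: "subgroup D ?P" unfolding D_def by (rule P.derived_is_subgroup[OF EP])
  have 1: "(\<one>\<^bsub>H\<^esub>, \<one>\<^bsub>M\<^esub>) \<in> D" using subgroup.one_closed[OF sD] by simp
  have commE: "(commutator H x x', commutator M y y') \<in> D" if "(x, y) \<in> E" "(x', y') \<in> E" for x y x' y'
  proof -
    have "(x, y) \<otimes>\<^bsub>?P\<^esub> (x', y') \<otimes>\<^bsub>?P\<^esub> inv\<^bsub>?P\<^esub> (x, y) \<otimes>\<^bsub>?P\<^esub> inv\<^bsub>?P\<^esub> (x', y') \<in> D"
      unfolding D_def derived_def using that by (intro generate.incl) blast
    moreover have "x \<in> carrier H" "y \<in> carrier M" "x' \<in> carrier H" "y' \<in> carrier M" using that EP by auto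
    ultimately show ?thesis using H M by (simp add: commutator_def inv_DirProd)
  qed
  have comm1H: "commutator H x y = \<one>\<^bsub>H\<^esub> \<longleftrightarrow> x \<otimes>\<^bsub>H\<^esub> y = y \<otimes>\<^bsub>H\<^esub> x" if "x \<in> carrier H" "y \<in> carrier H" for x y
    by (rule H.commutator_eq_one_iff[OF that])
  have comm1M: "commutator M x y = \<one>\<^bsub>M\<^esub> \<longleftrightarrow> x \<otimes>\<^bsub>M\<^esub> y = y \<otimes>\<^bsub>M\<^esub> x" if "x \<in> carrier M" "y \<in> carrier M" for x y
    by (rule M.commutator_eq_one_iff[OF that])
  have carE: "x \<in> carrier H" "y \<in> carrier M" if "(x, y) \<in> E" for x y using that EP by auto
  have center_aux: "\<forall>u'\<in>snd ` E. commutator M y u' = \<one>\<^bsub>M\<^esub>" if xy: "(x, y) \<in> E" and x: "x \<in> ?ZH" for x y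
  proof
    fix y' assume "y' \<in> snd ` E"
    then obtain x' where x': "(x', y') \<in> E" by auto
    have "commutator H x x' = \<one>\<^bsub>H\<^esub>" using comm1H[OF carE(1)[OF xy] carE(1)[OF x']] x carE(1)[OF x'] unfolding group_center_def by blast
    then have "(\<one>\<^bsub>H\<^esub>, commutator M y y') \<in> D" using commE[OF xy x'] by simp
    then show "commutator M y y' = \<one>\<^bsub>M\<^esub>"
      using inj_onD[OF inj(1)[folded D_def] _ _ 1, of "(\<one>\<^bsub>H\<^esub>, commutator M y y')"] by simp
  qed
  have center_aux': "\<forall>u'\<in>fst ` E. commutator H x u' = \<one>\<^bsub>H\<^esub>" if xy: "(x, y) \<in> E" and y: "y \<in> ?ZM" for x y
  proof
    fix x' assume "x' \<in> fst ` E"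
    then obtain y' where x': "(x', y') \<in> E" by auto
    have "commutator M y y' = \<one>\<^bsub>M\<^esub>" using comm1M[OF carE(2)[OF xy] carE(2)[OF x']] y carE(2)[OF x'] unfolding group_center_def by blast
    then have "(commutator H x x', \<one>\<^bsub>M\<^esub>) \<in> D" using commE[OF xy x'] by simp
    then show "commutator H x x' = \<one>\<^bsub>H\<^esub>"
      using inj_onD[OF inj(2)[folded D_def] _ _ 1, of "(commutator H x x', \<one>\<^bsub>M\<^esub>)"] by simp
  qed
  have center: "x \<in> ?ZH \<longleftrightarrow> y \<in> ?ZM" if xy: "(x, y) \<in> E" for x y
  proof
    assume "x \<in> ?ZH"
    from center_aux[OF xy this] have "\<forall>u'\<in>carrier M. commutator M y u' = \<one>\<^bsub>M\<^esub>" unfolding surj .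
    then show "y \<in> ?ZM" using comm1M[OF carE(2)[OF xy]] carE(2)[OF xy] unfolding group_center_def by blast
  next
    assume "y \<in> ?ZM"
    from center_aux'[OF xy this] have "\<forall>u'\<in>carrier H. commutator H x u' = \<one>\<^bsub>H\<^esub>" unfolding surj .
    then show "x \<in> ?ZH" using comm1H[OF carE(1)[OF xy]] carE(1)[OF xy] unfolding group_center_def by blast
  qed
  have cosH: "?ZH #>\<^bsub>H\<^esub> x = ?ZH #>\<^bsub>H\<^esub> x' \<longleftrightarrow> x \<otimes>\<^bsub>H\<^esub> inv\<^bsub>H\<^esub> x' \<in> ?ZH" if "x \<in> carrier H" "x' \<in> carrier H" for x x'
    by (rule H.rcos_eq_iff[OF ZH.subgroup_axioms that])
  have cosM: "?ZM #>\<^bsub>M\<^esub> x = ?ZM #>\<^bsub>M\<^esub> x' \<longleftrightarrow> x \<otimes>\<^bsub>M\<^esub> inv\<^bsub>M\<^esub> x' \<in> ?ZM" if "x \<in> carrier M" "x' \<in> carrier M" for x x'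
    by (rule M.rcos_eq_iff[OF ZM.subgroup_axioms that])
  have cos_iff: "?ZH #>\<^bsub>H\<^esub> x = ?ZH #>\<^bsub>H\<^esub> x' \<longleftrightarrow> ?ZM #>\<^bsub>M\<^esub> y = ?ZM #>\<^bsub>M\<^esub> y'" if xy: "(x, y) \<in> E" "(x', y') \<in> E" for x y x' y'
  proof -
    have "(x, y) \<otimes>\<^bsub>?P\<^esub> inv\<^bsub>?P\<^esub> (x', y') \<in> E" using E xy by (simp add: subgroup.m_closed subgroup.m_inv_closed)
    then have "(x \<otimes>\<^bsub>H\<^esub> inv\<^bsub>H\<^esub> x', y \<otimes>\<^bsub>M\<^esub> inv\<^bsub>M\<^esub> y') \<in> E"
      using inv_DirProd[OF H M carE[OF xy(2)]] by simp
    then show ?thesis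
      using center cosH[OF carE(1)[OF xy(1)] carE(1)[OF xy(2)]] cosM[OF carE(2)[OF xy(1)] carE(2)[OF xy(2)]] by metis
  qed
  \<comment> \<open>The graph of \<open>\<phi>\<close> is the image of \<open>E\<close> among pairs
    of cosets; \<open>cos_iff\<close> makes it single-valued and injective.\<close>
  define \<phi> where "\<phi> S = (THE T. \<exists>x y. (x, y) \<in> E \<and> S = ?ZH #>\<^bsub>H\<^esub> x \<and> T = ?ZM #>\<^bsub>M\<^esub> y)" for S
  have \<phi>: "\<phi> (?ZH #>\<^bsub>H\<^esub> x) = ?ZM #>\<^bsub>M\<^esub> y" if xy: "(x, y) \<in> E" for x y
    unfolding \<phi>_def
  proof (rule the_equality)
    show "\<exists>x' y'. (x', y') \<in> E \<and> ?ZH #>\<^bsub>H\<^esub> x = ?ZH #>\<^bsub>H\<^esub> x' \<and> ?ZM #>\<^bsub>M\<^esub> y = ?ZM #>\<^bsub>M\<^esub> y'" using xy by blast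
    fix T assume "\<exists>x' y'. (x', y') \<in> E \<and> ?ZH #>\<^bsub>H\<^esub> x = ?ZH #>\<^bsub>H\<^esub> x' \<and> T = ?ZM #>\<^bsub>M\<^esub> y'"
    then obtain x' y' where "(x', y') \<in> E" "?ZH #>\<^bsub>H\<^esub> x = ?ZH #>\<^bsub>H\<^esub> x'" "T = ?ZM #>\<^bsub>M\<^esub> y'" by blast
    then show "T = ?ZM #>\<^bsub>M\<^esub> y" using cos_iff[OF xy] by metis
  qed
  have carH: "\<exists>x y. (x, y) \<in> E \<and> S = ?ZH #>\<^bsub>H\<^esub> x" if S: "S \<in> carrier (H Mod ?ZH)" for S
  proof -
    obtain x where x: "x \<in> fst ` E" "S = ?ZH #>\<^bsub>H\<^esub> x" using S unfolding carrier_FactGroup surj(1)[symmetric] by (rule imageE) simp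
    moreover obtain y where "(x, y) \<in> E" using x(1) by auto
    ultimately show ?thesis by blast
  qed
  have carM: "\<exists>x y. (x, y) \<in> E \<and> S = ?ZM #>\<^bsub>M\<^esub> y" if S: "S \<in> carrier (M Mod ?ZM)" for S
  proof -
    obtain y where y: "y \<in> snd ` E" "S = ?ZM #>\<^bsub>M\<^esub> y" using S unfolding carrier_FactGroup surj(2)[symmetric] by (rule imageE) simp
    moreover obtain x where "(x, y) \<in> E" using y(1) by auto
    ultimately show ?thesis by blast
  qed
  have iso1: "\<phi> \<in> iso (H Mod ?ZH) (M Mod ?ZM)"
  proof (rule isoI)
    show "\<phi> \<in> hom (H Mod ?ZH) (M Mod ?ZM)"
    proof (rule homI)
      show "\<phi> S \<in> carrier (M Mod ?ZM)" if "S \<in> carrier (H Mod ?ZH)" for S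
      proof -
        obtain x y where xy: "(x, y) \<in> E" "S = ?ZH #>\<^bsub>H\<^esub> x" using carH[OF \<open>S \<in> carrier (H Mod ?ZH)\<close>] by blast
        then show ?thesis using \<phi>[OF xy(1)] carE(2)[OF xy(1)] unfolding carrier_FactGroup by simp
      qed
      fix S S' assume "S \<in> carrier (H Mod ?ZH)" "S' \<in> carrier (H Mod ?ZH)"
      then obtain x y x' y' where S: "(x, y) \<in> E" "S = ?ZH #>\<^bsub>H\<^esub> x" "(x', y') \<in> E" "S' = ?ZH #>\<^bsub>H\<^esub> x'"
        using carH by metis
      have "(x \<otimes>\<^bsub>H\<^esub> x', y \<otimes>\<^bsub>M\<^esub> y') \<in> E" using subgroup.m_closed[OF E S(1,3)] by simp
      then show "\<phi> (S \<otimes>\<^bsub>H Mod ?ZH\<^esub> S') = \<phi> S \<otimes>\<^bsub>M Mod ?ZM\<^esub> \<phi> S'"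
        using S \<phi> carE[OF S(1)] carE[OF S(3)] by (simp add: ZH.rcos_sum ZM.rcos_sum)
    qed
    show "bij_betw \<phi> (carrier (H Mod ?ZH)) (carrier (M Mod ?ZM))"
    proof (rule bij_betw_imageI)
      show "inj_on \<phi> (carrier (H Mod ?ZH))"
      proof (rule inj_onI)
        fix S S' assume "S \<in> carrier (H Mod ?ZH)" "S' \<in> carrier (H Mod ?ZH)" and e: "\<phi> S = \<phi> S'"
        then obtain x y x' y' where S: "(x, y) \<in> E" "S = ?ZH #>\<^bsub>H\<^esub> x" "(x', y') \<in> E" "S' = ?ZH #>\<^bsub>H\<^esub> x'"
          using carH by metis
        then show "S = S'" using e \<phi> cos_iff[OF S(1,3)] by simp
      qed
      show "\<phi> ` carrier (H Mod ?ZH) = carrier (M Mod ?ZM)"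
      proof
        show "\<phi> ` carrier (H Mod ?ZH) \<subseteq> carrier (M Mod ?ZM)"
        proof (rule image_subsetI)
          fix S assume "S \<in> carrier (H Mod ?ZH)"
          then obtain x y where xy: "(x, y) \<in> E" "S = ?ZH #>\<^bsub>H\<^esub> x" using carH by blast
          then show "\<phi> S \<in> carrier (M Mod ?ZM)" using \<phi>[OF xy(1)] carE(2)[OF xy(1)] unfolding carrier_FactGroup by simp
        qed
        show "carrier (M Mod ?ZM) \<subseteq> \<phi> ` carrier (H Mod ?ZH)"
        proof
          fix T assume "T \<in> carrier (M Mod ?ZM)"
          then obtain x y where "(x, y) \<in> E" "T = ?ZM #>\<^bsub>M\<^esub> y" using carM by blast
          then have "T = \<phi> (?ZH #>\<^bsub>H\<^esub> x)" "?ZH #>\<^bsub>H\<^esub> x \<in> carrier (H Mod ?ZH)"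
            using \<phi>[of x y] carE[of x y] unfolding carrier_FactGroup by auto
          then show "T \<in> \<phi> ` carrier (H Mod ?ZH)" by (rule image_eqI)
        qed
      qed
    qed
  qed
  define \<psi> where "\<psi> = (\<lambda>x. THE y. (x, y) \<in> D)"
  have fD: "fst ` D = derived H (carrier H)" "snd ` D = derived M (carrier M)"
    using group_hom.derived_img[OF fst_hom_DirProd[OF H M] EP] group_hom.derived_img[OF snd_hom_DirProd[OF H M] EP] surj
    by (simp_all add: D_def)
  have iso2: "\<psi> \<in> iso (H\<lparr>carrier := derived H (carrier H)\<rparr>) (M\<lparr>carrier := derived M (carrier M)\<rparr>)"
    using graph_iso(1)[OF H M sD] inj unfolding \<psi>_def fD[symmetric] D_def by blast
  have \<psi>: "\<psi> x = y" if "(x, y) \<in> D" for x y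
    using graph_iso(2)[OF H M sD] inj that unfolding \<psi>_def D_def by blast
  \<comment> \<open>Commutators depend only on cosets modulo the center; this handles the arbitrary
    representatives in \<open>isoclinic\<close>.\<close>
  have comm_center: "commutator M (z \<otimes>\<^bsub>M\<^esub> x) (w \<otimes>\<^bsub>M\<^esub> y) = commutator M x y"
    if "z \<in> ?ZM" "w \<in> ?ZM" "x \<in> carrier M" "y \<in> carrier M" for z w x y
  proof -
    have zw: "z \<in> carrier M" "w \<in> carrier M" "\<And>v. v \<in> carrier M \<Longrightarrow> v \<otimes>\<^bsub>M\<^esub> z = z \<otimes>\<^bsub>M\<^esub> v" "\<And>v. v \<in> carrier M \<Longrightarrow> v \<otimes>\<^bsub>M\<^esub> w = w \<otimes>\<^bsub>M\<^esub> v"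
      using that(1,2) unfolding group_center_def by simp_all
    have l: "commutator M (v \<otimes>\<^bsub>M\<^esub> a) b = commutator M a b"
      if "v \<in> carrier M" "\<And>u. u \<in> carrier M \<Longrightarrow> M.conjugate u v = v" "a \<in> carrier M" "b \<in> carrier M" for v a b
    proof -
      have cc: "commutator M a b \<in> carrier M" using that(3,4) by (simp add: commutator_def)
      have "commutator M (v \<otimes>\<^bsub>M\<^esub> a) b = v \<otimes>\<^bsub>M\<^esub> M.conjugate (commutator M a b \<otimes>\<^bsub>M\<^esub> b) (inv\<^bsub>M\<^esub> v) \<otimes>\<^bsub>M\<^esub> commutator M a b"
        using that(1,3,4) by (simp add: commutator_def M.conjugate_def M.grp_simps)
      also have "M.conjugate (commutator M a b \<otimes>\<^bsub>M\<^esub> b) (inv\<^bsub>M\<^esub> v) = inv\<^bsub>M\<^esub> v"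
        using that(2)[of "commutator M a b \<otimes>\<^bsub>M\<^esub> b"] that(1,3,4) cc by (simp add: M.conjugate_inv)
      finally show ?thesis using that(1) cc by simp
    qed
    have sw: "commutator M a b = inv\<^bsub>M\<^esub> commutator M b a" if "a \<in> carrier M" "b \<in> carrier M" for a b
      using that by (simp add: commutator_def M.grp_simps)
    have cz: "M.conjugate u z = z" "M.conjugate u w = w" if "u \<in> carrier M" for u
      using zw(3,4)[OF that] M.conjugate_eq_self_iff[OF that zw(1)] M.conjugate_eq_self_iff[OF that zw(2)] by blast+
    have "commutator M (z \<otimes>\<^bsub>M\<^esub> x) (w \<otimes>\<^bsub>M\<^esub> y) = commutator M x (w \<otimes>\<^bsub>M\<^esub> y)" 
      by (rule l[OF zw(1) cz(1) that(3) M.m_closed[OF zw(2) that(4)]])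
    also have "\<dots> = inv\<^bsub>M\<^esub> commutator M (w \<otimes>\<^bsub>M\<^esub> y) x" 
      by (rule sw[OF that(3) M.m_closed[OF zw(2) that(4)]])
    also have "commutator M (w \<otimes>\<^bsub>M\<^esub> y) x = commutator M y x" by (rule l[OF zw(2) cz(2) that(4,3)])
    also have "inv\<^bsub>M\<^esub> commutator M y x = commutator M x y" by (rule sw[OF that(3,4), symmetric])
    finally show ?thesis .
  qed
  show ?thesis unfolding isoclinic_def
  proof (intro exI conjI ballI impI)
    show "\<phi> \<in> iso (H Mod ?ZH) (M Mod ?ZM)" by (rule iso1)
    show "\<psi> \<in> iso (H\<lparr>carrier := derived H (carrier H)\<rparr>) (M\<lparr>carrier := derived M (carrier M)\<rparr>)" by (rule iso2)
    fix g1 g2 h1 h2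
    assume g: "g1 \<in> carrier H" "g2 \<in> carrier H" "h1 \<in> carrier M" "h2 \<in> carrier M"
      and e: "\<phi> (?ZH #>\<^bsub>H\<^esub> g1) = ?ZM #>\<^bsub>M\<^esub> h1" "\<phi> (?ZH #>\<^bsub>H\<^esub> g2) = ?ZM #>\<^bsub>M\<^esub> h2"
    have "g1 \<in> fst ` E" "g2 \<in> fst ` E" using g surj(1) by simp_all
    then obtain m1 m2 where m: "(g1, m1) \<in> E" "(g2, m2) \<in> E" by auto
    have mc: "m1 \<in> carrier M" "m2 \<in> carrier M" using m carE by auto
    have "?ZM #>\<^bsub>M\<^esub> h1 = ?ZM #>\<^bsub>M\<^esub> m1" "?ZM #>\<^bsub>M\<^esub> h2 = ?ZM #>\<^bsub>M\<^esub> m2" using e \<phi> m by auto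
    then have "h1 \<otimes>\<^bsub>M\<^esub> inv\<^bsub>M\<^esub> m1 \<in> ?ZM" "h2 \<otimes>\<^bsub>M\<^esub> inv\<^bsub>M\<^esub> m2 \<in> ?ZM" using cosM g mc by auto
    from comm_center[OF this mc] have "commutator M h1 h2 = commutator M m1 m2" using g mc by (simp add: M.m_assoc)
    then show "\<psi> (commutator H g1 g2) = commutator M h1 h2" using \<psi>[OF commE[OF m]] by simp
  qed
qed

theorem sl_relations_iso:
  assumes H: "fin_group H" and M: "fin_group M"
    and rH: "sl_relations H i j t c" "t \<noteq> \<one>\<^bsub>H\<^esub>" "c \<noteq> \<one>\<^bsub>H\<^esub>" "order H \<le> 24"
    and rM: "sl_relations M i' j' t' c'" "t' \<noteq> \<one>\<^bsub>M\<^esub>" "c' \<noteq> \<one>\<^bsub>M\<^esub>" "order M \<le> 24"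
  shows "H \<cong> M"
proof -
  interpret H: fin_group H by fact
  interpret M: fin_group M by fact
  interpret P: fin_group "H \<times>\<times> M" by (rule fin_group_DirProd[OF H M])
  let ?D = "generate (H \<times>\<times> M) {(i, i'), (j, j'), (c, c')}"
  have K: "{(i, i'), (j, j'), (c, c')} \<subseteq> carrier (H \<times>\<times> M)" using rH rM by (auto simp: sl_relations_def)
  note inj = sl_generate_product_inj[OF H M rH(1-3) rM(1-3)]
  have "generate H {i, j, c} = carrier H"
    using H.card_sl_generate[OF rH(1-3)] rH(4) card_seteq[OF H.fin subgroup.subset[OF H.card_sl_generate(2)[OF rH(1-3)]]]
    by (simp add: order_def)
  moreover have "generate M {i', j', c'} = carrier M"
    using M.card_sl_generate[OF rM(1-3)] rM(4) card_seteq[OF M.fin subgroup.subset[OF M.card_sl_generate(2)[OF rM(1-3)]]]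
    by (simp add: order_def)
  ultimately show ?thesis
    using graph_iso(1)[OF H.is_group M.is_group P.generate_is_subgroup[OF K] inj(1,2)] inj(3,4)
    by (auto simp: is_iso_def)
qed

text \<open>The squares of \<open>d\<close> and \<open>d'\<close> may differ, so the subgroup
  \<open>?E\<close> of the product generated by all four pairs can fail to be a graph. Its derived
  subgroup lies in the part \<open>?D\<close> generated by the first three pairs, on which both
  projections are injective.\<close>

theorem gl_relations_isoclinic:
  assumes H: "fin_group H" and M: "fin_group M"
    and rH: "gl_relations H i j t c d" "t \<noteq> \<one>\<^bsub>H\<^esub>" "c \<noteq> \<one>\<^bsub>H\<^esub>" "order H \<le> 48"
    and rM: "gl_relations M i' j' t' c' d'" "t' \<noteq> \<one>\<^bsub>M\<^esub>" "c' \<noteq> \<one>\<^bsub>M\<^esub>" "order M \<le> 48"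
  shows "isoclinic H M"
proof -
  interpret H: fin_group H by fact
  interpret M: fin_group M by fact
  interpret P: fin_group "H \<times>\<times> M" by (rule fin_group_DirProd[OF H M])
  have sH: "sl_relations H i j t c" and sM: "sl_relations M i' j' t' c'" using rH rM by (auto simp: gl_relations_def)
  note r = gl_relations_DirProd[OF H.is_group M.is_group rH(1) rM(1)]
  let ?D = "generate (H \<times>\<times> M) {(i, i'), (j, j'), (c, c')}"
  let ?E = "generate (H \<times>\<times> M) {(i, i'), (j, j'), (c, c'), (d, d')}"
  have K: "{(i, i'), (j, j'), (c, c'), (d, d')} \<subseteq> carrier (H \<times>\<times> M)" using r by (auto simp: gl_relations_def sl_relations_def)
  note inj = sl_generate_product_inj[OF H M sH rH(2,3) sM rM(2,3)]
  have "derived (H \<times>\<times> M) ?E \<subseteq> ?D" by (rule P.gl_generate_derived[OF r])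
  then have "inj_on fst (derived (H \<times>\<times> M) ?E)" "inj_on snd (derived (H \<times>\<times> M) ?E)"
    using inj(1,2) inj_on_subset by blast+
  moreover have "fst ` ?E = carrier H"
    using group_hom.generate_img[OF fst_hom_DirProd[OF H.is_group M.is_group] K] H.gl_generate(1)[OF rH] by simp
  moreover have "snd ` ?E = carrier M"
    using group_hom.generate_img[OF snd_hom_DirProd[OF H.is_group M.is_group] K] M.gl_generate(1)[OF rM] by simp
  ultimately show ?thesis
    using subdirect_product_isoclinic[OF H.is_group M.is_group P.generate_is_subgroup[OF K]] by blast
qed


section \<open>\<open>SL\<^sub>2(3)\<close> and \<open>GL\<^sub>2(3)\<close> as matrix groups\<close>

definition mat2 :: "'a::comm_ring_1 \<Rightarrow> 'a \<Rightarrow> 'a \<Rightarrow> 'a \<Rightarrow> 'a ^ 2 ^ 2" where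
  "mat2 a b c d = vector [vector [a, b], vector [c, d]]"

lemma mat2_mult: "mat2 a b c d ** mat2 e f g h = mat2 (a * e + b * g) (a * f + b * h) (c * e + d * g) (c * f + d * h)"
  by (simp add: mat2_def matrix_matrix_mult_def vec_eq_iff forall_2 sum_2)

lemma mat2_eq_iff [simp]: "mat2 a b c d = mat2 e f g h \<longleftrightarrow> a = e \<and> b = f \<and> c = g \<and> d = h"
  by (auto simp: mat2_def vec_eq_iff forall_2)

lemma mat_1_mat2: "mat 1 = mat2 1 0 0 1"
  by (simp add: mat2_def mat_def vec_eq_iff forall_2)

lemma det_mat2: "Determinants.det (mat2 a b c d) = a * d - b * c"
  by (simp add: mat2_def det_2)

lemma mat2_cases:
  fixes A :: "'a::comm_ring_1 ^ 2 ^ 2" obtains a b c d where "A = mat2 a b c d"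
proof
  show "A = mat2 (A $ 1 $ 1) (A $ 1 $ 2) (A $ 2 $ 1) (A $ 2 $ 2)"
    by (simp add: mat2_def vec_eq_iff forall_2)
qed

lemma F3_cases: "(x :: 3) = 0 \<or> x = 1 \<or> x = 2"
proof (cases x)
  case (of_int z)
  then have "z = 0 \<or> z = 1 \<or> z = 2" by auto
  then show ?thesis using of_int by auto
qed

lemma sum_F3: "(\<Sum>x\<in>UNIV. f (x :: 3)) = f 0 + f 1 + (f 2 :: nat)"
proof -
  have *: "(UNIV :: 3 set) = {0, 1, 2}" using F3_cases by auto
  show ?thesis by (subst *) (simp add: add.assoc)
qed

text \<open>It reduces a cardinality to a sum of 81 terms that simplification evaluates.\<close>

lemma card_mat2_F3:
  "card {A :: 3 ^ 2 ^ 2. P A} =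
     (\<Sum>a\<in>UNIV. \<Sum>b\<in>UNIV. \<Sum>c\<in>UNIV. \<Sum>d\<in>UNIV. if P (mat2 a b c d) then 1 else 0)"
proof -
  let ?f = "\<lambda>(a, b, c, d). mat2 a b c d :: 3 ^ 2 ^ 2"
  have bij: "bij_betw ?f UNIV UNIV"
  proof (rule bij_betwI')
    show "\<exists>x\<in>UNIV. A = ?f x" for A :: "3 ^ 2 ^ 2" by (rule mat2_cases[of A]) auto
  qed auto
  have "card {A :: 3 ^ 2 ^ 2. P A} = (\<Sum>A\<in>UNIV. if P A then 1 else 0)"
    by (simp add: sum.If_cases)
  also have "\<dots> = (\<Sum>x\<in>UNIV. if P (?f x) then 1 else 0)"
    using sum.reindex_bij_betw[OF bij, of "\<lambda>A. if P A then 1 else (0::nat)"] by simp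
  also have "\<dots> = (\<Sum>(a, b, c, d)\<in>UNIV \<times> UNIV \<times> UNIV \<times> UNIV. if P (mat2 a b c d) then 1 else 0)"
    by (simp add: case_prod_unfold)
  finally show ?thesis by (simp add: sum.cartesian_product)
qed

lemma fin_group_SL: "fin_group (SL :: (3 ^ 2 ^ 2) monoid)"
proof -
  have "group (SL :: (3 ^ 2 ^ 2) monoid)"
  proof (rule groupI)
    fix A :: "3 ^ 2 ^ 2" assume A: "A \<in> carrier SL"
    obtain a b c d where abcd: "A = mat2 a b c d" by (rule mat2_cases)
    then have "a * d - b * c = 1" using A by (simp add: SL_def det_mat2)
    then show "\<exists>B\<in>carrier SL. B \<otimes>\<^bsub>SL\<^esub> A = \<one>\<^bsub>SL\<^esub>"
      by (intro bexI[of _ "mat2 d (- b) (- c) a"])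
         (auto simp: SL_def abcd det_mat2 mat2_mult mat_1_mat2 algebra_simps)
  qed (auto simp: SL_def det_mul matrix_mul_assoc)
  then show ?thesis by (simp add: fin_group_def fin_group_axioms_def)
qed

lemma fin_group_GL: "fin_group (GL :: (3 ^ 2 ^ 2) monoid)"
  by (simp add: fin_group_def fin_group_axioms_def group_GL)

lemma order_SL_le: "order SL\<^sub>2_3 \<le> 24"
proof -
  have "order SL\<^sub>2_3 = card {A :: 3 ^ 2 ^ 2. Determinants.det A = 1}" by (simp add: order_def SL_def)
  also have "\<dots> = 24" unfolding card_mat2_F3 det_mat2 sum_F3 by simp
  finally show ?thesis by simp
qed

lemma order_GL_le: "order GL\<^sub>2_3 \<le> 48"
proof -
  have "Determinants.det A \<noteq> 0" if inv: "invertible A" for A :: "3 ^ 2 ^ 2"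
  proof -
    obtain B where "A ** B = mat 1" using inv by (auto simp: invertible_def)
    then have "Determinants.det A * Determinants.det B = 1" by (metis det_mul det_I)
    then show ?thesis by auto
  qed
  then have "order GL\<^sub>2_3 \<le> card {A :: 3 ^ 2 ^ 2. Determinants.det A \<noteq> 0}"
    unfolding order_def GL_def by (auto intro!: card_mono)
  also have "\<dots> = 48" unfolding card_mat2_F3 det_mat2 sum_F3 by simp
  finally show ?thesis .
qed

text \<open>Here 2 stands for -1. The matrices \<open>mat_i\<close> and \<open>mat_j\<close> have
  determinant 1 and trace 0, so they square to \<open>mat_t\<close>, the matrix -1.
  \<open>mat_c\<close> is a transvection of order 3 conjugating \<open>mat_i\<close> to
  \<open>mat_j\<close>, and \<open>mat_d\<close> is an involution of determinant -1 inverting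
  \<open>mat_c\<close>.\<close>

definition mat_i :: "3 ^ 2 ^ 2" where "mat_i = mat2 0 2 1 0"
definition mat_j :: "3 ^ 2 ^ 2" where "mat_j = mat2 1 1 1 2"
definition mat_t :: "3 ^ 2 ^ 2" where "mat_t = mat2 2 0 0 2"
definition mat_c :: "3 ^ 2 ^ 2" where "mat_c = mat2 1 1 0 1"
definition mat_d :: "3 ^ 2 ^ 2" where "mat_d = mat2 1 2 0 2"

lemmas mat_defs = mat_i_def mat_j_def mat_t_def mat_c_def mat_d_def

lemma sl_relations_SL: "sl_relations SL\<^sub>2_3 mat_i mat_j mat_t mat_c"
  by (simp add: sl_relations_def SL_def mat_defs mat2_mult det_mat2 mat_1_mat2)

lemma mat_nontrivial: "mat_t \<noteq> mat 1" "mat_c \<noteq> mat 1"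
  by (simp_all add: mat_defs mat_1_mat2)

lemma mat_invertible: "invertible mat_i" "invertible mat_j" "invertible mat_t" "invertible mat_c" "invertible mat_d"
  unfolding invertible_def mat_1_mat2
  by (rule exI[of _ "mat2 0 1 2 0"], simp add: mat_defs mat2_mult,
      rule exI[of _ "mat2 2 2 2 1"], simp add: mat_defs mat2_mult,
      rule exI[of _ "mat2 2 0 0 2"], simp add: mat_defs mat2_mult,
      rule exI[of _ "mat2 1 2 0 1"], simp add: mat_defs mat2_mult,
      rule exI[of _ "mat2 1 2 0 2"], simp add: mat_defs mat2_mult)

lemma gl_relations_GL: "gl_relations GL\<^sub>2_3 mat_i mat_j mat_t mat_c mat_d"
proof -
  interpret GL: group GL\<^sub>2_3 by (rule group_GL)
  have s: "sl_relations GL\<^sub>2_3 mat_i mat_j mat_t mat_c"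
    using mat_invertible by (simp add: sl_relations_def GL_def) (simp add: mat_defs mat2_mult mat_1_mat2)
  have car: "x \<in> carrier GL\<^sub>2_3 \<longleftrightarrow> invertible x" for x :: "3 ^ 2 ^ 2" by (simp add: GL_def)
  have inv: "inv\<^bsub>GL\<^sub>2_3\<^esub> mat_i = mat2 0 1 2 0" "inv\<^bsub>GL\<^sub>2_3\<^esub> mat_j = mat2 2 2 2 1" "inv\<^bsub>GL\<^sub>2_3\<^esub> mat_c = mat2 1 2 0 1"
  proof -
    have *: "inv\<^bsub>GL\<^sub>2_3\<^esub> x = y" if "y ** x = mat 1" "x ** y = mat 1" for x y :: "3 ^ 2 ^ 2"
    proof (rule GL.inv_equality)
      show "x \<in> carrier GL\<^sub>2_3" "y \<in> carrier GL\<^sub>2_3" using that by (auto simp: GL_def invertible_def)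
      show "y \<otimes>\<^bsub>GL\<^sub>2_3\<^esub> x = \<one>\<^bsub>GL\<^sub>2_3\<^esub>" using that by (simp add: GL_def)
    qed
    show "inv\<^bsub>GL\<^sub>2_3\<^esub> mat_i = mat2 0 1 2 0" "inv\<^bsub>GL\<^sub>2_3\<^esub> mat_j = mat2 2 2 2 1" "inv\<^bsub>GL\<^sub>2_3\<^esub> mat_c = mat2 1 2 0 1"
      by (rule *; simp add: mat_defs mat2_mult mat_1_mat2)+
  qed
  show ?thesis unfolding gl_relations_def inv
    using s mat_invertible by (simp add: car) (simp add: GL_def mat_defs mat2_mult)
qed

text \<open>Two matrices suffice to cut the commutant down to scalars; both center computations
  below rest on this.\<close>

lemma scalar_of_commuting:
  fixes A :: "3 ^ 2 ^ 2"
  assumes "A ** mat_i = mat_i ** A" "A ** mat_c = mat_c ** A"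
  obtains a where "A = mat2 a 0 0 a"
proof -
  obtain a b c d where A: "A = mat2 a b c d" by (rule mat2_cases)
  then have "A = mat2 a 0 0 a" using assms by (auto simp: mat_defs mat2_mult)
  then show ?thesis using that by blast
qed

lemma mat_t_commute: "mat_t ** A = A ** mat_t" for A :: "3 ^ 2 ^ 2"
  by (rule mat2_cases[of A]) (simp add: mat_defs mat2_mult mult.commute)

lemma group_center_GL: "group_center GL\<^sub>2_3 = {mat 1, mat_t}"
proof
  show "group_center GL\<^sub>2_3 \<subseteq> {mat 1, mat_t}"
  proof
    fix A assume "A \<in> group_center GL\<^sub>2_3"
    then have A: "invertible A" "A ** mat_i = mat_i ** A" "A ** mat_c = mat_c ** A"
      using mat_invertible by (auto simp: group_center_def GL_def)
    then obtain a where a: "A = mat2 a 0 0 a" using scalar_of_commuting by blast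
    have "a \<noteq> 0"
    proof
      assume "a = 0"
      obtain B where "A ** B = mat 1" using A(1) by (auto simp: invertible_def)
      moreover obtain e f g h where "B = mat2 e f g h" by (rule mat2_cases)
      ultimately show False using a \<open>a = 0\<close> by (simp add: mat2_mult mat_1_mat2)
    qed
    then show "A \<in> {mat 1, mat_t}" using F3_cases[of a] a by (auto simp: mat_1_mat2 mat_defs)
  qed
  show "{mat 1, mat_t} \<subseteq> group_center GL\<^sub>2_3"
    using mat_invertible mat_t_commute
    by (auto simp: group_center_def GL_def invertible_def intro!: exI[of _ "mat 1 :: 3 ^ 2 ^ 2"])
qed

lemma SL_unique_involution: "group.unique_involution SL\<^sub>2_3 mat_t"
proof -
  interpret SL: fin_group SL\<^sub>2_3 by (rule fin_group_SL)
  have "A = mat 1 \<or> A = mat_t" if "Determinants.det A = 1" "A ** A = mat 1" for A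
  proof -
    obtain a b c d where A: "A = mat2 a b c d" by (rule mat2_cases)
    show ?thesis
      using that F3_cases[of a] F3_cases[of b] F3_cases[of c] F3_cases[of d]
      unfolding A by (elim disjE) (simp_all add: det_mat2 mat2_mult mat_1_mat2 mat_t_def)
  qed
  moreover have "Determinants.det mat_t = 1" "mat_t ** mat_t = mat 1" by (simp_all add: mat_defs det_mat2 mat2_mult mat_1_mat2)
  ultimately show ?thesis using mat_nontrivial(1) unfolding SL.unique_involution_def by (auto simp: SL_def)
qed

lemma SL_center_square: "A \<in> group_center SL\<^sub>2_3 \<Longrightarrow> A ** A = mat 1"
proof -
  assume "A \<in> group_center SL\<^sub>2_3"
  then have A: "Determinants.det A = 1" "A ** mat_i = mat_i ** A" "A ** mat_c = mat_c ** A"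
    using sl_relations_SL by (auto simp: group_center_def sl_relations_def) (auto simp: SL_def)
  then obtain a where a: "A = mat2 a 0 0 a" using scalar_of_commuting by blast
  then show ?thesis using A(1) by (simp add: det_mat2 mat2_mult mat_1_mat2)
qed


section \<open>The cases of the theorem\<close>

text \<open>These two properties are all that case (2b) takes from the quotient: the first gives a
  unique involution of \<open>G\<close>, the second bounds the 2-part of
  \<open>|K(G)|\<close>.\<close>

lemma iso_SL_facts:
  assumes H: "fin_group H" and iso: "H \<cong> SL\<^sub>2_3"
  shows "\<exists>t. group.unique_involution H t" "\<And>x. x \<in> group_center H \<Longrightarrow> x \<otimes>\<^bsub>H\<^esub> x = \<one>\<^bsub>H\<^esub>"
proof -
  interpret H: fin_group H by fact
  interpret SL: fin_group SL\<^sub>2_3 by (rule fin_group_SL)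
  obtain f where f: "f \<in> iso H SL\<^sub>2_3" using iso by (auto simp: is_iso_def)
  interpret f: group_hom H "SL\<^sub>2_3" f
    using f by (simp add: group_hom_def group_hom_axioms_def H.is_group SL.is_group iso_def)
  have inj: "inj_on f (carrier H)" and surj: "f ` carrier H = carrier SL\<^sub>2_3"
    using f by (auto simp: iso_def bij_betw_def)
  have eq: "x = y \<longleftrightarrow> f x = f y" if "x \<in> carrier H" "y \<in> carrier H" for x y
    using inj that by (auto simp: inj_on_def)
  have T: "mat_t \<in> carrier SL\<^sub>2_3" "mat_t \<noteq> \<one>\<^bsub>SL\<^sub>2_3\<^esub>" "mat_t \<otimes>\<^bsub>SL\<^sub>2_3\<^esub> mat_t = \<one>\<^bsub>SL\<^sub>2_3\<^esub>"
    "\<And>A. A \<in> carrier SL\<^sub>2_3 \<Longrightarrow> A \<otimes>\<^bsub>SL\<^sub>2_3\<^esub> A = \<one>\<^bsub>SL\<^sub>2_3\<^esub> \<Longrightarrow> A = \<one>\<^bsub>SL\<^sub>2_3\<^esub> \<or> A = mat_t"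
    using SL_unique_involution unfolding SL.unique_involution_def by blast+
  have "mat_t \<in> f ` carrier H" by (subst surj) (rule T(1))
  then obtain t where t: "mat_t = f t" "t \<in> carrier H" by (rule imageE)
  then have t: "t \<in> carrier H" "f t = mat_t" by simp_all
  have "H.unique_involution t" unfolding H.unique_involution_def
  proof (intro conjI ballI impI)
    show "t \<in> carrier H" by fact
    show "t \<noteq> \<one>\<^bsub>H\<^esub>" using t(2) T(2) f.hom_one by metis
    show "t \<otimes>\<^bsub>H\<^esub> t = \<one>\<^bsub>H\<^esub>" 
      using eq[OF H.m_closed[OF t(1) t(1)] H.one_closed] f.hom_mult[OF t(1) t(1)] t(2) T(3) f.hom_one by metis
    fix x assume x: "x \<in> carrier H" "x \<otimes>\<^bsub>H\<^esub> x = \<one>\<^bsub>H\<^esub>"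
    have "f x \<otimes>\<^bsub>SL\<^sub>2_3\<^esub> f x = \<one>\<^bsub>SL\<^sub>2_3\<^esub>" using f.hom_mult[OF x(1) x(1)] x(2) f.hom_one by metis
    then have "f x = f \<one>\<^bsub>H\<^esub> \<or> f x = f t" using T(4)[OF f.hom_closed[OF x(1)]] t(2) f.hom_one by metis
    then show "x = \<one>\<^bsub>H\<^esub> \<or> x = t" using eq[OF x(1)] t(1) H.one_closed by blast
  qed
  then show "\<exists>t. H.unique_involution t" ..
  fix x assume x: "x \<in> group_center H"
  then have xc: "x \<in> carrier H" unfolding group_center_def by blast
  have "f x \<otimes>\<^bsub>SL\<^sub>2_3\<^esub> A = A \<otimes>\<^bsub>SL\<^sub>2_3\<^esub> f x" if A: "A \<in> carrier SL\<^sub>2_3" for A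
  proof -
    have "A \<in> f ` carrier H" by (subst surj) (rule A)
    then obtain y where y: "A = f y" "y \<in> carrier H" by (rule imageE)
    then have y: "y \<in> carrier H" "A = f y" by simp_all
    have "x \<otimes>\<^bsub>H\<^esub> y = y \<otimes>\<^bsub>H\<^esub> x" using x y(1) unfolding group_center_def by blast
    then show ?thesis using f.hom_mult[OF xc y(1)] f.hom_mult[OF y(1) xc] y(2) by metis
  qed
  then have "f x \<in> group_center SL\<^sub>2_3" using f.hom_closed[OF xc] unfolding group_center_def by blast
  then have "f x ** f x = mat 1" by (rule SL_center_square)
  then have "f (x \<otimes>\<^bsub>H\<^esub> x) = f \<one>\<^bsub>H\<^esub>" using f.hom_mult[OF xc xc] unfolding f.hom_one by (simp add: SL_def)
  then show "x \<otimes>\<^bsub>H\<^esub> x = \<one>\<^bsub>H\<^esub>" using eq[OF H.m_closed[OF xc xc] H.one_closed] by blast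
qed

text \<open>Isoclinism gives \<open>|H/Z(H)| = 24\<close>, so the center has order 2. It lies in the
  quaternion Sylow subgroup \<open>S\<close>, whose only involution is therefore central in
  \<open>H\<close>; every involution is conjugate into \<open>S\<close> and so equals it.\<close>

lemma GL_tilde_facts:
  assumes H: "fin_group H" and GLt: "is_GL\<^sub>2_3_tilde H"
  shows "\<exists>t. group.unique_involution H t" "\<And>x. x \<in> group_center H \<Longrightarrow> x \<otimes>\<^bsub>H\<^esub> x = \<one>\<^bsub>H\<^esub>"
proof -
  interpret H: fin_group H by fact
  interpret GL: fin_group GL\<^sub>2_3 by (rule fin_group_GL)
  have oH: "order H = 48" and isoc: "isoclinic H GL\<^sub>2_3" using GLt by (auto simp: is_GL\<^sub>2_3_tilde_def)
  obtain S where S: "sylow_subgroup 2 S H" "generalized_quaternion (H\<lparr>carrier := S\<rparr>)"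
    using GLt by (auto simp: is_GL\<^sub>2_3_tilde_def)
  have sS: "subgroup S H" using S(1) by (simp add: sylow_subgroup_def)
  interpret S: fin_group "H\<lparr>carrier := S\<rparr>" by (rule H.fin_group_subgroup[OF sS])
  have one_GL: "\<one>\<^bsub>GL\<^sub>2_3\<^esub> = mat 1" by (simp add: GL_def)
  have oGL: "order GL\<^sub>2_3 = 48"
    using GL.gl_generate(2)[OF gl_relations_GL _ _ order_GL_le] mat_nontrivial unfolding one_GL by blast
  have "card (group_center GL\<^sub>2_3) = 2" using mat_nontrivial(1) by (simp add: group_center_GL)
  then have "order (GL\<^sub>2_3 Mod group_center GL\<^sub>2_3) = 24"
    using GL.order_quot[OF GL.group_center_normal] oGL by simp
  moreover have "order (H Mod group_center H) = order (GL\<^sub>2_3 Mod group_center GL\<^sub>2_3)"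
    using isoc iso_same_card[of "H Mod group_center H" "GL\<^sub>2_3 Mod group_center GL\<^sub>2_3"]
    unfolding isoclinic_def is_iso_def order_def by blast
  ultimately have cZ: "card (group_center H) = 2" using H.order_quot[OF H.group_center_normal] oH by simp
  have sZ: "subgroup (group_center H) H" by (rule normal_imp_subgroup[OF H.group_center_normal])
  show sq: "x \<otimes>\<^bsub>H\<^esub> x = \<one>\<^bsub>H\<^esub>" if "x \<in> group_center H" for x
    using H.subgroup_pow_card[OF sZ that] cZ H.pow_sq[OF subgroup.mem_carrier[OF sZ that]] by simp
  have "\<not> group_center H \<subseteq> {\<one>\<^bsub>H\<^esub>}" using cZ card_mono[of "{\<one>\<^bsub>H\<^esub>}" "group_center H"] by auto
  then obtain t where t: "t \<in> group_center H" "t \<noteq> \<one>\<^bsub>H\<^esub>" by blast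
  have tc: "t \<in> carrier H" using t(1) unfolding group_center_def by blast
  have "group_center H \<subseteq> S"
    using H.normal_p_subgroup_subset_sylow[OF two_is_prime_nat S(1) H.group_center_normal, of 1] cZ by simp
  then have tS: "t \<in> S" using t by blast
  obtain a b m where q: "S.quaternion_pair a b m" using S.generalized_quaternion_imp_quaternion_pair[OF S(2)] .
  have SI: "x = y" if "x \<in> S" "y \<in> S" "x \<otimes>\<^bsub>H\<^esub> x = \<one>\<^bsub>H\<^esub>" "y \<otimes>\<^bsub>H\<^esub> y = \<one>\<^bsub>H\<^esub>" "x \<noteq> \<one>\<^bsub>H\<^esub>" "y \<noteq> \<one>\<^bsub>H\<^esub>" for x y
    using S.quaternion_involution[OF q, of x] S.quaternion_involution[OF q, of y] that by auto
  have "H.unique_involution t" unfolding H.unique_involution_def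
  proof (intro conjI ballI impI)
    fix y assume y: "y \<in> carrier H" "y \<otimes>\<^bsub>H\<^esub> y = \<one>\<^bsub>H\<^esub>"
    show "y = \<one>\<^bsub>H\<^esub> \<or> y = t"
    proof (cases "y = \<one>\<^bsub>H\<^esub>")
      case ny: False
      then have "H.ord y = 2" using H.prime_ord_iff[OF two_is_prime_nat y(1)] H.pow_sq[OF y(1)] y(2) by simp
      then have "card (H.powers y) = 2 ^ 1" using H.card_powers[OF y(1)] by simp
      then obtain g where g: "g \<in> carrier H" "\<forall>x\<in>H.powers y. H.conjugate g x \<in> S"
        using H.sylow_conjugate[OF two_is_prime_nat S(1) H.powers_subgroup[OF y(1)]] by blast
      have gy: "H.conjugate g y \<in> S" using g H.powers_self[OF y(1)] by blast
      have "H.conjugate g y \<otimes>\<^bsub>H\<^esub> H.conjugate g y = \<one>\<^bsub>H\<^esub>" using y g(1) by (simp flip: H.conjugate_mult)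
      moreover have "H.conjugate g y \<noteq> \<one>\<^bsub>H\<^esub>" using ny H.conjugate_eq_iff[OF g(1) y(1) H.one_closed] g(1) by simp
      ultimately have "H.conjugate g y = t" using SI[OF gy tS] sq[OF t(1)] t(2) by blast
      also have "t = H.conjugate g t"
        using t(1) g(1) tc H.conjugate_eq_self_iff[OF g(1) tc] unfolding group_center_def by auto
      finally show ?thesis using H.conjugate_eq_iff[OF g(1) y(1) tc] by simp
    qed simp
  qed (use t tc sq in auto)
  then show "\<exists>t. H.unique_involution t" ..
qed

section \<open>Case (2) makes 2 divide the order of K(G) exactly once\<close>

context fin_group
begin

lemma odd_normal_square_trivial:
  assumes "subgroup N G" "odd (card N)" "x \<in> N" "x \<otimes> x = \<one>" shows "x = \<one>"
proof -
  have xc: "x \<in> carrier G" using assms(1,3) by (rule subgroup.mem_carrier)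
  have "x [^] (2::nat) = \<one>" using assms(4) pow_sq[OF xc] by simp
  then show ?thesis using pow_eq_one_coprime[OF xc, of "card N" 2] subgroup_pow_card[OF assms(1,3)] assms(2) by simp
qed

text \<open>If \<open>y = n z\<close> squares to 1, then \<open>n^2 = 1\<close> because
  \<open>n\<close> and \<open>z\<close> commute, and \<open>n = 1\<close> because \<open>N\<close>
  has odd order.\<close>

lemma unique_involution_lift:
  assumes N: "N \<lhd> G" "odd (card N)" and z: "z \<in> carrier G" "z \<noteq> \<one>" "z \<otimes> z = \<one>"
    and zN: "\<And>n. n \<in> N \<Longrightarrow> z \<otimes> n = n \<otimes> z"
    and uniq: "\<And>y. y \<in> carrier G \<Longrightarrow> y \<otimes> y \<in> N \<Longrightarrow> y \<in> N \<or> (\<exists>n\<in>N. y = n \<otimes> z)"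
  shows "unique_involution z"
  unfolding unique_involution_def
proof (intro conjI ballI impI)
  have sN: "subgroup N G" by (rule normal_imp_subgroup[OF N(1)])
  fix y assume y: "y \<in> carrier G" "y \<otimes> y = \<one>"
  then have "y \<otimes> y \<in> N" using subgroup.one_closed[OF sN] by simp
  then consider "y \<in> N" | n where "n \<in> N" "y = n \<otimes> z" using uniq[OF y(1)] by blast
  then show "y = \<one> \<or> y = z"
  proof cases
    case 1 then show ?thesis using odd_normal_square_trivial[OF sN N(2)] y(2) by blast
  next
    case 2
    have nc: "n \<in> carrier G" using 2(1) sN by (rule subgroup.mem_carrier[rotated])
    have "y \<otimes> y = n \<otimes> (z \<otimes> n) \<otimes> z" using 2(2) nc z(1) by (simp add: m_assoc)
    also have "\<dots> = (n \<otimes> n) \<otimes> (z \<otimes> z)" unfolding zN[OF 2(1)] using nc z(1) by (simp add: m_assoc)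
    finally have "n \<otimes> n = \<one>" using y(2) z(3) nc by simp
    then have "n = \<one>" using odd_normal_square_trivial[OF sN N(2) 2(1)] by blast
    then show ?thesis using 2(2) z(1) by simp
  qed
qed (use z in auto)

text \<open>If 4 divided \<open>|K(G)|\<close>, there would be a central \<open>v\<close> of order
  4. Its square lies in \<open>N\<close> and has order 2, against the odd order of
  \<open>N\<close>.\<close>

lemma two_part_cyclicizer:
  assumes N: "N \<lhd> G" "odd (card N)" and z: "unique_involution z"
    and ctr: "\<And>v. v \<in> group_center G \<Longrightarrow> v [^] (4::nat) = \<one> \<Longrightarrow> v \<otimes> v \<in> N"
  shows "2 dvd card (cyclicizer G) \<and> 2 ^ multiplicity 2 (card (cyclicizer G)) = (2::nat)"
proof -
  have zu: "unique_prime_subgroup 2 z" using z unique_prime_subgroup_2_iff by blast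
  then have d2: "2 dvd card (cyclicizer G)"
    using prime_dvd_card_cyclicizer_iff[OF two_is_prime_nat] unique_involution_central[OF z] by blast
  have n4: "\<not> 2 ^ 2 dvd card (cyclicizer G)"
  proof
    assume "2 ^ 2 dvd card (cyclicizer G)"
    then have "4 dvd card (cyclicizer G)" by simp
    then obtain v where v: "v \<in> cyclicizer G" "v [^] (4::nat) = \<one>" "v [^] (2::nat) \<noteq> \<one>"
      using unique_involution_order_4[OF zu cyclicizer_subgroup] by metis
    have vZ: "v \<in> group_center G" using v(1) cyclicizer_subset_center by blast
    then have vc: "v \<in> carrier G" unfolding group_center_def by blast
    have "(v \<otimes> v) \<otimes> (v \<otimes> v) = v [^] (4::nat)" using vc by (simp add: numeral_eq_Suc m_assoc)
    then have "v \<otimes> v = \<one>"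
      using odd_normal_square_trivial[OF normal_imp_subgroup[OF N(1)] N(2) ctr[OF vZ v(2)]] v(2) by simp
    then show False using v(3) pow_sq[OF vc] by simp
  qed
  have "multiplicity 2 (card (cyclicizer G)) = 1"
    using n4 d2 by (intro multiplicity_eqI) simp_all
  then show ?thesis using d2 by simp
qed

lemma sylow_2_center_involution:
  assumes P: "sylow_subgroup 2 P G" and ev: "even (order G)"
  obtains z where "z \<in> P" "z \<in> group_center (G\<lparr>carrier := P\<rparr>)" "z \<in> carrier G" "z \<noteq> \<one>" "z \<otimes> z = \<one>"
proof -
  have sP: "subgroup P G" and cP: "card P = 2 ^ multiplicity 2 (order G)" using P by (auto simp: sylow_subgroup_def)
  interpret P: fin_group "G\<lparr>carrier := P\<rparr>" by (rule fin_group_subgroup[OF sP])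
  have "multiplicity 2 (order G) \<ge> 1" using ev order_pos by (intro multiplicity_geI) auto
  then have "card P \<noteq> 1" using cP by simp
  then have "carrier (G\<lparr>carrier := P\<rparr>) \<noteq> {\<one>\<^bsub>G\<lparr>carrier := P\<rparr>\<^esub>}" by (auto simp: card_1_singleton_iff)
  then obtain z where z: "z \<in> P" "z \<noteq> \<one>" "z [^]\<^bsub>G\<lparr>carrier := P\<rparr>\<^esub> (2::nat) = \<one>" "z \<in> group_center (G\<lparr>carrier := P\<rparr>)"
    using P.p_group_normal_meets_center[OF two_is_prime_nat, of "multiplicity 2 (order G)" "carrier (G\<lparr>carrier := P\<rparr>)"] cP P.normal_self
    by (auto simp: order_def)
  moreover have "z \<in> carrier G" using z(1) sP by (rule subgroup.mem_carrier[rotated])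
  moreover from this have "z \<otimes> z = \<one>" using z(3) pow_sq by (simp flip: nat_pow_consistent)
  ultimately show ?thesis using that by blast
qed

lemma case_2b_two_part:
  assumes P: "sylow_subgroup 2 P G"
    and ZP: "group_center (G\<lparr>carrier := P\<rparr>) \<subseteq> centralizer_in G P (odd_core G)"
    and H: "G Mod odd_core G \<cong> SL\<^sub>2_3 \<or> is_GL\<^sub>2_3_tilde (G Mod odd_core G)"
  shows "2 dvd card (cyclicizer G) \<and> 2 ^ multiplicity 2 (card (cyclicizer G)) = (2::nat)"
proof -
  define N where "N = odd_core G"
  have N: "N \<lhd> G" "odd (card N)" using odd_core_normal odd_core_odd by (simp_all add: N_def)
  have sN: "subgroup N G" by (rule normal_imp_subgroup[OF N(1)])
  interpret Q: fin_group "G Mod N" by (rule quot_fin_group[OF N(1)])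
  interpret h: group_hom G "G Mod N" "\<lambda>x. N #> x" by (rule quot_hom[OF N(1)])
  have facts: "\<exists>t. Q.unique_involution t" "\<And>x. x \<in> group_center (G Mod N) \<Longrightarrow> x \<otimes>\<^bsub>G Mod N\<^esub> x = \<one>\<^bsub>G Mod N\<^esub>"
    using H iso_SL_facts[OF Q.fin_group_axioms] GL_tilde_facts[OF Q.fin_group_axioms] unfolding N_def by blast+
  then obtain t where t: "Q.unique_involution t" by blast
  then have "Q.unique_prime_subgroup 2 t" using Q.unique_prime_subgroup_2_iff by blast
  then have "Q.ord t = 2" by (simp add: Q.unique_prime_subgroup_def)
  then have "2 dvd order (G Mod N)" using Q.ord_dvd_group_order[of t] t by (simp add: Q.unique_involution_def)
  then have ev: "even (order G)" using order_quot[OF N(1)] by (metis dvd_mult2)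
  obtain z where z: "z \<in> P" "z \<in> group_center (G\<lparr>carrier := P\<rparr>)" "z \<in> carrier G" "z \<noteq> \<one>" "z \<otimes> z = \<one>"
    using sylow_2_center_involution[OF P ev] .
  have sq: "(N #> y) \<otimes>\<^bsub>G Mod N\<^esub> (N #> y) = \<one>\<^bsub>G Mod N\<^esub> \<longleftrightarrow> y \<otimes> y \<in> N" if "y \<in> carrier G" for y
    using quot_eq_one[OF N(1), of "y \<otimes> y"] h.hom_mult[OF that that] that by simp
  have two: "N #> y = N \<or> N #> y = t" if "y \<in> carrier G" "y \<otimes> y \<in> N" for y
    using t sq[OF that(1)] that h.hom_closed[OF that(1)] unfolding Q.unique_involution_def by auto
  \<comment> \<open>\<open>z\<close> survives modulo the odd subgroup \<open>N\<close>, so its image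
    is the unique involution \<open>t\<close> of the quotient.\<close>
  have "z \<notin> N" using odd_normal_square_trivial[OF sN N(2)] z by blast
  then have zt: "N #> z = t" using two[OF z(3)] z(5) subgroup.one_closed[OF sN] quot_eq_one[OF N(1) z(3)] by auto
  have zu: "unique_involution z"
  proof (rule unique_involution_lift[OF N z(3-5)])
    show "z \<otimes> n = n \<otimes> z" if "n \<in> N" for n using z(2) ZP that by (auto simp: centralizer_in_def N_def)
    show "y \<in> N \<or> (\<exists>n\<in>N. y = n \<otimes> z)" if y: "y \<in> carrier G" "y \<otimes> y \<in> N" for y
      using two[OF y]
    proof
      assume "N #> y = N" then show ?thesis using quot_eq_one[OF N(1) y(1)] by simp
    next
      assume "N #> y = t"
      then have "y \<otimes> inv z \<in> N" using zt quot_eq[OF N(1) y(1) z(3)] by simp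
      moreover have "y = (y \<otimes> inv z) \<otimes> z" using y(1) z(3) by (simp add: m_assoc)
      ultimately show ?thesis by blast
    qed
  qed
  show ?thesis
  proof (rule two_part_cyclicizer[OF N zu])
    fix v assume v: "v \<in> group_center G"
    then have vc: "v \<in> carrier G" unfolding group_center_def by blast
    have "(N #> v) \<otimes>\<^bsub>G Mod N\<^esub> U = U \<otimes>\<^bsub>G Mod N\<^esub> (N #> v)" if U: "U \<in> carrier (G Mod N)" for U
    proof -
      obtain u where u: "u \<in> carrier G" "U = N #> u" using U by (auto simp: carrier_FactGroup)
      have "v \<otimes> u = u \<otimes> v" using v u(1) unfolding group_center_def by blast
      then show ?thesis using h.hom_mult[OF vc u(1)] h.hom_mult[OF u(1) vc] u(2) by simp
    qed
    then have "N #> v \<in> group_center (G Mod N)" using h.hom_closed[OF vc] unfolding group_center_def by blast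
    then show "v \<otimes> v \<in> N" using facts(2) sq[OF vc] by blast
  qed
qed

text \<open>\<open>P\<close> meets \<open>Q\<close> trivially and has as many elements as there are
  cosets of \<open>Q\<close>, so \<open>P\<close> represents the quotient. Squares and commutators
  modulo \<open>Q\<close> can therefore be computed in \<open>P\<close>, where quaternion groups are
  understood.\<close>

lemma case_2a_two_part:
  assumes P: "sylow_subgroup 2 P G" and gq: "generalized_quaternion (G\<lparr>carrier := P\<rparr>)"
    and Q: "normal_two_complement Q G"
    and ZP: "group_center (G\<lparr>carrier := P\<rparr>) \<subseteq> centralizer_in G P Q"
  shows "2 dvd card (cyclicizer G) \<and> 2 ^ multiplicity 2 (card (cyclicizer G)) = (2::nat)"
proof -
  have sP: "subgroup P G" and cP: "card P = 2 ^ multiplicity 2 (order G)" using P by (auto simp: sylow_subgroup_def)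
  have PG: "P \<subseteq> carrier G" by (rule subgroup.subset[OF sP])
  have N: "Q \<lhd> G" "odd (card Q)" using Q by (auto simp: normal_two_complement_def)
  obtain n where n: "card (rcosets Q) = 2 ^ n" using Q by (auto simp: normal_two_complement_def)
  have sQ: "subgroup Q G" by (rule normal_imp_subgroup[OF N(1)])
  interpret P: fin_group "G\<lparr>carrier := P\<rparr>" by (rule fin_group_subgroup[OF sP])
  obtain a b m where q: "P.quaternion_pair a b m" using P.generalized_quaternion_imp_quaternion_pair[OF gq] .
  define z where "z = a [^]\<^bsub>G\<lparr>carrier := P\<rparr>\<^esub> (2 ^ (m - 1) :: nat)"
  have zZ: "group_center (G\<lparr>carrier := P\<rparr>) = {\<one>, z}" using P.quaternion_center[OF q] by (simp add: z_def)
  have z: "z \<in> P" "z \<noteq> \<one>" "z \<otimes> z = \<one>" using P.quaternion_t[OF q] by (auto simp: z_def)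
  have zc: "z \<in> carrier G" using z(1) PG by blast
  have inv: "w = \<one> \<or> w = z" if "w \<in> P" "w \<otimes> w = \<one>" for w
    using P.quaternion_involution[OF q, of w] that by (simp add: z_def)
  have PQ: "x = \<one>" if "x \<in> P" "x \<in> Q" for x
  proof -
    have "x [^] card P = \<one>" "x [^] card Q = \<one>" using subgroup_pow_card sP sQ that by auto
    moreover have "coprime (card P) (card Q)" using cP N(2) by simp
    ultimately show ?thesis using pow_eq_one_coprime that(1) PG by blast
  qed
  have "order G = 2 ^ n * card Q" using lagrange[OF sQ] n by simp
  then have "multiplicity 2 (order G) = n"
    using N(2) by (intro multiplicity_eqI) (auto simp: mult.commute)
  then have cards: "card P = card (rcosets Q)" using cP n by simp
  have injP: "inj_on (\<lambda>w. Q #> w) P"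
  proof (rule inj_onI)
    fix x y assume xy: "x \<in> P" "y \<in> P" "Q #> x = Q #> y"
    then have "x \<otimes> inv y \<in> Q" using quot_eq[OF N(1)] PG by blast
    then have "x \<otimes> inv y = \<one>" using PQ xy sP by (simp add: subgroup.m_closed subgroup.m_inv_closed)
    then show "x = y" using xy PG by (metis inv_closed inv_inv inv_equality subsetD)
  qed
  have sub: "(\<lambda>w. Q #> w) ` P \<subseteq> rcosets Q" using PG by (auto simp: RCOSETS_def)
  have "finite (rcosets Q)" by (simp add: RCOSETS_def)
  then have surj: "(\<lambda>w. Q #> w) ` P = rcosets Q"
    using card_subset_eq[OF _ sub] card_image[OF injP] cards by simp
  have decomp: "\<exists>w\<in>P. y \<otimes> inv w \<in> Q" if y: "y \<in> carrier G" for y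
  proof -
    have "Q #> y \<in> rcosets Q" using y by (auto simp: RCOSETS_def)
    then obtain w where w: "w \<in> P" "Q #> y = Q #> w" using surj by blast
    then show ?thesis using quot_eq[OF N(1) y, of w] PG by blast
  qed
  interpret h: group_hom G "G Mod Q" "\<lambda>x. Q #> x" by (rule quot_hom[OF N(1)])
  have sq: "w \<otimes> w \<in> Q \<longleftrightarrow> y \<otimes> y \<in> Q" if "y \<in> carrier G" "w \<in> P" "y \<otimes> inv w \<in> Q" for y w
  proof -
    have wc: "w \<in> carrier G" using that(2) PG by blast
    have "Q #> y = Q #> w" using quot_eq[OF N(1) that(1) wc] that(3) by simp
    then have "Q #> (y \<otimes> y) = Q #> (w \<otimes> w)" using h.hom_mult[OF that(1) that(1)] h.hom_mult[OF wc wc] by simp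
    then show ?thesis using quot_eq_one[OF N(1)] that(1) wc by (metis m_closed)
  qed
  have zu: "unique_involution z"
  proof (rule unique_involution_lift[OF N zc z(2,3)])
    show "z \<otimes> n = n \<otimes> z" if "n \<in> Q" for n using zZ ZP that by (auto simp: centralizer_in_def)
    fix y assume y: "y \<in> carrier G" "y \<otimes> y \<in> Q"
    obtain w where w: "w \<in> P" "y \<otimes> inv w \<in> Q" using decomp[OF y(1)] by blast
    have "w \<otimes> w = \<one>" using PQ sq[OF y(1) w] y(2) subgroup.m_closed[OF sP w(1) w(1)] by blast
    then have "w = \<one> \<or> w = z" using inv w(1) by blast
    then show "y \<in> Q \<or> (\<exists>n\<in>Q. y = n \<otimes> z)"
    proof
      assume "w = \<one>" then show ?thesis using w(2) y(1) by simp
    next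
      assume "w = z"
      moreover have "y = (y \<otimes> inv z) \<otimes> z" using y(1) zc by (simp add: m_assoc)
      ultimately show ?thesis using w(2) by blast
    qed
  qed
  show ?thesis
  proof (rule two_part_cyclicizer[OF N zu])
    fix v assume v: "v \<in> group_center G"
    then have vc: "v \<in> carrier G" unfolding group_center_def by blast
    obtain w where w: "w \<in> P" "v \<otimes> inv w \<in> Q" using decomp[OF vc] by blast
    have wc: "w \<in> carrier G" using w(1) PG by blast
    have vw: "Q #> v = Q #> w" using quot_eq[OF N(1) vc wc] w(2) by simp
    have "w \<otimes> u = u \<otimes> w" if u: "u \<in> P" for u
    proof -
      have uc: "u \<in> carrier G" using u PG by blast
      have "v \<otimes> u = u \<otimes> v" using v uc unfolding group_center_def by blast
      then have "Q #> (w \<otimes> u) = Q #> (u \<otimes> w)"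
        using h.hom_mult[OF vc uc] h.hom_mult[OF uc vc] h.hom_mult[OF wc uc] h.hom_mult[OF uc wc] vw by simp
      then have "(w \<otimes> u) \<otimes> inv (u \<otimes> w) \<in> Q" using quot_eq[OF N(1), of "w \<otimes> u" "u \<otimes> w"] wc uc by simp
      moreover have "(w \<otimes> u) \<otimes> inv (u \<otimes> w) \<in> P" using w(1) u sP by (simp add: subgroup.m_closed subgroup.m_inv_closed)
      ultimately have "(w \<otimes> u) \<otimes> inv (u \<otimes> w) = \<one>" using PQ by blast
      then show ?thesis using wc uc by (metis inv_closed inv_equality inv_inv m_closed)
    qed
    then have "w \<in> group_center (G\<lparr>carrier := P\<rparr>)" using w(1) by (simp add: group_center_def)
    then have "w \<otimes> w = \<one>" using zZ z(3) by auto
    then show "v \<otimes> v \<in> Q" using sq[OF vc w] subgroup.one_closed[OF sQ] by simp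
  qed
qed

end


section \<open>Case (1), the quotient by the odd core, and the forward direction\<close>

context fin_group
begin

text \<open>The central subgroup of \<open>P\<close> contains some \<open>w\<close> of order
  \<open>p\<close>, which generates the only subgroup of order \<open>p\<close> of the cyclic group
  \<open>P\<close>. Any \<open>y\<close> of order \<open>p\<close> is conjugate to a power of
  \<open>w\<close>, and since \<open>w\<close> is central, \<open>y\<close> equals that
  power.\<close>

lemma case_1_dvd:
  assumes p: "Factorial_Ring.prime p" and P: "sylow_subgroup p P G" and cyc: "cyclic_group (G\<lparr>carrier := P\<rparr>)"
    and Z: "group_center G \<inter> P \<noteq> {\<one>}"
  shows "p dvd card (cyclicizer G)"
proof -
  have sP: "subgroup P G" and cP: "card P = p ^ multiplicity p (order G)" using P by (auto simp: sylow_subgroup_def)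
  have PG: "P \<subseteq> carrier G" by (rule subgroup.subset[OF sP])
  interpret P: fin_group "G\<lparr>carrier := P\<rparr>" by (rule fin_group_subgroup[OF sP])
  obtain a where a: "a \<in> P" "P = powers a" using cyc cyclic_group_subgroup_iff[OF sP] by blast
  have sZ: "subgroup (group_center G \<inter> P) G"
    using subgroups_Inter_pair[OF normal_imp_subgroup[OF group_center_normal] sP] .
  obtain j where j: "card (group_center G \<inter> P) = p ^ j"
    using card_subgroup_dvd_subgroup[OF sZ sP] cP p by (metis divides_primepow_nat inf_le2)
  have "card (group_center G \<inter> P) \<noteq> 1"
  proof
    assume "card (group_center G \<inter> P) = 1"
    then obtain x where "group_center G \<inter> P = {x}" by (rule card_1_singletonE)
    then show False using Z subgroup.one_closed[OF sZ] by simp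
  qed
  then have "p dvd card (group_center G \<inter> P)" using j by (cases j) auto
  then obtain w where w: "w \<in> group_center G \<inter> P" "w [^] p = \<one>" "w \<noteq> \<one>"
    using cauchy_subgroup[OF p sZ] by metis
  have wc: "w \<in> carrier G" using w(1) PG by blast
  have wo: "ord w = p" using prime_ord_iff[OF p wc] w by blast
  \<comment> \<open>A cyclic group is its own cyclicizer, so the characterization of prime divisors,
    applied inside \<open>P\<close>, yields the unique subgroup of order \<open>p\<close>.\<close>
  have "x \<in> cyclicizer (G\<lparr>carrier := P\<rparr>)" if "x \<in> P" for x
    unfolding P.cyclicizer_iff using that a powers_consistent[OF sP] by auto
  then have "cyclicizer (G\<lparr>carrier := P\<rparr>) = P" using P.cyclicizer_iff by auto
  moreover have "p dvd card P"
  proof -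
    have "w [^] card P = \<one>" using subgroup_pow_card[OF sP] w(1) by blast
    then show ?thesis using wo wc by (simp add: pow_eq_id)
  qed
  ultimately obtain z where z: "P.unique_prime_subgroup p z" using P.prime_dvd_card_cyclicizer_iff[OF p] by auto
  then have zP: "z \<in> P" "ord z = p" "\<And>y. y \<in> P \<Longrightarrow> y [^] p = \<one> \<Longrightarrow> y \<in> powers z"
    using powers_consistent[OF sP] ord_consistent[OF sP] by (auto simp: P.unique_prime_subgroup_def simp flip: nat_pow_consistent)
  have zc: "z \<in> carrier G" using zP PG by blast
  have "z \<in> powers w" using powers_eq_prime[OF p zc zP(2)] zP(3)[of w] w by blast
  then have zw: "powers z \<subseteq> powers w" using powers_trans[OF wc] by blast
  have "unique_prime_subgroup p w" unfolding unique_prime_subgroup_def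
  proof (intro conjI ballI impI wc wo)
    fix y assume y: "y \<in> carrier G" "y [^] p = \<one>"
    show "y \<in> powers w"
    proof (cases "y = \<one>")
      case False
      then have "ord y = p" using prime_ord_iff[OF p y(1)] y(2) by blast
      then have "card (powers y) = p ^ 1" using card_powers[OF y(1)] by simp
      then obtain g where g: "g \<in> carrier G" "\<forall>x\<in>powers y. conjugate g x \<in> P"
        using sylow_conjugate[OF p P powers_subgroup[OF y(1)]] by blast
      have "conjugate g y \<in> P" using g(2) powers_self[OF y(1)] by blast
      moreover have "conjugate g y [^] p = \<one>" using y g(1) by (simp flip: conjugate_pow)
      ultimately have "conjugate g y \<in> powers w" using zP(3) zw by blast
      then obtain k :: nat where k: "conjugate g y = w [^] k" by (auto simp: powers_def)
      have "w \<otimes> g = g \<otimes> w" using w(1) g(1) unfolding group_center_def by blast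
      then have "conjugate g w = w" using conjugate_eq_self_iff[OF g(1) wc] by simp
      then have "conjugate g (w [^] k) = conjugate g y" using k conjugate_pow[OF g(1) wc] by simp
      then have "y = w [^] k" using conjugate_eq_iff[OF g(1) _ y(1), of "w [^] k"] wc by simp
      then show ?thesis by simp
    qed simp
  qed
  then show ?thesis using prime_dvd_card_cyclicizer_iff[OF p] w(1) by blast
qed

text \<open>The preimage of a normal subgroup of odd order contains no involution: its image would
  be trivial, which places it in the odd core. So the preimage has odd order and is contained in the
  core.\<close>

lemma quot_odd_core_facts:
  assumes solv: "solvable G" and z: "unique_involution z"
  shows "fin_group (G Mod odd_core G)" "solvable (G Mod odd_core G)"
    "\<And>M. M \<lhd> (G Mod odd_core G) \<Longrightarrow> odd (card M) \<Longrightarrow> M = {\<one>\<^bsub>G Mod odd_core G\<^esub>}"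
    "group.unique_involution (G Mod odd_core G) (odd_core G #> z)"
proof -
  define N where "N = odd_core G"
  have N: "N \<lhd> G" "odd (card N)" and Nmax: "\<And>M. M \<lhd> G \<Longrightarrow> odd (card M) \<Longrightarrow> M \<subseteq> N"
    using odd_core[OF fin] by (simp_all add: N_def)
  have sN: "subgroup N G" by (rule normal_imp_subgroup[OF N(1)])
  have NG: "N \<subseteq> carrier G" by (rule subgroup.subset[OF sN])
  interpret Q: fin_group "G Mod N" by (rule quot_fin_group[OF N(1)])
  interpret h: group_hom G "G Mod N" "\<lambda>x. N #> x" by (rule quot_hom[OF N(1)])
  show "fin_group (G Mod odd_core G)" using Q.fin_group_axioms by (simp add: N_def)
  show "solvable (G Mod odd_core G)"
    using h.surj_hom_imp_solvable[OF _ solv] by (simp add: carrier_FactGroup N_def)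
  show "M = {\<one>\<^bsub>G Mod odd_core G\<^esub>}" if M: "M \<lhd> (G Mod odd_core G)" "odd (card M)" for M
  proof -
    have M': "M \<lhd> (G Mod N)" using M(1) by (simp add: N_def)
    have sM: "subgroup M (G Mod N)" by (rule normal_imp_subgroup[OF M'])
    define L where "L = {x \<in> carrier G. N #> x \<in> M}"
    have sL: "subgroup L G"
    proof (rule finite_subgroupI)
      show "\<one> \<in> L" using h.hom_one subgroup.one_closed[OF sM] by (simp add: L_def)
      fix x y assume "x \<in> L" "y \<in> L"
      then show "x \<otimes> y \<in> L" using subgroup.m_closed[OF sM] h.hom_mult[of x y] by (simp add: L_def)
    qed (auto simp: L_def)
    have "L \<lhd> G"
    proof (rule normalI_conjugate[OF sL])
      fix g x assume g: "g \<in> carrier G" and x: "x \<in> L"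
      have xc: "x \<in> carrier G" using x by (simp add: L_def)
      have "N #> conjugate g x = Q.conjugate (N #> g) (N #> x)"
        unfolding conjugate_def Q.conjugate_def using g xc h.hom_mult h.hom_inv by simp
      then show "conjugate g x \<in> L"
        using Q.conjugate_normal[OF M' h.hom_closed[OF g]] x g xc by (simp add: L_def)
    qed
    moreover have "odd (card L)"
    proof
      assume "even (card L)"
      then obtain u where u: "u \<in> L" "u [^] (2::nat) = \<one>" "u \<noteq> \<one>" using cauchy_subgroup[OF two_is_prime_nat sL] by metis
      have uc: "u \<in> carrier G" using u(1) by (simp add: L_def)
      have uu: "u \<otimes> u = \<one>" using u(2) pow_sq[OF uc] by simp
      then have "(N #> u) \<otimes>\<^bsub>G Mod N\<^esub> (N #> u) = \<one>\<^bsub>G Mod N\<^esub>" using h.hom_mult[OF uc uc] h.hom_one by simp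
      then have "N #> u = \<one>\<^bsub>G Mod N\<^esub>"
        using Q.odd_normal_square_trivial[OF sM M(2), of "N #> u"] u(1) by (simp add: L_def)
      then have "u \<in> N" using quot_eq_one[OF N(1) uc] by simp
      then show False using odd_normal_square_trivial[OF sN N(2)] uu u(3) by blast
    qed
    ultimately have LN: "L \<subseteq> N" using Nmax by blast
    have "M \<subseteq> {N}"
    proof
      fix U assume U: "U \<in> M"
      then obtain x where x: "x \<in> carrier G" "U = N #> x" using subgroup.subset[OF sM] by (auto simp: carrier_FactGroup)
      then have "x \<in> N" using U LN by (auto simp: L_def)
      then show "U \<in> {N}" using quot_eq_one[OF N(1) x(1)] x(2) by simp
    qed
    then show ?thesis using subgroup.one_closed[OF sM] by (auto simp: N_def)
  qed
  have zc: "z \<in> carrier G" and z1: "z \<noteq> \<one>" and zz: "z \<otimes> z = \<one>"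
    and zu: "\<And>y. y \<in> carrier G \<Longrightarrow> y \<otimes> y = \<one> \<Longrightarrow> y = \<one> \<or> y = z" using z by (auto simp: unique_involution_def)
  have "Q.unique_involution (N #> z)" unfolding Q.unique_involution_def
  proof (intro conjI ballI impI)
    show "N #> z \<in> carrier (G Mod N)" by (rule h.hom_closed[OF zc])
    show "N #> z \<noteq> \<one>\<^bsub>G Mod N\<^esub>"
      using quot_eq_one[OF N(1) zc] odd_normal_square_trivial[OF sN N(2) _ zz] z1 by auto
    show "(N #> z) \<otimes>\<^bsub>G Mod N\<^esub> (N #> z) = \<one>\<^bsub>G Mod N\<^esub>"
      using h.hom_mult[OF zc zc] h.hom_one zz by simp
    fix U assume U: "U \<in> carrier (G Mod N)" "U \<otimes>\<^bsub>G Mod N\<^esub> U = \<one>\<^bsub>G Mod N\<^esub>"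
    then obtain y where y: "y \<in> carrier G" "U = N #> y" by (auto simp: carrier_FactGroup)
    have yy: "y \<otimes> y \<in> N" using U(2) y h.hom_mult[OF y(1) y(1)] quot_eq_one[OF N(1), of "y \<otimes> y"] by simp
    obtain k where k: "card N = 2 * k + 1" using N(2) by (rule oddE)
    \<comment> \<open>The odd exponent \<open>card N\<close> kills \<open>y^2\<close> but leaves the
      coset of \<open>y\<close> unchanged, so every coset squaring to the identity contains an
      element squaring to 1.\<close>
    define w where "w = y [^] card N"
    have wc: "w \<in> carrier G" using y(1) by (simp add: w_def)
    have "w \<otimes> w = (y \<otimes> y) [^] card N" using y(1) by (simp add: w_def pow_mult_distrib)
    then have "w \<otimes> w = \<one>" using subgroup_pow_card[OF sN yy] by simp
    then have w: "w = \<one> \<or> w = z" using zu wc by blast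
    have "w = (y \<otimes> y) [^] k \<otimes> y"
      using y(1) by (simp add: w_def k pow_sq flip: nat_pow_pow nat_pow_mult)
    then have "w \<otimes> inv y \<in> N" using subgroup_pow_closed[OF sN yy] y(1) by (simp add: m_assoc)
    then have "N #> w = U" using quot_eq[OF N(1) wc y(1)] y(2) by simp
    then show "U = \<one>\<^bsub>G Mod N\<^esub> \<or> U = N #> z" using w h.hom_one by auto
  qed
  then show "group.unique_involution (G Mod odd_core G) (odd_core G #> z)" by (simp add: N_def)
qed

text \<open>In order 48 the relations give isoclinism only. The Sylow 2-subgroup decides: its
  involution is unique and it contains the noncommuting \<open>i\<close> and \<open>j\<close>, so it
  is generalized quaternion.\<close>

lemma core_free_structure:
  assumes solv: "solvable G" and no_odd: "\<And>N. N \<lhd> G \<Longrightarrow> odd (card N) \<Longrightarrow> N = {\<one>}"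
    and t: "unique_involution t" and not2: "\<not> (\<exists>k. order G = 2 ^ k)"
  shows "G \<cong> SL\<^sub>2_3 \<or> is_GL\<^sub>2_3_tilde G"
proof -
  obtain F where F: "F \<lhd> G" and ord: "order G = 24 \<or> order G = 48" and exc: "\<exists>c. odd_element c \<and> c \<noteq> \<one>"
    and all: "\<forall>c. odd_element c \<and> c \<noteq> \<one> \<longrightarrow> (\<exists>i j. quaternion_on F i j 2 \<and> i \<otimes> i = t \<and> j \<otimes> j = t \<and>
      j \<otimes> i = t \<otimes> i \<otimes> j \<and> c [^] (3::nat) = \<one> \<and> conjugate c i = j \<and> conjugate c j = i \<otimes> j \<and>
      (order G = 48 \<longrightarrow> (\<exists>d\<in>carrier G. conjugate d i = inv j \<and> conjugate d j = inv i \<and> conjugate d c = inv c)))"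
    by (rule quaternion_8_core_structure[OF solv _ t not2]) (erule (1) no_odd, blast)
  obtain c where c: "odd_element c" "c \<noteq> \<one>" using exc by blast
  then obtain i j where q: "quaternion_on F i j 2" and r: "i \<otimes> i = t" "j \<otimes> j = t" "j \<otimes> i = t \<otimes> i \<otimes> j"
    "c [^] (3::nat) = \<one>" "conjugate c i = j" "conjugate c j = i \<otimes> j"
    and d: "order G = 48 \<longrightarrow> (\<exists>d\<in>carrier G. conjugate d i = inv j \<and> conjugate d j = inv i \<and> conjugate d c = inv c)"
    using all by blast
  note f = quaternion_on_facts[OF q]
  have cc: "c \<in> carrier G" using c(1) by (simp add: odd_element_def)
  have tf: "t \<in> carrier G" "t \<noteq> \<one>" "t \<otimes> t = \<one>" using t by (auto simp: unique_involution_def)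
  have conj_swap: "g \<otimes> x = y \<otimes> g" if "conjugate g x = y" "g \<in> carrier G" "x \<in> carrier G" for g x y
    using that by (auto simp: conjugate_def m_assoc)
  have sl: "sl_relations G i j t c"
    unfolding sl_relations_def
    using f(9,10) tf(1,3) cc r conj_swap[OF r(5) cc f(9)] conj_swap[OF r(6) cc f(10)]
    by (simp add: m_assoc numeral_eq_Suc)
  show ?thesis
  proof (cases "order G = 48")
    case False
    then have "order G \<le> 24" using ord by simp
    then show ?thesis
      using sl_relations_iso[OF fin_group_axioms fin_group_SL sl tf(2) c(2) _ sl_relations_SL _ _ order_SL_le] mat_nontrivial
      by (simp add: SL_def)
  next
    case True
    then obtain d where d: "d \<in> carrier G" "conjugate d i = inv j" "conjugate d j = inv i" "conjugate d c = inv c"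
      using d by blast
    have gl: "gl_relations G i j t c d"
      unfolding gl_relations_def
      using sl d(1) conj_swap[OF d(2) d(1) f(9)] conj_swap[OF d(3) d(1) f(10)] conj_swap[OF d(4) d(1) cc] by blast
    have iso: "isoclinic G GL\<^sub>2_3"
      using gl_relations_isoclinic[OF fin_group_axioms fin_group_GL gl tf(2) c(2) _ gl_relations_GL _ _ order_GL_le] mat_nontrivial True
      by (simp add: GL_def)
    obtain S where S: "sylow_subgroup 2 S G" using sylow_exists[OF two_is_prime_nat] .
    have sS: "subgroup S G" using S by (simp add: sylow_subgroup_def)
    have SG: "S \<subseteq> carrier G" by (rule subgroup.subset[OF sS])
    have "multiplicity 2 (order G) = 4"
      unfolding True by (intro multiplicity_eqI) simp_all
    then have cS: "card S = 16" using S by (simp add: sylow_subgroup_def)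
    interpret S: fin_group "G\<lparr>carrier := S\<rparr>" by (rule fin_group_subgroup[OF sS])
    have "card F = 2 ^ 3" using quaternion_on_card[OF q] by simp
    then have FS: "F \<subseteq> S" using normal_p_subgroup_subset_sylow[OF two_is_prime_nat S F] by blast
    then have ijS: "i \<in> S" "j \<in> S" using f by auto
    then have tS: "t \<in> S" using r(1) sS subgroup.m_closed by metis
    have "S.unique_involution t" using t tS SG unfolding unique_involution_def S.unique_involution_def by auto
    then have "S.unique_prime_subgroup 2 t" using S.unique_prime_subgroup_2_iff by blast
    moreover have "order (G\<lparr>carrier := S\<rparr>) = 2 ^ 4" using cS by (simp add: order_def)
    ultimately have "(\<exists>a\<in>S. S = powers a) \<or> (\<exists>a b m. S.quaternion_pair a b m)"
      using S.unique_prime_subgroup_classification[OF two_is_prime_nat, of 4 t] powers_consistent[OF sS] by simp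
    then consider a where "a \<in> S" "S = powers a" | a b m where "S.quaternion_pair a b m" by blast
    then have "generalized_quaternion (G\<lparr>carrier := S\<rparr>)"
    proof cases
      case 1
      then have "j \<otimes> i = i \<otimes> j" using powers_abelian[of a j i] ijS SG by blast
      then have "t \<otimes> (i \<otimes> j) = \<one> \<otimes> (i \<otimes> j)" using r(3) f(9,10) tf(1) by (simp add: m_assoc)
      then have "t = \<one>" using right_cancel[of "i \<otimes> j" t \<one>] f(9,10) tf(1) by simp
      then show ?thesis using tf(2) by simp
    next
      case 2 then show ?thesis by (rule S.quaternion_pair_imp_generalized_quaternion)
    qed
    then show ?thesis using True iso S cS is_group unfolding is_GL\<^sub>2_3_tilde_def by blast
  qed
qed

text \<open>\<open>P\<close> contains an element of order \<open>p\<close>, which generates the same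
  subgroup as \<open>z\<close>. Uniqueness is inherited by \<open>P\<close>, and the classification
  of such \<open>p\<close>-groups applies.\<close>

lemma sylow_of_cyclicizer_prime:
  assumes p: "Factorial_Ring.prime p" and P: "sylow_subgroup p P G" and z: "unique_prime_subgroup p z"
  shows "z \<in> P" "(\<exists>a\<in>P. P = powers a) \<or> (p = 2 \<and> generalized_quaternion (G\<lparr>carrier := P\<rparr>))"
proof -
  have sP: "subgroup P G" and cP: "card P = p ^ multiplicity p (order G)" using P by (auto simp: sylow_subgroup_def)
  have PG: "P \<subseteq> carrier G" by (rule subgroup.subset[OF sP])
  interpret P: fin_group "G\<lparr>carrier := P\<rparr>" by (rule fin_group_subgroup[OF sP])
  have zc: "z \<in> carrier G" and zo: "ord z = p" and zu: "\<And>y. y \<in> carrier G \<Longrightarrow> y [^] p = \<one> \<Longrightarrow> y \<in> powers z"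
    using z by (auto simp: unique_prime_subgroup_def)
  have "p dvd order G" using ord_dvd_group_order[OF zc] zo by simp
  then have "multiplicity p (order G) \<noteq> 0" using p order_pos by (auto simp: multiplicity_eq_zero_iff prime_nat_iff)
  then have "p dvd card P" using cP by simp
  then obtain u where u: "u \<in> P" "u [^] p = \<one>" "u \<noteq> \<one>" using cauchy_subgroup[OF p sP] by metis
  have "u \<in> powers z" using zu u PG by blast
  then have "z \<in> powers u" using powers_eq_prime[OF p zc zo] u(3) by blast
  then show zP: "z \<in> P" using powers_subset[OF sP u(1)] by blast
  have "P.unique_prime_subgroup p z"
    using zP zo zu PG powers_consistent[OF sP] ord_consistent[OF sP]
    by (auto simp: P.unique_prime_subgroup_def simp flip: nat_pow_consistent)
  then have "(\<exists>a\<in>P. P = powers a) \<or> (p = 2 \<and> (\<exists>a b m. P.quaternion_pair a b m))"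
    using P.unique_prime_subgroup_classification[OF p, of "multiplicity p (order G)"] cP powers_consistent[OF sP]
    by (simp add: order_def)
  then show "(\<exists>a\<in>P. P = powers a) \<or> (p = 2 \<and> generalized_quaternion (G\<lparr>carrier := P\<rparr>))"
    using P.quaternion_pair_imp_generalized_quaternion by blast
qed

text \<open>The contradiction is one of exponents. Some \<open>e\<close> normalizes the Sylow
  subgroup \<open>R\<close>, generated by \<open>x\<close>, acting by \<open>x -> x^s\<close>. It
  fixes the central element \<open>r\<close> of order 3, so \<open>s = 1\<close> modulo 3; it
  inverts the image \<open>c\<close> of \<open>x\<close>, also of order 3, so \<open>s = -1\<close>
  modulo 3.\<close>

lemma GL_tilde_not_3_dvd:
  assumes solv: "solvable G" and z: "unique_involution z" and o48: "order (G Mod odd_core G) = 48"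
  shows "\<not> 3 dvd card (cyclicizer G)"
proof
  assume "3 dvd card (cyclicizer G)"
  have p3: "Factorial_Ring.prime (3::nat)" by simp
  then obtain r where rZ: "r \<in> group_center G" and r: "unique_prime_subgroup 3 r"
    using prime_dvd_card_cyclicizer_iff \<open>3 dvd card (cyclicizer G)\<close> by blast
  have rc: "r \<in> carrier G" and ro: "ord r = 3" using r by (auto simp: unique_prime_subgroup_def)
  define N where "N = odd_core G"
  have N: "N \<lhd> G" "odd (card N)" using odd_core[OF fin] by (simp_all add: N_def)
  have sN: "subgroup N G" by (rule normal_imp_subgroup[OF N(1)])
  interpret Q: fin_group "G Mod N" by (rule quot_fin_group[OF N(1)])
  interpret h: group_hom G "G Mod N" "\<lambda>x. N #> x" by (rule quot_hom[OF N(1)])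
  have hconj: "N #> conjugate g x = Q.conjugate (N #> g) (N #> x)" if "g \<in> carrier G" "x \<in> carrier G" for g x
    unfolding conjugate_def Q.conjugate_def using that h.hom_mult h.hom_inv by simp
  have hpow: "N #> (x [^] (k::nat)) = (N #> x) [^]\<^bsub>G Mod N\<^esub> k" if "x \<in> carrier G" for x k
    using h.hom_nat_pow[OF that] .
  note qf = quot_odd_core_facts[OF solv z, folded N_def]
  have o48': "order (G Mod N) = 48" using o48 by (simp add: N_def)
  have not2: "\<not> (\<exists>k. order (G Mod N) = 2 ^ k)"
  proof
    assume "\<exists>k. order (G Mod N) = 2 ^ k"
    then obtain k where "(48::nat) = 2 ^ k" using o48' by auto
    moreover have "3 dvd (48::nat)" by simp
    ultimately have "3 dvd (2::nat) ^ k" by (simp only:)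
    then have "3 dvd (2::nat)" using p3 prime_dvd_power by blast
    then show False by simp
  qed
  obtain R where R: "sylow_subgroup 3 R G" using sylow_exists[OF p3] .
  have sR: "subgroup R G" and cR: "card R = 3 ^ multiplicity 3 (order G)" using R by (auto simp: sylow_subgroup_def)
  have RG: "R \<subseteq> carrier G" by (rule subgroup.subset[OF sR])
  obtain x where x: "x \<in> R" "R = powers x" using sylow_of_cyclicizer_prime(2)[OF p3 R r] by auto
  have rR: "r \<in> R" using sylow_of_cyclicizer_prime(1)[OF p3 R r] .
  have xc: "x \<in> carrier G" using x RG by blast
  define c where "c = N #> x"
  have cc: "c \<in> carrier (G Mod N)" using h.hom_closed[OF xc] by (simp add: c_def)
  have xpow: "x [^] (3 ^ multiplicity 3 (order G) :: nat) = \<one>" using subgroup_pow_card[OF sR x(1)] cR by simp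
  have "c [^]\<^bsub>G Mod N\<^esub> (3 ^ multiplicity 3 (order G) :: nat) = \<one>\<^bsub>G Mod N\<^esub>"
    using hpow[OF xc, of "3 ^ multiplicity 3 (order G)"] xpow h.hom_one by (simp add: c_def)
  then have codd: "Q.odd_element c" using cc unfolding Q.odd_element_def by (metis even_power even_numeral odd_numeral)
  \<comment> \<open>Otherwise \<open>R\<close> lies in \<open>N\<close>; as 3 divides the index 48,
    this gives a power of 3 dividing \<open>|G|\<close> that is too large.\<close>
  have c1: "c \<noteq> \<one>\<^bsub>G Mod N\<^esub>"
  proof
    assume "c = \<one>\<^bsub>G Mod N\<^esub>"
    then have "x \<in> N" using quot_eq_one[OF N(1) xc] by (simp add: c_def)
    then have "R \<subseteq> N" using powers_subset[OF sN] x(2) by simp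
    then have "card R dvd card N" by (rule card_subgroup_dvd_subgroup[OF sR sN])
    then have "3 * card R dvd 48 * card N" by (intro mult_dvd_mono) simp_all
    then have "3 * card R dvd order G" using order_quot[OF N(1)] o48' by (simp only:)
    then have "3 ^ Suc (multiplicity 3 (order G)) dvd order G" using cR by simp
    then have "Suc (multiplicity 3 (order G)) \<le> multiplicity 3 (order G)"
      by - (rule multiplicity_geI, use order_pos in auto)
    then show False by simp
  qed
  obtain F where all: "\<forall>c. Q.odd_element c \<and> c \<noteq> \<one>\<^bsub>G Mod N\<^esub> \<longrightarrow> (\<exists>i j. Q.quaternion_on F i j 2 \<and>
      i \<otimes>\<^bsub>G Mod N\<^esub> i = N #> z \<and> j \<otimes>\<^bsub>G Mod N\<^esub> j = N #> z \<and>
      j \<otimes>\<^bsub>G Mod N\<^esub> i = (N #> z) \<otimes>\<^bsub>G Mod N\<^esub> i \<otimes>\<^bsub>G Mod N\<^esub> j \<and> c [^]\<^bsub>G Mod N\<^esub> (3::nat) = \<one>\<^bsub>G Mod N\<^esub> \<and> Q.conjugate c i = j \<and>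
      Q.conjugate c j = i \<otimes>\<^bsub>G Mod N\<^esub> j \<and>
      (order (G Mod N) = 48 \<longrightarrow> (\<exists>d\<in>carrier (G Mod N). Q.conjugate d i = inv\<^bsub>G Mod N\<^esub> j \<and> Q.conjugate d j = inv\<^bsub>G Mod N\<^esub> i \<and> Q.conjugate d c = inv\<^bsub>G Mod N\<^esub> c)))"
    by (rule Q.quaternion_8_core_structure[OF qf(2) _ qf(4) not2]) (erule (1) qf(3), blast)
  then obtain D where c3: "c [^]\<^bsub>G Mod N\<^esub> (3::nat) = \<one>\<^bsub>G Mod N\<^esub>" and D: "D \<in> carrier (G Mod N)" "Q.conjugate D c = inv\<^bsub>G Mod N\<^esub> c"
    using codd c1 o48' by blast
  obtain d where d: "d \<in> carrier G" "D = N #> d" using D(1) by (auto simp: carrier_FactGroup)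
  \<comment> \<open>Frattini argument in the preimage \<open>M\<close> of \<open>\<langle>c\<rangle>\<close>.\<close>
  define M where "M = {g \<in> carrier G. N #> g \<in> Q.powers c}"
  have spc: "subgroup (Q.powers c) (G Mod N)" using cc by simp
  have sM: "subgroup M G"
  proof (rule finite_subgroupI)
    show "\<one> \<in> M" using h.hom_one subgroup.one_closed[OF spc] by (simp add: M_def)
    fix u v assume "u \<in> M" "v \<in> M"
    then show "u \<otimes> v \<in> M" using subgroup.m_closed[OF spc] h.hom_mult[of u v] by (simp add: M_def)
  qed (auto simp: M_def)
  have xM: "x \<in> M" using xc cc by (simp add: M_def flip: c_def)
  have RM: "R \<subseteq> M" using powers_subset[OF sM xM] x(2) by simp
  interpret M: fin_group "G\<lparr>carrier := M\<rparr>" by (rule fin_group_subgroup[OF sM])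
  have "multiplicity 3 (card M) = multiplicity 3 (order G)"
  proof (rule antisym)
    show "multiplicity 3 (card M) \<le> multiplicity 3 (order G)"
      using card_subgroup_dvd[OF sM] order_pos by (intro dvd_imp_multiplicity_le) auto
    show "multiplicity 3 (order G) \<le> multiplicity 3 (card M)"
      using card_subgroup_dvd_subgroup[OF sR sM RM] cR card_subgroup_pos[OF sM] by (intro multiplicity_geI) auto
  qed
  then have sylM: "sylow_subgroup 3 R (G\<lparr>carrier := M\<rparr>)"
    using cR subgroup_incl[OF sR sM RM] by (simp add: sylow_subgroup_def order_def)
  have dxM: "conjugate d x \<in> M"
  proof -
    have "N #> conjugate d x = inv\<^bsub>G Mod N\<^esub> c" using hconj[OF d(1) xc] D(2) d(2) by (simp add: c_def)
    then show ?thesis using subgroup.m_inv_closed[OF spc Q.powers_self[OF cc]] d(1) xc by (simp add: M_def)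
  qed
  have dxc: "conjugate d x \<in> carrier G" using d(1) xc by simp
  have "card (powers (conjugate d x)) = card R"
  proof -
    have "ord (conjugate d x) = ord x"
      using ord_unique[OF dxc, of "ord x"] pow_eq_id[OF xc] conjugate_pow[OF d(1) xc] conjugate_eq_iff[OF d(1) _ one_closed] d(1) xc
      by (metis conjugate_one(1) nat_pow_closed)
    then show ?thesis using card_powers[OF dxc] card_powers[OF xc] x(2) by simp
  qed
  then have cdx: "card (powers (conjugate d x)) = 3 ^ multiplicity 3 (order G)" using cR by simp
  have "subgroup (powers (conjugate d x)) (G\<lparr>carrier := M\<rparr>)"
    using subgroup_incl[OF powers_subgroup[OF dxc] sM] powers_subset[OF sM dxM] by blast
  then obtain m where m: "m \<in> M" "\<forall>y\<in>powers (conjugate d x). M.conjugate m y \<in> R"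
    using M.sylow_conjugate[OF p3 sylM _ cdx] by auto
  have mc: "m \<in> carrier G" using m(1) by (simp add: M_def)
  have mdx: "conjugate m (conjugate d x) \<in> R"
    using m(2) powers_self[OF dxc] conjugate_consistent[OF sM m(1) dxM] by metis
  \<comment> \<open>\<open>m\<close> carries the conjugate of \<open>x\<close> by \<open>d\<close>
    back into \<open>R\<close>. Its image lies in \<open>Q.powers c\<close> and commutes with
    \<open>c\<close>, so \<open>e\<close> still inverts \<open>c\<close>.\<close>
  define e where "e = m \<otimes> d"
  have ec: "e \<in> carrier G" using mc d(1) by (simp add: e_def)
  have exR: "conjugate e x \<in> R" using mdx conjugate_conjugate[OF mc d(1) xc] by (simp add: e_def)
  then obtain s :: nat where s: "conjugate e x = x [^] s" using x(2) by (auto simp: powers_def)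
  have "N #> conjugate e x = inv\<^bsub>G Mod N\<^esub> c"
  proof -
    have mP: "N #> m \<in> Q.powers c" using m(1) by (simp add: M_def)
    have ic: "inv\<^bsub>G Mod N\<^esub> c \<in> Q.powers c" using subgroup.m_inv_closed[OF spc Q.powers_self[OF cc]] .
    have "N #> conjugate e x = Q.conjugate (N #> m) (inv\<^bsub>G Mod N\<^esub> c)"
      using hconj[OF mc dxc] hconj[OF d(1) xc] D(2) d(2) conjugate_conjugate[OF mc d(1) xc] by (simp add: e_def c_def)
    also have "\<dots> = inv\<^bsub>G Mod N\<^esub> c"
      using Q.conjugate_eq_self_iff[OF h.hom_closed[OF mc] Q.inv_closed[OF cc]] Q.powers_abelian[OF cc mP ic] by simp
    finally show ?thesis .
  qed
  then have cs: "c [^]\<^bsub>G Mod N\<^esub> s = inv\<^bsub>G Mod N\<^esub> c" using s hpow[OF xc] by (simp add: c_def)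
  obtain l :: nat where l: "r = x [^] l" using rR x(2) by (auto simp: powers_def)
  have "r \<otimes> e = e \<otimes> r" using rZ ec unfolding group_center_def by blast
  then have "conjugate e r = r" using conjugate_eq_self_iff[OF ec rc] by simp
  moreover have "conjugate e r = r [^] s"
    using l s conjugate_pow[OF ec xc] xc by (simp add: nat_pow_pow mult.commute)
  ultimately have "r [^] s = r [^] (1::nat)" using rc by simp
  then have "[s = 1] (mod 3)" using pow_eq_pow_iff[OF rc] ro by metis
  moreover have "Q.ord c = 3" using Q.prime_ord_iff[OF p3 cc] c3 c1 by blast
  ultimately have "c [^]\<^bsub>G Mod N\<^esub> s = c [^]\<^bsub>G Mod N\<^esub> (1::nat)" using Q.pow_eq_pow_iff[OF cc] by metis
  then have "c = inv\<^bsub>G Mod N\<^esub> c" using cs Q.nat_pow_eone[OF cc] by metis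
  then have "c \<otimes>\<^bsub>G Mod N\<^esub> c = \<one>\<^bsub>G Mod N\<^esub>" using Q.r_inv[OF cc] by metis
  then have "c [^]\<^bsub>G Mod N\<^esub> (2 ^ 1 :: nat) = \<one>\<^bsub>G Mod N\<^esub>" using Q.pow_sq[OF cc] by simp
  then show False using Q.odd_element_square_trivial[OF codd] c1 by blast
qed

end

theorem theorem1:
  fixes G :: "('a, 'b) monoid_scheme" and p :: nat and P :: "'a set"
  assumes "group G" and "finite (carrier G)" and "solvable G"
    and "Factorial_Ring.prime p" and "sylow_subgroup p P G"
  shows "let
      case_1 = (cyclic_group (G\<lparr>carrier := P\<rparr>) \<and> group_center G \<inter> P \<noteq> {\<one>\<^bsub>G\<^esub>});
      case_2a = (generalized_quaternion (G\<lparr>carrier := P\<rparr>) \<and>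
        (\<exists>Q. normal_two_complement Q G \<and>
             group_center (G\<lparr>carrier := P\<rparr>) \<subseteq> centralizer_in G P Q));
      case_2b = (group_center (G\<lparr>carrier := P\<rparr>) \<subseteq> centralizer_in G P (odd_core G) \<and>
        ((G Mod odd_core G) \<cong> SL\<^sub>2_3 \<or> is_GL\<^sub>2_3_tilde (G Mod odd_core G)));
      case_2 = (p = 2 \<and> (case_2a \<or> case_2b))
    in
      (p dvd card (cyclicizer G) \<longleftrightarrow> case_1 \<or> case_2) \<and>
      (p = 2 \<and> case_2b \<and> 3 dvd card (cyclicizer G) \<longrightarrow> (G Mod odd_core G) \<cong> SL\<^sub>2_3) \<and>
      (case_2 \<longrightarrow> 2 ^ multiplicity 2 (card (cyclicizer G)) = (2::nat))"
proof -
  interpret fin_group G using assms(1,2) by (simp add: fin_group_def fin_group_axioms_def)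
  note solv = assms(3) and p = assms(4) and P = assms(5)
  have sP: "subgroup P G" using P by (simp add: sylow_subgroup_def)
  have PG: "P \<subseteq> carrier G" by (rule subgroup.subset[OF sP])
  define case_1 where "case_1 = (cyclic_group (G\<lparr>carrier := P\<rparr>) \<and> group_center G \<inter> P \<noteq> {\<one>\<^bsub>G\<^esub>})"
  define case_2a where "case_2a = (generalized_quaternion (G\<lparr>carrier := P\<rparr>) \<and>
        (\<exists>Q. normal_two_complement Q G \<and>
             group_center (G\<lparr>carrier := P\<rparr>) \<subseteq> centralizer_in G P Q))"
  define case_2b where "case_2b = (group_center (G\<lparr>carrier := P\<rparr>) \<subseteq> centralizer_in G P (odd_core G) \<and>
        ((G Mod odd_core G) \<cong> SL\<^sub>2_3 \<or> is_GL\<^sub>2_3_tilde (G Mod odd_core G)))"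
  have back2: "2 dvd card (cyclicizer G) \<and> 2 ^ multiplicity 2 (card (cyclicizer G)) = (2::nat)"
    if p2: "p = 2" and c: "case_2a \<or> case_2b"
  proof -
    have P2: "sylow_subgroup 2 P G" using P p2 by simp
    show ?thesis
      using c case_2a_two_part[OF P2] case_2b_two_part[OF P2] unfolding case_2a_def case_2b_def by blast
  qed
  have three: "(G Mod odd_core G) \<cong> SL\<^sub>2_3" if p2: "p = 2" and c: "case_2b" and d3: "3 dvd card (cyclicizer G)"
  proof (rule ccontr)
    assume "\<not> (G Mod odd_core G) \<cong> SL\<^sub>2_3"
    then have "order (G Mod odd_core G) = 48" using c by (auto simp: case_2b_def is_GL\<^sub>2_3_tilde_def)
    moreover obtain z where "unique_involution z"
      using back2[OF p2] c prime_dvd_card_cyclicizer_iff[OF two_is_prime_nat] unique_prime_subgroup_2_iff by blast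
    ultimately show False using GL_tilde_not_3_dvd[OF solv] d3 by blast
  qed
  have fwd: "case_1 \<or> (p = 2 \<and> (case_2a \<or> case_2b))" if "p dvd card (cyclicizer G)"
  proof -
    obtain z where zZ: "z \<in> group_center G" and z: "unique_prime_subgroup p z"
      using prime_dvd_card_cyclicizer_iff[OF p] \<open>p dvd card (cyclicizer G)\<close> by blast
    have zP: "z \<in> P" by (rule sylow_of_cyclicizer_prime(1)[OF p P z])
    have z1: "z \<noteq> \<one>\<^bsub>G\<^esub>" using z p ord_id by (auto simp: unique_prime_subgroup_def prime_nat_iff)
    from sylow_of_cyclicizer_prime(2)[OF p P z] show ?thesis
    proof
      assume "\<exists>a\<in>P. P = powers a"
      then have "cyclic_group (G\<lparr>carrier := P\<rparr>)" using cyclic_group_subgroup_iff[OF sP] by blast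
      then show ?thesis using zZ zP z1 by (auto simp: case_1_def)
    next
      assume gq: "p = 2 \<and> generalized_quaternion (G\<lparr>carrier := P\<rparr>)"
      then have zi: "unique_involution z" using z unique_prime_subgroup_2_iff by simp
      interpret P: fin_group "G\<lparr>carrier := P\<rparr>" by (rule fin_group_subgroup[OF sP])
      obtain a b m where q: "P.quaternion_pair a b m" using P.generalized_quaternion_imp_quaternion_pair gq by blast
      define t where "t = a [^]\<^bsub>G\<lparr>carrier := P\<rparr>\<^esub> (2 ^ (m - 1) :: nat)"
      have t: "t \<in> P" "t \<noteq> \<one>\<^bsub>G\<^esub>" "t \<otimes>\<^bsub>G\<^esub> t = \<one>\<^bsub>G\<^esub>" using P.quaternion_t[OF q] by (auto simp: t_def)
      \<comment> \<open>The involution of \<open>P\<close> produced by the quaternion structure is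
        the unique involution of \<open>G\<close>, so the center of \<open>P\<close> is central in
        \<open>G\<close> and the centralizer conditions follow.\<close>
      have "t = z" using zi t PG by (auto simp: unique_involution_def)
      then have ZP: "group_center (G\<lparr>carrier := P\<rparr>) = {\<one>\<^bsub>G\<^esub>, z}" using P.quaternion_center[OF q] by (simp add: t_def)
      have cent: "group_center (G\<lparr>carrier := P\<rparr>) \<subseteq> centralizer_in G P S" if "S \<subseteq> carrier G" for S
        unfolding ZP using that zZ zP subgroup.one_closed[OF sP] unfolding centralizer_in_def group_center_def by auto
      have N: "odd_core G \<lhd> G" "odd (card (odd_core G))" using odd_core[OF fin] by simp_all
      have centN: "group_center (G\<lparr>carrier := P\<rparr>) \<subseteq> centralizer_in G P (odd_core G)"
        by (rule cent[OF subgroup.subset[OF normal_imp_subgroup[OF N(1)]]])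
      note qf = quot_odd_core_facts[OF solv zi]
      \<comment> \<open>When the quotient is a 2-group, the odd core itself is the required normal
        2-complement, which is case (2a); otherwise the structure theorem gives case (2b).\<close>
      show ?thesis
      proof (cases "\<exists>k. order (G Mod odd_core G) = 2 ^ k")
        case True
        then have "normal_two_complement (odd_core G) G"
          using N by (simp add: normal_two_complement_def order_def FactGroup_def)
        then show ?thesis using gq centN by (auto simp: case_2a_def)
      next
        case False
        have "(G Mod odd_core G) \<cong> SL\<^sub>2_3 \<or> is_GL\<^sub>2_3_tilde (G Mod odd_core G)"
          by (rule fin_group.core_free_structure[OF qf(1,2) _ qf(4) False]) (erule (1) qf(3))
        then show ?thesis using gq centN by (auto simp: case_2b_def)
      qed
    qed
  qed
  have back1: "p dvd card (cyclicizer G)" if "case_1" using case_1_dvd[OF p P] that by (auto simp: case_1_def)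
  show ?thesis
    unfolding Let_def case_1_def[symmetric] case_2a_def[symmetric] case_2b_def[symmetric]
    using fwd back1 back2 three by blast
qed

end
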